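(* Let $\mathcal{C}$ be a permutation class and $k$ a positive integer. The following are equivalent. (1) There is a $\mathsf{TOTO}$ formula $\phi(x_1,\dots,x_k)$ such that for all $\sigma\in\mathcal{C}$ and all sequences $\mathbf{a}=(a_1,\dots,a_k)$ of elements of $\sigma$, $(\sigma,\mathbf{a})\models\phi$ if and only if $\mathbf{a}$ is a union of cycles of $\sigma$ (that is, $a_1,\dots,a_k$ are distinct and the set of their positions is mapped to itself by $\sigma$). (2) For each permutation $\pi$ of size $k$, for each non-trivial cycle $\mathbf{i}$ of distinct elements of $[k+1]$, and for each sequence $\overline{\mathcal{X}}$ of the same length as $\mathbf{i}$ whose terms are $\mathcal{I}$ or $\mathcal{D}$, the class $\mathcal{C}$ avoids at least one permutation of $E(\pi,\mathbf{i},\overline{\mathcal{X}})$.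
   Context: Permutations are viewed as finite structures with domain $A^\sigma=\{(i,\sigma(i))\}$, position order $<_P$ (first coordinates) and value order $<_V$ (second coordinates); $\mathsf{TOTO}$ is first-order logic with equality over $\{<_P,<_V\}$. A permutation class is a set of permutations closed under taking patterns; $\mathcal{I}$ and $\mathcal{D}$ are the classes of increasing and of decreasing permutations. An occurrence of $\pi\in S_k$ in $\sigma$ is a sequence $\mathbf{s}=(s_1,\dots,s_k)$ of elements of $\sigma$ with $s_1<_P\dots<_P s_k$ whose pattern is $\pi$; it is stable if the set of positions of $s_1,\dots,s_k$ is mapped to itself by $\sigma$. An occurrence $\mathbf{s}$ partitions the remaining elements of $\sigma$ into $(k+1)^2$ cells: two elements are in the same cell iff they compare identically with each $s_j$ in both orders; cells form a $(k+1)\times(k+1)$ grid (columns by position relative to $\mathbf{s}$, rows by value, rows indexed bottom to top). $A(\sigma,\mathbf{s})$ is the matrix whose $(i,j)$ entry is the number of elements in the cell in row $i$, column $j$. For a sequence $\mathbf{i}=(i_1,\dots,i_r)$ of distinct elements of $[k+1]$, $A_{\mathbf{i}}$ is the $(k+1)\times(k+1)$ 0/1 matrix with $1$'s exactly at $(i_t,i_{t+1})$, $1\le t<r$, and $(i_r,i_1)$; $\mathbf{i}$ is non-trivial if $r\ge2$. The expansion $E(\pi,\mathbf{i})$ is the permutation of length $k+r$ containing a stable occurrence $\mathbf{s}$ of $\pi$ with $A(E(\pi,\mathbf{i}),\mathbf{s})=A_{\mathbf{i}}$. For permutations $\Theta=(\theta_1,\dots,\theta_r)$, $E(\pi,\mathbf{i},\Theta)$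 is obtained by inflating the $r$ points of $E(\pi,\mathbf{i})$ not in $\mathbf{s}$, in left-to-right order, by $\theta_1,\dots,\theta_r$. For classes $\overline{\mathcal{X}}=(\mathcal{X}_1,\dots,\mathcal{X}_r)$, $E(\pi,\mathbf{i},\overline{\mathcal{X}})$ is the class of all patterns of permutations $E(\pi,\mathbf{i},\Theta)$ with $\theta_t\in\mathcal{X}_t$. *)

theory Defs
  imports "HOL-Combinatorics.Permutations"
begin

text \<open>
  A permutation of size n is a pair of n and a function permuting {1..n}. The size has to be
  recorded, since a function that permutes {1..n} also permutes every {1..m} with m \<ge> n.
  The empty permutation is allowed.
\<close>

type_synonym perm = "nat \<times> (nat \<Rightarrow> nat)"

type_synonym point = "nat \<times> nat"

definition perms :: "perm set" where
  "perms = {(n, f). f permutes {1..n}}"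

definition points :: "perm \<Rightarrow> point set" where
  "points \<sigma> = {(i, snd \<sigma> i) | i. i \<in> {1..fst \<sigma>}}"

definition less_P :: "point \<Rightarrow> point \<Rightarrow> bool" (infix \<open>\<prec>\<^sub>P\<close> 50) where
  "a \<prec>\<^sub>P b \<longleftrightarrow> fst a < fst b"

definition less_V :: "point \<Rightarrow> point \<Rightarrow> bool" (infix \<open>\<prec>\<^sub>V\<close> 50) where
  "a \<prec>\<^sub>V b \<longleftrightarrow> snd a < snd b"


section \<open>The logic TOTO\<close>

text \<open>The remaining connectives and the universal quantifier are expressible as usual.\<close>

datatype toto =
    Eq nat nat
  | LessP nat nat
  | LessV nat nat
  | Neg toto
  | Conj toto toto
  | Ex nat toto

primrec fv :: "toto \<Rightarrow> nat set" where
  "fv (Eq x y) = {x, y}"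
| "fv (LessP x y) = {x, y}"
| "fv (LessV x y) = {x, y}"
| "fv (Neg \<phi>) = fv \<phi>"
| "fv (Conj \<phi> \<psi>) = fv \<phi> \<union> fv \<psi>"
| "fv (Ex x \<phi>) = fv \<phi> - {x}"

primrec sat :: "point set \<Rightarrow> (nat \<Rightarrow> point) \<Rightarrow> toto \<Rightarrow> bool" where
  "sat A e (Eq x y) \<longleftrightarrow> e x = e y"
| "sat A e (LessP x y) \<longleftrightarrow> e x \<prec>\<^sub>P e y"
| "sat A e (LessV x y) \<longleftrightarrow> e x \<prec>\<^sub>V e y"
| "sat A e (Neg \<phi>) \<longleftrightarrow> \<not> sat A e \<phi>"
| "sat A e (Conj \<phi> \<psi>) \<longleftrightarrow> sat A e \<phi> \<and> sat A e \<psi>"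
| "sat A e (Ex x \<phi>) \<longleftrightarrow> (\<exists>a\<in>A. sat A (e(x := a)) \<phi>)"

text \<open>
  The variable x_i is the number i and is interpreted by the i-th entry of the list. This is
  meant for formulas whose free variables lie in {1..length as}, so that the values of the
  assignment at other variables are irrelevant.
\<close>

definition models :: "perm \<Rightarrow> point list \<Rightarrow> toto \<Rightarrow> bool" where
  "models \<sigma> as \<phi> \<longleftrightarrow> sat (points \<sigma>) (\<lambda>i. as ! (i - 1)) \<phi>"


section \<open>Patterns and classes\<close>

definition occurrence :: "perm \<Rightarrow> perm \<Rightarrow> point list \<Rightarrow> bool" where
  "occurrence \<pi> \<sigma> s \<longleftrightarrow>
     length s = fst \<pi> \<and> set s \<subseteq> points \<sigma> \<and> sorted_wrt (\<prec>\<^sub>P) s \<and>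
     (\<forall>i\<in>{1..fst \<pi>}. \<forall>j\<in>{1..fst \<pi>}.
        s ! (i - 1) \<prec>\<^sub>V s ! (j - 1) \<longleftrightarrow> snd \<pi> i < snd \<pi> j)"

definition contains :: "perm \<Rightarrow> perm \<Rightarrow> bool" where
  "contains \<sigma> \<pi> \<longleftrightarrow> (\<exists>s. occurrence \<pi> \<sigma> s)"

definition perm_class :: "perm set \<Rightarrow> bool" where
  "perm_class C \<longleftrightarrow> C \<subseteq> perms \<and> (\<forall>\<sigma>\<in>C. \<forall>\<tau>\<in>perms. contains \<sigma> \<tau> \<longrightarrow> \<tau> \<in> C)"

definition avoids :: "perm set \<Rightarrow> perm \<Rightarrow> bool" where
  "avoids C \<tau> \<longleftrightarrow> (\<forall>\<sigma>\<in>C. \<not> contains \<sigma> \<tau>)"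

definition increasing_perms :: "perm set" where
  "increasing_perms =
     {\<theta> \<in> perms. \<forall>i\<in>{1..fst \<theta>}. \<forall>j\<in>{1..fst \<theta>}. i < j \<longrightarrow> snd \<theta> i < snd \<theta> j}"

definition decreasing_perms :: "perm set" where
  "decreasing_perms =
     {\<theta> \<in> perms. \<forall>i\<in>{1..fst \<theta>}. \<forall>j\<in>{1..fst \<theta>}. i < j \<longrightarrow> snd \<theta> j < snd \<theta> i}"

definition stable :: "perm \<Rightarrow> point list \<Rightarrow> bool" where
  "stable \<sigma> s \<longleftrightarrow> snd \<sigma> ` (fst ` set s) = fst ` set s"

definition union_of_cycles :: "perm \<Rightarrow> point list \<Rightarrow> bool" where
  "union_of_cycles \<sigma> as \<longleftrightarrow> distinct as \<and> stable \<sigma> as"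


section \<open>Expansions\<close>

text \<open>
  Rows and columns are numbered from 1. Two points outside s compare identically with every
  entry of s iff they have the same row and the same column.
\<close>

definition cell_row :: "point list \<Rightarrow> point \<Rightarrow> nat" where
  "cell_row s p = Suc (card {q \<in> set s. q \<prec>\<^sub>V p})"

definition cell_col :: "point list \<Rightarrow> point \<Rightarrow> nat" where
  "cell_col s p = Suc (card {q \<in> set s. q \<prec>\<^sub>P p})"

definition cell_matrix :: "perm \<Rightarrow> point list \<Rightarrow> nat \<Rightarrow> nat \<Rightarrow> nat" where
  "cell_matrix \<sigma> s i j = card {p \<in> points \<sigma> - set s. cell_row s p = i \<and> cell_col s p = j}"

definition cycle_matrix :: "nat list \<Rightarrow> nat \<Rightarrow> nat \<Rightarrow> nat" where
  "cycle_matrix c i j =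
     (if \<exists>t < length c. i = c ! t \<and> j = c ! (Suc t mod length c) then 1 else 0)"

text \<open>
  The expansion of a permutation along a sequence c of distinct indices, together with the
  distinguished stable occurrence s. Both are uniquely determined: the column sums of the
  matrix fix the positions of s, and no row or column contains more than one further point.
\<close>

definition is_expansion :: "perm \<Rightarrow> nat list \<Rightarrow> perm \<Rightarrow> point list \<Rightarrow> bool" where
  "is_expansion \<pi> c \<sigma> s \<longleftrightarrow>
     \<sigma> \<in> perms \<and> fst \<sigma> = fst \<pi> + length c \<and> occurrence \<pi> \<sigma> s \<and> stable \<sigma> s \<and>
     (\<forall>i\<in>{1..fst \<pi> + 1}. \<forall>j\<in>{1..fst \<pi> + 1}. cell_matrix \<sigma> s i j = cycle_matrix c i j)"

text \<open>
  The inflation of every point p of \<sigma> by F p: p is replaced by an interval order-isomorphic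
  to F p, and distinct intervals compare in both orders as the points they replace. The
  point of \<tau> that comes from the point u of F p is f (p, u).
\<close>

definition is_inflation :: "perm \<Rightarrow> (point \<Rightarrow> perm) \<Rightarrow> perm \<Rightarrow> bool" where
  "is_inflation \<sigma> F \<tau> \<longleftrightarrow> \<tau> \<in> perms \<and>
     (\<exists>f. bij_betw f (SIGMA p : points \<sigma>. points (F p)) (points \<tau>) \<and>
        (\<forall>p\<in>points \<sigma>. \<forall>q\<in>points \<sigma>. \<forall>u\<in>points (F p). \<forall>v\<in>points (F q).
           (f (p, u) \<prec>\<^sub>P f (q, v) \<longleftrightarrow> p \<prec>\<^sub>P q \<or> p = q \<and> u \<prec>\<^sub>P v) \<and>
           (f (p, u) \<prec>\<^sub>V f (q, v) \<longleftrightarrow> p \<prec>\<^sub>V q \<or> p = q \<and> u \<prec>\<^sub>V v)))"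

text \<open>
  The points of s are left alone, that is, inflated by the permutation of size 1; the others
  are inflated by the entries of the list from left to right.
\<close>

definition inflation_family :: "perm \<Rightarrow> point list \<Rightarrow> perm list \<Rightarrow> point \<Rightarrow> perm" where
  "inflation_family \<sigma> s \<Theta> p =
     (if p \<in> set s then (1, id) else \<Theta> ! card {q \<in> points \<sigma> - set s. q \<prec>\<^sub>P p})"

definition is_inflated_expansion :: "perm \<Rightarrow> nat list \<Rightarrow> perm list \<Rightarrow> perm \<Rightarrow> bool" where
  "is_inflated_expansion \<pi> c \<Theta> \<tau> \<longleftrightarrow>
     (\<exists>\<sigma> s. is_expansion \<pi> c \<sigma> s \<and> is_inflation \<sigma> (inflation_family \<sigma> s \<Theta>) \<tau>)"

definition expansion_class :: "perm \<Rightarrow> nat list \<Rightarrow> perm set list \<Rightarrow> perm set" where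
  "expansion_class \<pi> c Xs =
     {\<rho> \<in> perms. \<exists>\<Theta> \<tau>. length \<Theta> = length Xs \<and> (\<forall>t < length Xs. \<Theta> ! t \<in> Xs ! t) \<and>
        is_inflated_expansion \<pi> c \<Theta> \<tau> \<and> contains \<tau> \<rho>}"

end

theory Submission imports Defs "HOL-Library.Ramsey" begin

text \<open>
  An occurrence is stable iff in its matrix of cell sizes every row sum equals the column sum of
  the same index.

  If C contains a whole class E(\<pi>, c, Xs), take the inflation of the expansion by monotone
  permutations of a common length N, and the one where a single block has length N + 1. The
  distinguished occurrence is stable in the first and, since the block lies in a row and a column
  of different index, not in the second. For N at least two to the quantifier rank of a formula,
  the duplicator wins the Ehrenfeucht-Fraisse game between the two.

  Otherwise, by Ramsey's theorem there is n such that no occurrence in a member of C has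
  at least n points in each cell of a non-trivial cycle. The off-diagonal entries of at least n
  then form an acyclic graph, so in a matrix with equal row and column sums, seen as
  a circulation, every off-diagonal entry is bounded in terms of n and k. Hence stability only
  depends on the off-diagonal entries truncated at a fixed threshold, and these are definable.
\<close>

section \<open>Points, cells and patterns\<close>

text \<open>Diagonal entries have to be left out of the truncation: a cell (i, i) adds equally to
  row sum i and to column sum i, so it can be arbitrarily large in a stable occurrence. For the same
  reason only cycles of length at least two obstruct definability. The number n can be chosen once
  for all of C because, for fixed k, there are finitely many choices of \<pi>, c and Xs, and for
  each of them an avoided permutation lies in an expansion with blocks of bounded length. All
  choices of Xs matter because Ramsey's theorem does not allow one to prescribe whether the points
  found in a cell are increasing or decreasing. The defining formula is never written down: every
  condition on the truth values of finitely many formulas is expressible, so it suffices that the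
  truth values of certain counting formulas and equalities determine the answer within C. In the
  other direction, the block length 2^rank comes from the fact that a move can halve the distance
  between two chosen points.\<close>

definition embeds :: "point set \<Rightarrow> (point \<Rightarrow> point) \<Rightarrow> bool" where
  "embeds A f \<longleftrightarrow> (\<forall>p\<in>A. \<forall>q\<in>A. (f p \<prec>\<^sub>P f q \<longleftrightarrow> p \<prec>\<^sub>P q) \<and> (f p \<prec>\<^sub>V f q \<longleftrightarrow> p \<prec>\<^sub>V q))"

lemma points_eq_image: "points \<sigma> = (\<lambda>i. (i, snd \<sigma> i)) ` {1..fst \<sigma>}"
  by (auto simp: points_def)

lemma mem_points_iff: "p \<in> points \<sigma> \<longleftrightarrow> fst p \<in> {1..fst \<sigma>} \<and> snd p = snd \<sigma> (fst p)"
  by (cases p) (auto simp: points_def)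

lemma finite_points [simp]: "finite (points \<sigma>)"
  by (simp add: points_eq_image)

lemma card_points: "card (points \<sigma>) = fst \<sigma>"
  by (simp add: points_eq_image card_image inj_on_def)

lemma fst_image_points: "fst ` points \<sigma> = {1..fst \<sigma>}"
  by (auto simp: points_eq_image image_image)

lemma inj_on_fst_points: "inj_on fst (points \<sigma>)"
  by (auto simp: inj_on_def points_def)

lemma permutes_of_perms: "\<sigma> \<in> perms \<Longrightarrow> snd \<sigma> permutes {1..fst \<sigma>}"
  by (auto simp: perms_def)

lemma snd_image_points: "\<sigma> \<in> perms \<Longrightarrow> snd ` points \<sigma> = {1..fst \<sigma>}"
  using permutes_image[OF permutes_of_perms, of \<sigma>] by (simp add: points_eq_image image_image)

lemma inj_on_snd_points: "\<sigma> \<in> perms \<Longrightarrow> inj_on snd (points \<sigma>)"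
  using permutes_inj[OF permutes_of_perms, of \<sigma>] by (auto simp: inj_on_def points_def)

lemma not_less_P_iff:
  assumes "p \<in> points \<sigma>" "q \<in> points \<sigma>" "p \<noteq> q"
  shows "\<not> p \<prec>\<^sub>P q \<longleftrightarrow> q \<prec>\<^sub>P p"
proof -
  have "fst p \<noteq> fst q" using inj_onD[OF inj_on_fst_points _ assms(1,2)] assms(3) by blast
  then show ?thesis by (auto simp: less_P_def)
qed

lemma not_less_V_iff:
  assumes "\<sigma> \<in> perms" "p \<in> points \<sigma>" "q \<in> points \<sigma>" "p \<noteq> q"
  shows "\<not> p \<prec>\<^sub>V q \<longleftrightarrow> q \<prec>\<^sub>V p"
proof -
  have "snd p \<noteq> snd q" using inj_onD[OF inj_on_snd_points[OF assms(1)] _ assms(2,3)] assms(4) by blast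
  then show ?thesis by (auto simp: less_V_def)
qed

lemma embeds_subset: "embeds A f \<Longrightarrow> B \<subseteq> A \<Longrightarrow> embeds B f"
  unfolding embeds_def by (meson subsetD)

lemma embeds_comp: "embeds A f \<Longrightarrow> embeds B g \<Longrightarrow> f ` A \<subseteq> B \<Longrightarrow> embeds A (g \<circ> f)"
  unfolding embeds_def by (auto simp: image_subset_iff)

lemma embeds_inv:
  assumes "embeds A f" "bij_betw f A B"
  shows "embeds B (inv_into A f)"
  unfolding embeds_def
proof (intro ballI)
  fix p q assume "p \<in> B" "q \<in> B"
  then obtain x y where "p = f x" "q = f y" "x \<in> A" "y \<in> A"
    using assms(2) by (auto simp: bij_betw_def)
  then show "(inv_into A f p \<prec>\<^sub>P inv_into A f q) = (p \<prec>\<^sub>P q) \<and> (inv_into A f p \<prec>\<^sub>V inv_into A f q) = (p \<prec>\<^sub>V q)"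
    using assms by (auto simp: bij_betw_def embeds_def)
qed

section \<open>Ranks and standardization\<close>

lemma rank_less:
  fixes g :: "'a \<Rightarrow> nat"
  assumes "finite A" "p \<in> A" "q \<in> A"
  shows "card {x \<in> A. g x \<le> g p} < card {x \<in> A. g x \<le> g q} \<longleftrightarrow> g p < g q"
proof
  assume "g p < g q"
  then have "{x \<in> A. g x \<le> g p} \<subset> {x \<in> A. g x \<le> g q}" using assms by (auto simp: psubset_eq)
       (metis (mono_tags, lifting) mem_Collect_eq not_le order_refl)
  then show "card {x \<in> A. g x \<le> g p} < card {x \<in> A. g x \<le> g q}" using assms by (auto intro: psubset_card_mono)
next
  assume *: "card {x \<in> A. g x \<le> g p} < card {x \<in> A. g x \<le> g q}"
  show "g p < g q"
  proof (rule ccontr)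
    assume "\<not> g p < g q"
    then have "card {x \<in> A. g x \<le> g q} \<le> card {x \<in> A. g x \<le> g p}"
      using assms by (intro card_mono) auto
    with * show False by simp
  qed
qed

lemma rank_bij:
  fixes g :: "'a \<Rightarrow> nat"
  assumes "finite A" "inj_on g A"
  shows "bij_betw (\<lambda>p. card {x \<in> A. g x \<le> g p}) A {1..card A}"
proof -
  let ?r = "\<lambda>p. card {x \<in> A. g x \<le> g p}"
  have inj: "inj_on ?r A"
  proof (rule inj_onI)
    fix p q assume "p \<in> A" "q \<in> A" "?r p = ?r q"
    then have "g p = g q"
      using rank_less[OF assms(1), of p q g] rank_less[OF assms(1), of q p g] by simp
    with \<open>p \<in> A\<close> \<open>q \<in> A\<close> show "p = q" using assms(2) by (auto dest: inj_onD)
  qed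
  have "?r ` A \<subseteq> {1..card A}"
    using assms(1) by (auto simp: Suc_le_eq card_gt_0_iff intro!: card_mono)
  then have "?r ` A = {1..card A}"
    using card_image[OF inj] by (intro card_subset_eq) auto
  with inj show ?thesis by (simp add: bij_betw_def)
qed

text \<open>Replacing each coordinate by its rank turns any finite set without repeated coordinates
  into the graph of a permutation. Later constructions can therefore place points freely in the
  plane and normalize at the end.\<close>

lemma standardization:
  assumes "finite A" "inj_on fst A" "inj_on snd A"
  obtains \<sigma> f where "\<sigma> \<in> perms" "fst \<sigma> = card A" "bij_betw f A (points \<sigma>)" "embeds A f"
proof -
  let ?n = "card A"
  define r1 where "r1 p = card {x \<in> A. fst x \<le> fst p}" for p :: point
  define r2 where "r2 p = card {x \<in> A. snd x \<le> snd p}" for p :: point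
  have b1: "bij_betw r1 A {1..?n}" and b2: "bij_betw r2 A {1..?n}"
    unfolding r1_def r2_def using assms rank_bij by blast+
  \<comment> \<open>The identity outside {1..n} is what \<open>permutes\<close> demands.\<close>
  define h where "h i = (if i \<in> {1..?n} then r2 (inv_into A r1 i) else i)" for i
  have "bij_betw (r2 \<circ> inv_into A r1) {1..?n} {1..?n}"
    using b1 b2 by (auto intro: bij_betw_trans bij_betw_inv_into)
  then have "bij_betw h {1..?n} {1..?n}"
    by (subst bij_betw_cong[of _ _ "r2 \<circ> inv_into A r1"]) (simp_all add: h_def)
  then have "h permutes {1..?n}"
    by (rule bij_imp_permutes) (simp only: h_def if_False)
  then have perm: "(?n, h) \<in> perms" by (simp add: perms_def)
  define f where "f p = (r1 p, r2 p)" for p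
  have *: "h (r1 p) = r2 p" if "p \<in> A" for p
    using b1 that by (auto simp: h_def bij_betw_def)
  have "f ` A = points (?n, h)"
  proof -
    have "points (?n, h) = (\<lambda>i. (i, h i)) ` (r1 ` A)"
      using b1 by (simp add: points_eq_image bij_betw_def)
    also have "\<dots> = f ` A" unfolding image_image f_def by (intro image_cong) (simp_all add: *)
    finally show ?thesis by simp
  qed
  moreover have "inj_on f A" using b1 by (auto simp: f_def bij_betw_def inj_on_def)
  ultimately have bij: "bij_betw f A (points (?n, h))" by (simp add: bij_betw_def)
  have "embeds A f"
    using assms(1) by (auto simp: embeds_def f_def less_P_def less_V_def r1_def r2_def rank_less)
  with perm bij show ?thesis by (intro that[of "(?n, h)" f]) auto
qed

section \<open>Occurrences and their transport along embeddings\<close>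

lemma occurrence_distinct: "occurrence \<pi> \<sigma> s \<Longrightarrow> distinct s"
proof -
  assume "occurrence \<pi> \<sigma> s"
  then have "sorted_wrt (<) (map fst s)"
    by (simp add: occurrence_def less_P_def sorted_wrt_iff_nth_less)
  then show "distinct s" by (simp add: strict_sorted_iff distinct_map)
qed

lemma occurrence_nth_less_P:
  assumes "occurrence \<pi> \<sigma> s" "i < fst \<pi>" "j < fst \<pi>"
  shows "s ! i \<prec>\<^sub>P s ! j \<longleftrightarrow> i < j"
proof -
  have *: "fst (s ! a) < fst (s ! b)" if "a < b" "b < fst \<pi>" for a b
    using assms(1) that by (simp add: occurrence_def less_P_def sorted_wrt_iff_nth_less)
  show ?thesis
    using *[of i j] *[of j i] assms(2,3) by (cases i j rule: linorder_cases) (simp_all add: less_P_def)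
qed

lemma occurrence_nth_less_V:
  assumes "occurrence \<pi> \<sigma> s" "i < fst \<pi>" "j < fst \<pi>"
  shows "s ! i \<prec>\<^sub>V s ! j \<longleftrightarrow> snd \<pi> (Suc i) < snd \<pi> (Suc j)"
proof -
  have "\<forall>i\<in>{1..fst \<pi>}. \<forall>j\<in>{1..fst \<pi>}. s ! (i - 1) \<prec>\<^sub>V s ! (j - 1) \<longleftrightarrow> snd \<pi> i < snd \<pi> j"
    using assms(1) by (simp add: occurrence_def)
  from this[rule_format, of "Suc i" "Suc j"] show ?thesis using assms by simp
qed

lemma occurrence_map:
  assumes "occurrence \<rho> \<tau> s" "embeds (points \<tau>) g" "g ` points \<tau> \<subseteq> points \<sigma>"
  shows "occurrence \<rho> \<sigma> (map g s)"
proof -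
  have *: "length s = fst \<rho>" "\<And>i. i < length s \<Longrightarrow> s ! i \<in> points \<tau>"
    using assms(1) nth_mem by (auto simp: occurrence_def)
  show ?thesis
    using assms * unfolding occurrence_def embeds_def
    by (auto simp: sorted_wrt_iff_nth_less image_subset_iff)
qed

text \<open>The occurrence of a permutation in itself. Further occurrences are constructed by
  transporting it along order embeddings.\<close>

definition point_list :: "perm \<Rightarrow> point list" where
  "point_list \<sigma> = map (\<lambda>i. (Suc i, snd \<sigma> (Suc i))) [0..<fst \<sigma>]"

lemma length_point_list [simp]: "length (point_list \<sigma>) = fst \<sigma>"
  by (simp add: point_list_def)

lemma nth_point_list: "i < fst \<sigma> \<Longrightarrow> point_list \<sigma> ! i = (Suc i, snd \<sigma> (Suc i))"
  by (simp add: point_list_def)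

lemma set_point_list [simp]: "set (point_list \<sigma>) = points \<sigma>"
proof -
  have "set (point_list \<sigma>) = (\<lambda>i. (i, snd \<sigma> i)) ` (Suc ` {0..<fst \<sigma>})"
    unfolding image_image by (simp add: point_list_def)
  then show ?thesis
    by (simp only: image_Suc_atLeastLessThan points_eq_image atLeastLessThanSuc_atLeastAtMost One_nat_def)
qed

lemma occurrence_point_list: "occurrence \<sigma> \<sigma> (point_list \<sigma>)"
  by (auto simp: occurrence_def sorted_wrt_iff_nth_less nth_point_list less_P_def less_V_def)

lemma contains_refl: "contains \<sigma> \<sigma>"
  unfolding contains_def by (rule exI) (rule occurrence_point_list)

lemma contains_of_embedding:
  "contains \<tau> \<rho> \<Longrightarrow> embeds (points \<tau>) g \<Longrightarrow> g ` points \<tau> \<subseteq> points \<sigma> \<Longrightarrow> contains \<sigma> \<rho>"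
  unfolding contains_def by (blast intro: occurrence_map)

text \<open>The inverse of the standardization of A lists A from left to right. This supplies the
  permutation \<pi> for a tuple of points given in arbitrary order.\<close>

lemma exists_pattern:
  assumes "\<sigma> \<in> perms" "A \<subseteq> points \<sigma>"
  obtains \<pi> s where "\<pi> \<in> perms" "fst \<pi> = card A" "occurrence \<pi> \<sigma> s" "set s = A"
proof -
  have "finite A" "inj_on fst A" "inj_on snd A"
    using assms finite_subset[OF assms(2)] inj_on_subset[OF inj_on_fst_points assms(2)]
      inj_on_subset[OF inj_on_snd_points assms(2)] by simp_all
  then obtain \<pi> f where \<pi>: "\<pi> \<in> perms" "fst \<pi> = card A" "bij_betw f A (points \<pi>)" "embeds A f"
    by (rule standardization)
  let ?g = "inv_into A f"
  have im: "?g ` points \<pi> = A" using bij_betw_inv_into[OF \<pi>(3)] by (rule bij_betw_imp_surj_on)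
  have "occurrence \<pi> \<sigma> (map ?g (point_list \<pi>))"
    using occurrence_point_list embeds_inv[OF \<pi>(4,3)] im assms(2) by (intro occurrence_map) auto
  with \<pi> im show ?thesis by (intro that[of \<pi> "map ?g (point_list \<pi>)"]) auto
qed

section \<open>Cells and comparisons with an occurrence\<close>

text \<open>A down-closed subset of {1..k} is an initial segment, so its cardinality alone decides
  membership. Row and column numbers are such cardinalities.\<close>

lemma down_closed_mem_iff:
  assumes "D \<subseteq> {1..k::nat}" "\<And>i j. j \<in> D \<Longrightarrow> 1 \<le> i \<Longrightarrow> i \<le> j \<Longrightarrow> i \<in> D" "1 \<le> j"
  shows "j \<in> D \<longleftrightarrow> j \<le> card D"
proof -
  have fin: "finite D" using assms(1) by (rule finite_subset) simp
  have "j \<le> card D" if "j \<in> D"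
  proof -
    have "{1..j} \<subseteq> D" using assms(2) that by auto
    from card_mono[OF fin this] show ?thesis by simp
  qed
  moreover have "card D < j" if "j \<notin> D"
  proof -
    have "D \<subseteq> {1..<j}"
    proof
      fix i assume "i \<in> D"
      then have "1 \<le> i" "\<not> j \<le> i" using assms(1) assms(2)[of i j] assms(3) that by auto
      then show "i \<in> {1..<j}" by simp
    qed
    from card_mono[OF _ this] show ?thesis using assms(3) by simp
  qed
  ultimately show ?thesis by force
qed

text \<open>The entries to the left of p are an initial segment of the list, and the column of p is
  one more than its length. Hence the column already contains every position comparison of p with
  the occurrence.\<close>

lemma occurrence_nth_less_P_cell:
  assumes "occurrence \<pi> \<sigma> s" "j < fst \<pi>"
  shows "s ! j \<prec>\<^sub>P p \<longleftrightarrow> Suc j < cell_col s p"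
proof -
  let ?k = "fst \<pi>"
  define D where "D = {i \<in> {1..?k}. s ! (i - 1) \<prec>\<^sub>P p}"
  have len: "length s = ?k" using assms by (simp add: occurrence_def)
  have "bij_betw (\<lambda>i. s ! (i - 1)) D {q \<in> set s. q \<prec>\<^sub>P p}"
    unfolding bij_betw_def
  proof
    show "inj_on (\<lambda>i. s ! (i - 1)) D"
      using occurrence_distinct[OF assms(1)] len by (auto simp: D_def inj_on_def nth_eq_iff_index_eq)
    show "(\<lambda>i. s ! (i - 1)) ` D = {q \<in> set s. q \<prec>\<^sub>P p}"
    proof (intro equalityI subsetI)
      fix q assume "q \<in> {q \<in> set s. q \<prec>\<^sub>P p}"
      then obtain i where "i < ?k" "q = s ! i" "q \<prec>\<^sub>P p" by (auto simp: in_set_conv_nth len)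
      then show "q \<in> (\<lambda>i. s ! (i - 1)) ` D" by (intro image_eqI[of _ _ "Suc i"]) (auto simp: D_def)
    qed (use len in \<open>auto simp: D_def\<close>)
  qed
  then have "card D = card {q \<in> set s. q \<prec>\<^sub>P p}" by (rule bij_betw_same_card)
  moreover have "Suc j \<in> D \<longleftrightarrow> Suc j \<le> card D"
  proof (rule down_closed_mem_iff)
    fix i j assume *: "j \<in> D" "1 \<le> i" "i \<le> j"
    then have "i = j \<or> s ! (i - 1) \<prec>\<^sub>P s ! (j - 1)"
      using occurrence_nth_less_P[OF assms(1), of "i - 1" "j - 1"] by (cases "i = j") (auto simp: D_def)
    with * show "i \<in> D" by (auto simp: D_def less_P_def)
  qed (auto simp: D_def)
  ultimately show ?thesis using assms(2) by (simp add: cell_col_def D_def less_Suc_eq_le)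
qed

text \<open>The entries below p are in general no initial segment of the list, but the values that
  \<pi> gives to their indices form one; the argument for columns is applied to these
  values.\<close>

lemma occurrence_nth_less_V_cell:
  assumes "occurrence \<pi> \<sigma> s" "\<pi> \<in> perms" "j < fst \<pi>"
  shows "s ! j \<prec>\<^sub>V p \<longleftrightarrow> snd \<pi> (Suc j) < cell_row s p"
proof -
  let ?k = "fst \<pi>"
  have pm: "snd \<pi> permutes {1..?k}" using assms(2) by (rule permutes_of_perms)
  define D where "D = {i \<in> {1..?k}. s ! (i - 1) \<prec>\<^sub>V p}"
  have len: "length s = ?k" using assms by (simp add: occurrence_def)
  have "bij_betw (\<lambda>i. s ! (i - 1)) D {q \<in> set s. q \<prec>\<^sub>V p}"
    unfolding bij_betw_def
  proof
    show "inj_on (\<lambda>i. s ! (i - 1)) D"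
      using occurrence_distinct[OF assms(1)] len by (auto simp: D_def inj_on_def nth_eq_iff_index_eq)
    show "(\<lambda>i. s ! (i - 1)) ` D = {q \<in> set s. q \<prec>\<^sub>V p}"
    proof (intro equalityI subsetI)
      fix q assume "q \<in> {q \<in> set s. q \<prec>\<^sub>V p}"
      then obtain i where "i < ?k" "q = s ! i" "q \<prec>\<^sub>V p" by (auto simp: in_set_conv_nth len)
      then show "q \<in> (\<lambda>i. s ! (i - 1)) ` D" by (intro image_eqI[of _ _ "Suc i"]) (auto simp: D_def)
    qed (use len in \<open>auto simp: D_def\<close>)
  qed
  then have "card D = card {q \<in> set s. q \<prec>\<^sub>V p}" by (rule bij_betw_same_card)
  moreover have cD: "card (snd \<pi> ` D) = card D"
    using permutes_inj_on[OF pm] by (rule card_image)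
  moreover have "snd \<pi> (Suc j) \<in> snd \<pi> ` D \<longleftrightarrow> snd \<pi> (Suc j) \<le> card (snd \<pi> ` D)"
  proof (rule down_closed_mem_iff)
    have in_iff: "snd \<pi> i \<in> {1..?k} \<longleftrightarrow> i \<in> {1..?k}" for i
      using pm by (rule permutes_in_image)
    have inj: "snd \<pi> i = snd \<pi> j \<Longrightarrow> i = j" for i j
      using permutes_inj[OF pm] by (rule injD)
    show "snd \<pi> ` D \<subseteq> {1..?k}" using in_iff unfolding D_def by blast
    show "1 \<le> snd \<pi> (Suc j)" using in_iff[of "Suc j"] assms(3) by simp
    fix a b assume *: "b \<in> snd \<pi> ` D" "1 \<le> a" "a \<le> b"
    then obtain j where j: "j \<in> D" "b = snd \<pi> j" by blast
    then have jk: "j \<in> {1..?k}" by (simp add: D_def)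
    then have "a \<in> {1..?k}" using * in_iff[of j] j(2) by simp
    then obtain i where i: "i \<in> {1..?k}" "a = snd \<pi> i" using permutes_image[OF pm] by blast
    have "i \<in> D"
    proof (cases "i = j")
      case False
      then have "snd \<pi> i < snd \<pi> j" using inj[of i j] *(3) i(2) j(2) by force
      then have "s ! (i - 1) \<prec>\<^sub>V s ! (j - 1)"
        using occurrence_nth_less_V[OF assms(1), of "i - 1" "j - 1"] i(1) jk
        by (cases i; cases j) simp_all
      then show ?thesis using i(1) j(1) by (simp add: D_def less_V_def)
    qed (use j in simp)
    with i(2) show "a \<in> snd \<pi> ` D" by blast
  qed
  moreover have "snd \<pi> (Suc j) \<in> snd \<pi> ` D \<longleftrightarrow> Suc j \<in> D"
    using permutes_inj[OF pm] by (rule inj_image_mem_iff)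
  ultimately show ?thesis using assms(3) by (simp add: cell_row_def D_def less_Suc_eq_le)
qed

lemma cell_col_bounds: "length s = k \<Longrightarrow> cell_col s p \<in> {1..k + 1}"
  unfolding cell_col_def
  using order_trans[OF card_mono[of "set s" "{q \<in> set s. q \<prec>\<^sub>P p}"] card_length[of s]] by simp

lemma cell_row_bounds: "length s = k \<Longrightarrow> cell_row s p \<in> {1..k + 1}"
  unfolding cell_row_def
  using order_trans[OF card_mono[of "set s" "{q \<in> set s. q \<prec>\<^sub>V p}"] card_length[of s]] by simp

lemma cell_col_less: "finite (set s) \<Longrightarrow> cell_col s p < cell_col s q \<Longrightarrow> p \<prec>\<^sub>P q"
proof (rule ccontr)
  assume "cell_col s p < cell_col s q" "\<not> p \<prec>\<^sub>P q"
  moreover from this(2) have "card {x \<in> set s. x \<prec>\<^sub>P q} \<le> card {x \<in> set s. x \<prec>\<^sub>P p}"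
    by (intro card_mono) (auto simp: less_P_def)
  ultimately show False by (simp add: cell_col_def)
qed

lemma cell_row_less: "finite (set s) \<Longrightarrow> cell_row s p < cell_row s q \<Longrightarrow> p \<prec>\<^sub>V q"
proof (rule ccontr)
  assume "cell_row s p < cell_row s q" "\<not> p \<prec>\<^sub>V q"
  moreover from this(2) have "card {x \<in> set s. x \<prec>\<^sub>V q} \<le> card {x \<in> set s. x \<prec>\<^sub>V p}"
    by (intro card_mono) (auto simp: less_V_def)
  ultimately show False by (simp add: cell_row_def)
qed

section \<open>Gap sizes and stability\<close>

text \<open>A subset of {1..n} is determined by the sizes of its gaps, where gap i consists of the
  elements outside with exactly i members below. At the least x on which the sets differ, the set
  containing x ends its current gap there, while the gap of the other set has the same elements
  before x and also contains x, so it is larger.\<close>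

lemma level_counts_eq_imp_eq:
  fixes S W :: "nat set"
  assumes "S \<subseteq> {1..n}" "W \<subseteq> {1..n}"
    and eq: "\<And>i. card {x \<in> {1..n} - S. card {y \<in> S. y < x} = i} = card {x \<in> {1..n} - W. card {y \<in> W. y < x} = i}"
  shows "S = W"
proof -
  have fin: "finite S" "finite W" using assms(1,2) finite_subset[OF _ finite_atLeastAtMost] by blast+
  \<comment> \<open>Stated for fresh sets, so that it also applies with the two sets
    exchanged.\<close>
  have False
    if S: "S \<subseteq> {1..n}" and W: "W \<subseteq> {1..n}" and fin: "finite S" "finite W"
      and eq: "\<And>i. card {x \<in> {1..n} - S. card {y \<in> S. y < x} = i} = card {x \<in> {1..n} - W. card {y \<in> W. y < x} = i}"
      and x: "x \<in> S" "x \<notin> W" and below: "\<And>y. y < x \<Longrightarrow> y \<in> S \<longleftrightarrow> y \<in> W" for S W x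
  proof -
    define i where "i = card {y \<in> S. y < x}"
    have level: "{y \<in> S. y < z} = {y \<in> W. y < z}" if "z \<le> x" for z
      using that below by (metis (no_types, lifting) order_less_le_trans)
    have "{z \<in> {1..n} - S. card {y \<in> S. y < z} = i} \<subseteq> {z \<in> {1..n} - W. card {y \<in> W. y < z} = i} - {x}"
    proof
      fix z assume z: "z \<in> {z \<in> {1..n} - S. card {y \<in> S. y < z} = i}"
      have "z < x"
      proof (rule ccontr)
        assume "\<not> z < x"
        moreover have "x \<noteq> z" using z x(1) by blast
        ultimately have "x < z" by simp
        then have "{y \<in> S. y < x} \<subseteq> {y \<in> S. y < z}" "x \<in> {y \<in> S. y < z}" "x \<notin> {y \<in> S. y < x}"
          using x(1) by (simp_all add: subset_iff)
        then have "{y \<in> S. y < x} \<subset> {y \<in> S. y < z}" by blast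
        then have "i < card {y \<in> S. y < z}" unfolding i_def using fin by (intro psubset_card_mono) auto
        with z show False by simp
      qed
      then show "z \<in> {z \<in> {1..n} - W. card {y \<in> W. y < z} = i} - {x}"
        using z below[of z] level[of z] by simp
    qed
    moreover have "x \<in> {z \<in> {1..n} - W. card {y \<in> W. y < z} = i}"
      using x S level[of x] unfolding i_def by auto
    ultimately have "{z \<in> {1..n} - S. card {y \<in> S. y < z} = i} \<subset> {z \<in> {1..n} - W. card {y \<in> W. y < z} = i}"
      by blast
    from psubset_card_mono[OF _ this] eq[of i] show False by simp
  qed note * = this
  show ?thesis
  proof (rule ccontr)
    assume "S \<noteq> W"
    then have ex: "\<exists>x. x \<in> S \<longleftrightarrow> x \<notin> W" by blast
    define x where "x = (LEAST x. x \<in> S \<longleftrightarrow> x \<notin> W)"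
    have x: "x \<in> S \<longleftrightarrow> x \<notin> W" unfolding x_def using ex by (rule LeastI_ex)
    have below: "\<And>y. y < x \<Longrightarrow> y \<in> S \<longleftrightarrow> y \<in> W" unfolding x_def using not_less_Least by blast
    show False
    proof (cases "x \<in> S")
      case True
      with x show ?thesis by (intro *[OF assms(1,2) fin eq, of x] below) simp_all
    next
      case False
      with x show ?thesis
        by (intro *[OF assms(2,1) fin(2,1) eq[symmetric], of x] below[symmetric]) simp_all
    qed
  qed
qed

definition row_count :: "perm \<Rightarrow> point list \<Rightarrow> nat \<Rightarrow> nat" where
  "row_count \<sigma> s i = card {p \<in> points \<sigma> - set s. cell_row s p = i}"

definition col_count :: "perm \<Rightarrow> point list \<Rightarrow> nat \<Rightarrow> nat" where
  "col_count \<sigma> s j = card {p \<in> points \<sigma> - set s. cell_col s p = j}"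

text \<open>Projection to positions turns the columns of the grid into the gaps of the set of
  positions of s. Projection to values does the same for rows.\<close>

lemma col_count_eq_level_count:
  assumes "set s \<subseteq> points \<sigma>"
  shows "col_count \<sigma> s (Suc i) =
    card {x \<in> {1..fst \<sigma>} - fst ` set s. card {y \<in> fst ` set s. y < x} = i}"
proof -
  have inj: "inj_on fst (points \<sigma>)" by (rule inj_on_fst_points)
  have lev: "card {y \<in> fst ` set s. y < fst p} = card {q \<in> set s. q \<prec>\<^sub>P p}" for p :: point
  proof -
    have "{y \<in> fst ` set s. y < fst p} = fst ` {q \<in> set s. q \<prec>\<^sub>P p}" by (auto simp: less_P_def)
    then show ?thesis using inj assms by (auto intro!: card_image intro: inj_on_subset)
  qed
  have "{x \<in> {1..fst \<sigma>} - fst ` set s. card {y \<in> fst ` set s. y < x} = i}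
      = {x \<in> fst ` (points \<sigma> - set s). card {y \<in> fst ` set s. y < x} = i}"
    using inj assms by (simp add: inj_on_image_set_diff[of fst "points \<sigma>"] fst_image_points)
  also have "\<dots> = fst ` {p \<in> points \<sigma> - set s. card {y \<in> fst ` set s. y < fst p} = i}"
    by blast
  also have "\<dots> = fst ` {p \<in> points \<sigma> - set s. cell_col s p = Suc i}"
    by (simp only: cell_col_def lev nat.inject)
  also have "card \<dots> = card {p \<in> points \<sigma> - set s. cell_col s p = Suc i}"
    by (rule card_image) (auto intro: inj_on_subset[OF inj])
  finally show ?thesis by (simp add: col_count_def)
qed

lemma row_count_eq_level_count:
  assumes "\<sigma> \<in> perms" "set s \<subseteq> points \<sigma>"
  shows "row_count \<sigma> s (Suc i) =
    card {x \<in> {1..fst \<sigma>} - snd ` set s. card {y \<in> snd ` set s. y < x} = i}"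
proof -
  have inj: "inj_on snd (points \<sigma>)" using assms(1) by (rule inj_on_snd_points)
  have lev: "card {y \<in> snd ` set s. y < snd p} = card {q \<in> set s. q \<prec>\<^sub>V p}" for p :: point
  proof -
    have "{y \<in> snd ` set s. y < snd p} = snd ` {q \<in> set s. q \<prec>\<^sub>V p}" by (auto simp: less_V_def)
    then show ?thesis using inj assms by (auto intro!: card_image intro: inj_on_subset)
  qed
  have "{x \<in> {1..fst \<sigma>} - snd ` set s. card {y \<in> snd ` set s. y < x} = i}
      = {x \<in> snd ` (points \<sigma> - set s). card {y \<in> snd ` set s. y < x} = i}"
    using inj assms by (simp add: inj_on_image_set_diff[of snd "points \<sigma>"] snd_image_points)
  also have "\<dots> = snd ` {p \<in> points \<sigma> - set s. card {y \<in> snd ` set s. y < snd p} = i}"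
    by blast
  also have "\<dots> = snd ` {p \<in> points \<sigma> - set s. cell_row s p = Suc i}"
    by (simp only: cell_row_def lev nat.inject)
  also have "card \<dots> = card {p \<in> points \<sigma> - set s. cell_row s p = Suc i}"
    by (rule card_image) (auto intro: inj_on_subset[OF inj])
  finally show ?thesis by (simp add: row_count_def)
qed

lemma stable_iff_image:
  assumes "set s \<subseteq> points \<sigma>"
  shows "stable \<sigma> s \<longleftrightarrow> fst ` set s = snd ` set s"
proof -
  have "snd \<sigma> ` fst ` set s = snd ` set s"
    unfolding image_image using assms by (intro image_cong) (auto simp: mem_points_iff)
  then show ?thesis by (auto simp: stable_def)
qed

text \<open>Stability means that the positions and the values of s form the same set, and each of
  the two sets is determined by its gap sizes.\<close>

lemma stable_iff_row_count_eq_col_count: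
  assumes "\<sigma> \<in> perms" "set s \<subseteq> points \<sigma>"
  shows "stable \<sigma> s \<longleftrightarrow> (\<forall>i. row_count \<sigma> s i = col_count \<sigma> s i)"
proof
  assume "stable \<sigma> s"
  then have "row_count \<sigma> s (Suc i) = col_count \<sigma> s (Suc i)" for i
    using assms by (simp add: stable_iff_image row_count_eq_level_count col_count_eq_level_count)
  \<comment> \<open>Gaps are numbered from 0 and rows and columns from 1, so index 0 is separate;
    both counts vanish there.\<close>
  moreover have "row_count \<sigma> s 0 = col_count \<sigma> s 0"
    by (simp add: row_count_def col_count_def cell_row_def cell_col_def)
  ultimately show "\<forall>i. row_count \<sigma> s i = col_count \<sigma> s i" by (metis not0_implies_Suc)
next
  assume *: "\<forall>i. row_count \<sigma> s i = col_count \<sigma> s i"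
  have "fst ` set s \<subseteq> {1..fst \<sigma>}" "snd ` set s \<subseteq> {1..fst \<sigma>}"
    using assms fst_image_points snd_image_points by blast+
  then have "fst ` set s = snd ` set s"
    by (rule level_counts_eq_imp_eq)
      (use * in \<open>simp only: row_count_eq_level_count[OF assms, symmetric]
        col_count_eq_level_count[OF assms(2), symmetric]\<close>)
  then show "stable \<sigma> s" using assms(2) by (simp add: stable_iff_image)
qed

section \<open>Ehrenfeucht-Fraisse games on inflations\<close>

primrec qr :: "toto \<Rightarrow> nat" where
  "qr (Eq x y) = 0"
| "qr (LessP x y) = 0"
| "qr (LessV x y) = 0"
| "qr (Neg \<phi>) = qr \<phi>"
| "qr (Conj \<phi> \<psi>) = max (qr \<phi>) (qr \<psi>)"
| "qr (Ex x \<phi>) = Suc (qr \<phi>)"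

section \<open>Distance games on linear orders\<close>

text \<open>The usual invariant for games on finite linear orders with m rounds left: distances
  agree or are both too large to be distinguished. The distances are signed, so that order and
  equality are read off together.\<close>

definition near :: "nat \<Rightarrow> int \<Rightarrow> int \<Rightarrow> bool" where
  "near m d d' \<longleftrightarrow> d = d' \<or> 2 ^ m \<le> d \<and> 2 ^ m \<le> d' \<or> d \<le> - (2 ^ m) \<and> d' \<le> - (2 ^ m)"

text \<open>A pair in K consists of corresponding positions in the two orders.\<close>

definition good :: "nat \<Rightarrow> (int \<times> int) set \<Rightarrow> bool" where
  "good m K \<longleftrightarrow> (\<forall>x\<in>K. \<forall>y\<in>K. near m (fst x - fst y) (snd x - snd y))"

lemma near_0_iff: "near m d d' \<Longrightarrow> 0 < d \<longleftrightarrow> 0 < d'"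
proof -
  assume "near m d d'"
  moreover have "(1::int) \<le> 2 ^ m" by simp
  ultimately show ?thesis unfolding near_def by linarith
qed

lemma near_minus: "near m (a - b) (a' - b') \<Longrightarrow> near m (b - a) (b' - a')"
  unfolding near_def by auto

lemma near_mono: "near m d d' \<Longrightarrow> m' \<le> m \<Longrightarrow> near m' d d'"
proof -
  assume "near m d d'" "m' \<le> m"
  moreover have "(2::int) ^ m' \<le> 2 ^ m" using \<open>m' \<le> m\<close> by simp
  ultimately show ?thesis unfolding near_def by linarith
qed

lemma good_swap: "good m K \<Longrightarrow> good m ((\<lambda>z. (snd z, fst z)) ` K)"
proof -
  have "near m d d' \<Longrightarrow> near m d' d" for d d' by (auto simp: near_def)
  then show "good m K \<Longrightarrow> good m ((\<lambda>z. (snd z, fst z)) ` K)" by (simp add: good_def)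
qed

lemma good_subset: "good m K \<Longrightarrow> L \<subseteq> K \<Longrightarrow> good m L"
  unfolding good_def by blast

lemma good_mono: "good m K \<Longrightarrow> m' \<le> m \<Longrightarrow> good m' K"
  unfolding good_def using near_mono by blast

lemma good_insert:
  assumes "good m K" "\<And>y. y \<in> K \<Longrightarrow> near m (u - fst y) (u' - snd y)"
  shows "good m (insert (u, u') K)"
  unfolding good_def
proof (intro ballI)
  fix x y assume xy: "x \<in> insert (u, u') K" "y \<in> insert (u, u') K"
  show "near m (fst x - fst y) (snd x - snd y)"
  proof (cases "x = (u, u')")
    case True
    with xy assms(2)[of y] show ?thesis by (cases "y = (u, u')") (auto simp: near_def)
  next
    case False
    with xy have x: "x \<in> K" by simp
    show ?thesis
    proof (cases "y = (u, u')")
      case True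
      with near_minus[OF assms(2)[OF x]] show ?thesis by simp
    next
      case False
      with xy x assms(1) show ?thesis by (simp add: good_def)
    qed
  qed
qed

text \<open>The answer to a move u within 2^m of a chosen element copies its offset from that
  element; a distance of at least 2^(m+1) shortened by less than 2^m stays at least 2^m. The
  elements l and r guarantee that a move far from everything still has neighbours on both
  sides.\<close>

lemma good_extend:
  assumes K: "good (Suc m) K" "finite K" and l: "l \<in> K" "fst l < u" and r: "r \<in> K" "u < fst r"
  obtains u' where "good m (insert (u, u') K)"
proof (cases "\<exists>x\<in>K. \<bar>u - fst x\<bar> < 2 ^ m")
  case True
  then obtain x where x: "x \<in> K" "\<bar>u - fst x\<bar> < 2 ^ m" by blast
  have "good m (insert (u, snd x + (u - fst x)) K)"
  proof (rule good_insert)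
    show "good m K" using K(1) by (rule good_mono) simp
    fix y assume "y \<in> K"
    then have "near (Suc m) (fst x - fst y) (snd x - snd y)"
      using K(1) x(1) by (simp add: good_def)
    then show "near m (u - fst y) (snd x + (u - fst x) - snd y)"
      using x(2) unfolding near_def power_Suc by linarith
  qed
  then show ?thesis by (rule that)
next
  case False
  then have far: "2 ^ m \<le> \<bar>u - fst x\<bar>" if "x \<in> K" for x using that by force
  let ?L = "{x \<in> K. fst x < u}" and ?R = "{x \<in> K. u < fst x}"
  have fin: "finite (fst ` ?L)" "finite (fst ` ?R)" using K(2) by simp_all
  have ne: "fst ` ?L \<noteq> {}" "fst ` ?R \<noteq> {}" using l r by blast+
  obtain a where a: "a \<in> ?L" "fst a = Max (fst ` ?L)"
    using Max_in[OF fin(1) ne(1)] by (metis (no_types, lifting) imageE)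
  have a_max: "fst x \<le> fst a" if "x \<in> ?L" for x
    unfolding a(2) using fin(1) that by (intro Max_ge imageI)
  obtain b where b: "b \<in> ?R" "fst b = Min (fst ` ?R)"
    using Min_in[OF fin(2) ne(2)] by (metis (no_types, lifting) imageE)
  have b_min: "fst b \<le> fst x" if "x \<in> ?R" for x
    unfolding b(2) using fin(2) that by (intro Min_le imageI)
  have ba: "near (Suc m) (fst b - fst a) (snd b - snd a)" using K(1) a(1) b(1) by (simp add: good_def)
  have dist: "2 ^ m \<le> u - fst a" "2 ^ m \<le> fst b - u" using far[of a] far[of b] a(1) b(1) by simp_all
  \<comment> \<open>The neighbours a and b of u are at least 2^(m+1) apart, hence so are their
    partners. The place 2^m after the partner of a is therefore far from both partners.\<close>
  have "good m (insert (u, snd a + 2 ^ m) K)"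
  proof (rule good_insert)
    show "good m K" using K(1) by (rule good_mono) simp
    fix y assume y: "y \<in> K"
    consider "y \<in> ?L" | "y \<in> ?R" using y far[OF y] by (cases "fst y" u rule: linorder_cases) auto
    then show "near m (u - fst y) (snd a + 2 ^ m - snd y)"
    proof cases
      case 1
      then have "near (Suc m) (fst a - fst y) (snd a - snd y)" "fst y \<le> fst a"
        using K(1) a(1) y a_max[OF 1] by (simp_all add: good_def)
      moreover have "(1::int) \<le> 2 ^ m" by simp
      ultimately show ?thesis using dist unfolding near_def power_Suc by linarith
    next
      case 2
      then have "near (Suc m) (fst y - fst b) (snd y - snd b)" "fst b \<le> fst y"
        using K(1) b(1) y b_min[OF 2] by (simp_all add: good_def)
      moreover have "(1::int) \<le> 2 ^ m" by simp
      ultimately show ?thesis using dist ba unfolding near_def power_Suc by linarith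
    qed
  qed
  then show ?thesis by (rule that)
qed

section \<open>The game on two inflations\<close>

text \<open>The isomorphism hidden in \<open>is_inflation\<close>, made explicit so that a point of
  the inflation can be addressed by its block and its place in the block.\<close>

definition inflation_map :: "perm \<Rightarrow> (point \<Rightarrow> perm) \<Rightarrow> perm \<Rightarrow> (point \<times> point \<Rightarrow> point) \<Rightarrow> bool" where
  "inflation_map \<sigma> F \<tau> f \<longleftrightarrow>
     bij_betw f (SIGMA p : points \<sigma>. points (F p)) (points \<tau>) \<and>
        (\<forall>p\<in>points \<sigma>. \<forall>q\<in>points \<sigma>. \<forall>u\<in>points (F p). \<forall>v\<in>points (F q).
           (f (p, u) \<prec>\<^sub>P f (q, v) \<longleftrightarrow> p \<prec>\<^sub>P q \<or> p = q \<and> u \<prec>\<^sub>P v) \<and>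
           (f (p, u) \<prec>\<^sub>V f (q, v) \<longleftrightarrow> p \<prec>\<^sub>V q \<or> p = q \<and> u \<prec>\<^sub>V v))"

lemma is_inflation_iff: "is_inflation \<sigma> F \<tau> \<longleftrightarrow> \<tau> \<in> perms \<and> (\<exists>f. inflation_map \<sigma> F \<tau> f)"
  by (simp add: is_inflation_def inflation_map_def)

lemma inflation_map_less:
  assumes "inflation_map \<sigma> F \<tau> f" "p \<in> points \<sigma>" "q \<in> points \<sigma>" "u \<in> points (F p)" "v \<in> points (F q)"
  shows "f (p, u) \<prec>\<^sub>P f (q, v) \<longleftrightarrow> p \<prec>\<^sub>P q \<or> p = q \<and> u \<prec>\<^sub>P v"
    "f (p, u) \<prec>\<^sub>V f (q, v) \<longleftrightarrow> p \<prec>\<^sub>V q \<or> p = q \<and> u \<prec>\<^sub>V v"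
proof -
  have "\<forall>p\<in>points \<sigma>. \<forall>q\<in>points \<sigma>. \<forall>u\<in>points (F p). \<forall>v\<in>points (F q).
      (f (p, u) \<prec>\<^sub>P f (q, v) \<longleftrightarrow> p \<prec>\<^sub>P q \<or> p = q \<and> u \<prec>\<^sub>P v) \<and>
      (f (p, u) \<prec>\<^sub>V f (q, v) \<longleftrightarrow> p \<prec>\<^sub>V q \<or> p = q \<and> u \<prec>\<^sub>V v)"
    using assms(1) by (simp add: inflation_map_def)
  from this[rule_format, OF assms(2-5)]
  show "f (p, u) \<prec>\<^sub>P f (q, v) \<longleftrightarrow> p \<prec>\<^sub>P q \<or> p = q \<and> u \<prec>\<^sub>P v"
    "f (p, u) \<prec>\<^sub>V f (q, v) \<longleftrightarrow> p \<prec>\<^sub>V q \<or> p = q \<and> u \<prec>\<^sub>V v" by simp_all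
qed

lemma inflation_map_eq:
  assumes "inflation_map \<sigma> F \<tau> f" "p \<in> points \<sigma>" "q \<in> points \<sigma>" "u \<in> points (F p)" "v \<in> points (F q)"
  shows "f (p, u) = f (q, v) \<longleftrightarrow> p = q \<and> u = v"
proof -
  have "inj_on f (SIGMA p : points \<sigma>. points (F p))"
    using assms(1) by (simp add: inflation_map_def bij_betw_def)
  from inj_on_eq_iff[OF this, of "(p, u)" "(q, v)"] assms show ?thesis by simp
qed

text \<open>
  The position of a game on two inflations that differ only in the monotone block at p0. The
  set K holds the indices chosen so far inside that block, with its two ends as sentinels.
\<close>

definition game_pairs :: "point \<Rightarrow> perm \<Rightarrow> perm \<Rightarrow> nat set \<Rightarrow>
    (nat \<Rightarrow> point \<times> point) \<Rightarrow> (nat \<Rightarrow> point \<times> point) \<Rightarrow> (int \<times> int) set" where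
  "game_pairs p0 \<theta> \<theta>' V w w' = {(0, 0), (int (fst \<theta>) + 1, int (fst \<theta>') + 1)} \<union>
     (\<lambda>x. (int (fst (snd (w x))), int (fst (snd (w' x))))) ` {x \<in> V. fst (w x) = p0}"

definition game :: "perm \<Rightarrow> point \<Rightarrow> (point \<Rightarrow> perm) \<Rightarrow> (point \<Rightarrow> perm) \<Rightarrow> nat \<Rightarrow> nat set \<Rightarrow>
    (nat \<Rightarrow> point \<times> point) \<Rightarrow> (nat \<Rightarrow> point \<times> point) \<Rightarrow> bool" where
  "game \<sigma> p0 F F' m V w w' \<longleftrightarrow>
     (\<forall>x\<in>V. fst (w' x) = fst (w x) \<and> fst (w x) \<in> points \<sigma> \<and>
        snd (w x) \<in> points (F (fst (w x))) \<and> snd (w' x) \<in> points (F' (fst (w x))) \<and>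
        (fst (w x) \<noteq> p0 \<longrightarrow> snd (w' x) = snd (w x))) \<and>
     good m (game_pairs p0 (F p0) (F' p0) V w w')"

lemma game_sym: "game \<sigma> p0 F F' m V w w' \<Longrightarrow> game \<sigma> p0 F' F m V w' w"
proof -
  assume g: "game \<sigma> p0 F F' m V w w'"
  then have "{x \<in> V. fst (w' x) = p0} = {x \<in> V. fst (w x) = p0}" unfolding game_def by auto
  then have "game_pairs p0 (F' p0) (F p0) V w' w = (\<lambda>z. (snd z, fst z)) ` game_pairs p0 (F p0) (F' p0) V w w'"
    by (simp add: game_pairs_def image_Un image_image)
  then show ?thesis using g good_swap[of m] by (simp add: game_def)
qed

text \<open>A move outside the block at p0 is copied literally, since the two inflations agree
  there. A move inside it is answered by \<open>good_extend\<close>, with the sentinels as the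
  elements on either side.\<close>

lemma game_forth:
  assumes g: "game \<sigma> p0 F F' (Suc m) V w w'" and V: "finite V"
    and F: "\<And>p. p \<in> points \<sigma> \<Longrightarrow> p \<noteq> p0 \<Longrightarrow> F' p = F p"
    and pu: "p \<in> points \<sigma>" "u \<in> points (F p)"
  obtains v where "v \<in> points (F' p)" "game \<sigma> p0 F F' m (insert x V) (w(x := (p, u))) (w'(x := (p, v)))"
proof -
  let ?K = "game_pairs p0 (F p0) (F' p0) V w w'"
  have good: "good (Suc m) ?K" using g by (simp add: game_def)
  show ?thesis
  proof (cases "p = p0")
    case False
    have "game_pairs p0 (F p0) (F' p0) (insert x V) (w(x := (p, u))) (w'(x := (p, u))) \<subseteq> ?K"
      using False unfolding game_pairs_def by auto
    then have "good m (game_pairs p0 (F p0) (F' p0) (insert x V) (w(x := (p, u))) (w'(x := (p, u))))"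
      using good_subset good_mono[OF good, of m] by simp
    then have "game \<sigma> p0 F F' m (insert x V) (w(x := (p, u))) (w'(x := (p, u)))"
      using g pu F[OF pu(1) False] False unfolding game_def by simp
    then show ?thesis using pu F[OF pu(1) False] by (intro that[of u]) simp_all
  next
    case True
    let ?n = "fst (F p0)" and ?n' = "fst (F' p0)" and ?i = "int (fst u)"
    have u: "0 < ?i" "?i < int ?n + 1" using pu(2) True by (auto simp: mem_points_iff)
    have ends: "(0, 0) \<in> ?K" "(int ?n + 1, int ?n' + 1) \<in> ?K" by (simp_all add: game_pairs_def)
    have "finite ?K" using V by (simp add: game_pairs_def)
    then obtain i' where i': "good m (insert (?i, i') ?K)"
      using good_extend[OF good _ ends(1) _ ends(2), of ?i] u by auto
    \<comment> \<open>Nearness preserves signs, so comparison with both sentinels forces the answer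
      to be an actual position of the second block.\<close>
    have "near m (?i - 0) (i' - 0)" "near m (int ?n + 1 - ?i) (int ?n' + 1 - i')"
      using ends i'[unfolded good_def, rule_format, of "(?i, i')" "(0, 0)"]
        i'[unfolded good_def, rule_format, of "(int ?n + 1, int ?n' + 1)" "(?i, i')"] by simp_all
    from near_0_iff[OF this(1)] near_0_iff[OF this(2)] u have i'b: "0 < i'" "i' < int ?n' + 1" by auto
    define v where "v = (nat i', snd (F' p0) (nat i'))"
    have v: "v \<in> points (F' p)" using i'b True by (auto simp: mem_points_iff v_def)
    have "game_pairs p0 (F p0) (F' p0) (insert x V) (w(x := (p, u))) (w'(x := (p, v))) \<subseteq> insert (?i, i') ?K"
      using i'b unfolding game_pairs_def v_def by auto
    then have "good m (game_pairs p0 (F p0) (F' p0) (insert x V) (w(x := (p, u))) (w'(x := (p, v))))"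
      using good_subset[OF i'] by blast
    then have "game \<sigma> p0 F F' m (insert x V) (w(x := (p, u))) (w'(x := (p, v)))"
      using g pu v True unfolding game_def by simp
    with v show ?thesis by (rule that)
  qed
qed

definition comonotone :: "perm \<Rightarrow> perm \<Rightarrow> bool" where
  "comonotone \<theta> \<theta>' \<longleftrightarrow> \<theta> \<in> increasing_perms \<and> \<theta>' \<in> increasing_perms \<or>
     \<theta> \<in> decreasing_perms \<and> \<theta>' \<in> decreasing_perms"

lemma increasing_perms_less:
  assumes "\<theta> \<in> increasing_perms" "u \<in> points \<theta>" "v \<in> points \<theta>"
  shows "u \<prec>\<^sub>V v \<longleftrightarrow> fst u < fst v"
proof -
  have *: "\<And>i j. i \<in> {1..fst \<theta>} \<Longrightarrow> j \<in> {1..fst \<theta>} \<Longrightarrow> i < j \<Longrightarrow> snd \<theta> i < snd \<theta> j"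
    using assms(1) by (simp add: increasing_perms_def)
  show ?thesis
    using assms(2,3) *[of "fst u" "fst v"] *[of "fst v" "fst u"]
    by (cases "fst u" "fst v" rule: linorder_cases) (simp_all add: mem_points_iff less_V_def)
qed

lemma decreasing_perms_less:
  assumes "\<theta> \<in> decreasing_perms" "u \<in> points \<theta>" "v \<in> points \<theta>"
  shows "u \<prec>\<^sub>V v \<longleftrightarrow> fst v < fst u"
proof -
  have *: "\<And>i j. i \<in> {1..fst \<theta>} \<Longrightarrow> j \<in> {1..fst \<theta>} \<Longrightarrow> i < j \<Longrightarrow> snd \<theta> j < snd \<theta> i"
    using assms(1) by (simp add: decreasing_perms_def)
  show ?thesis
    using assms(2,3) *[of "fst u" "fst v"] *[of "fst v" "fst u"]
    by (cases "fst u" "fst v" rule: linorder_cases) (simp_all add: mem_points_iff less_V_def)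
qed

text \<open>In a monotone block the value order is the position order or its reverse, so a game that
  only tracks positions controls both orders.\<close>

lemma comonotone_less:
  assumes "comonotone \<theta> \<theta>'" "u \<in> points \<theta>" "v \<in> points \<theta>" "u' \<in> points \<theta>'" "v' \<in> points \<theta>'"
    and "fst u < fst v \<longleftrightarrow> fst u' < fst v'" "fst v < fst u \<longleftrightarrow> fst v' < fst u'"
  shows "u \<prec>\<^sub>V v \<longleftrightarrow> u' \<prec>\<^sub>V v'"
  using assms(1) unfolding comonotone_def
proof (elim disjE conjE)
  assume "\<theta> \<in> increasing_perms" "\<theta>' \<in> increasing_perms"
  then show ?thesis using assms(2-6) by (simp add: increasing_perms_less)
next
  assume "\<theta> \<in> decreasing_perms" "\<theta>' \<in> decreasing_perms"
  then show ?thesis using assms(2-5,7) by (simp add: decreasing_perms_less)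
qed

text \<open>Points of different blocks compare as the blocks do, which is common to both sides.
  Within the block at p0 the sign of the tracked distance decides, and within any other block the
  two chosen points are literally the same on both sides.\<close>

lemma game_atoms:
  assumes g: "game \<sigma> p0 F F' m V w w'" and f: "inflation_map \<sigma> F \<tau> f" "inflation_map \<sigma> F' \<tau>' f'"
    and mono: "comonotone (F p0) (F' p0)" and xy: "x \<in> V" "y \<in> V"
  shows "f (w x) \<prec>\<^sub>P f (w y) \<longleftrightarrow> f' (w' x) \<prec>\<^sub>P f' (w' y)"
    "f (w x) \<prec>\<^sub>V f (w y) \<longleftrightarrow> f' (w' x) \<prec>\<^sub>V f' (w' y)"
    "f (w x) = f (w y) \<longleftrightarrow> f' (w' x) = f' (w' y)"
proof -
  obtain p u u' where x: "w x = (p, u)" "w' x = (p, u')" "p \<in> points \<sigma>" "u \<in> points (F p)"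
      "u' \<in> points (F' p)" "p \<noteq> p0 \<longrightarrow> u' = u"
    using g xy(1) by (cases "w x"; cases "w' x") (fastforce simp: game_def)
  obtain q v v' where y: "w y = (q, v)" "w' y = (q, v')" "q \<in> points \<sigma>" "v \<in> points (F q)"
      "v' \<in> points (F' q)" "q \<noteq> p0 \<longrightarrow> v' = v"
    using g xy(2) by (cases "w y"; cases "w' y") (fastforce simp: game_def)
  have *: "(u \<prec>\<^sub>P v \<longleftrightarrow> u' \<prec>\<^sub>P v') \<and> (u \<prec>\<^sub>V v \<longleftrightarrow> u' \<prec>\<^sub>V v') \<and> (u = v \<longleftrightarrow> u' = v')" if "p = q"
  proof (cases "p = p0")
    case True
    have "(int (fst u), int (fst u')) \<in> game_pairs p0 (F p0) (F' p0) V w w'"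
      unfolding game_pairs_def using True xy x by (intro UnI2 image_eqI[of _ _ x]) auto
    moreover have "(int (fst v), int (fst v')) \<in> game_pairs p0 (F p0) (F' p0) V w w'"
      unfolding game_pairs_def using True that xy y by (intro UnI2 image_eqI[of _ _ y]) auto
    ultimately have "near m (int (fst u) - int (fst v)) (int (fst u') - int (fst v'))"
      using g unfolding game_def good_def by (metis fst_conv snd_conv)
    note near_0_iff[OF this] near_0_iff[OF near_minus[OF this]]
    then have le: "fst u < fst v \<longleftrightarrow> fst u' < fst v'" "fst v < fst u \<longleftrightarrow> fst v' < fst u'"
      by simp_all
    then have "fst u = fst v \<longleftrightarrow> fst u' = fst v'" by linarith
    moreover have "u = v \<longleftrightarrow> fst u = fst v" "u' = v' \<longleftrightarrow> fst u' = fst v'"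
      using x(4,5) y(4,5) that by (auto simp: mem_points_iff prod_eq_iff)
    ultimately have "u = v \<longleftrightarrow> u' = v'" by simp
    moreover have "u \<prec>\<^sub>V v \<longleftrightarrow> u' \<prec>\<^sub>V v'"
      using x(4,5) y(4,5) that True by (intro comonotone_less[OF mono _ _ _ _ le]) simp_all
    ultimately show ?thesis using le by (simp add: less_P_def)
  qed (use x(6) y(6) that in simp)
  show "f (w x) \<prec>\<^sub>P f (w y) \<longleftrightarrow> f' (w' x) \<prec>\<^sub>P f' (w' y)"
    unfolding x(1,2) y(1,2) inflation_map_less(1)[OF f(1) x(3) y(3) x(4) y(4)]
      inflation_map_less(1)[OF f(2) x(3) y(3) x(5) y(5)] using * by blast
  show "f (w x) \<prec>\<^sub>V f (w y) \<longleftrightarrow> f' (w' x) \<prec>\<^sub>V f' (w' y)"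
    unfolding x(1,2) y(1,2) inflation_map_less(2)[OF f(1) x(3) y(3) x(4) y(4)]
      inflation_map_less(2)[OF f(2) x(3) y(3) x(5) y(5)] using * by blast
  show "f (w x) = f (w y) \<longleftrightarrow> f' (w' x) = f' (w' y)"
    unfolding x(1,2) y(1,2) inflation_map_eq[OF f(1) x(3) y(3) x(4) y(4)]
      inflation_map_eq[OF f(2) x(3) y(3) x(5) y(5)] using * by blast
qed

text \<open>One direction of the quantifier step. The predicates P and P' stand for satisfaction on
  the two sides, so that the same lemma serves for both directions.\<close>

lemma game_sat_Ex:
  assumes g: "game \<sigma> p0 F F' (Suc m) V w w'" and V: "finite V"
    and f: "inflation_map \<sigma> F \<tau> f" "inflation_map \<sigma> F' \<tau>' f'"
    and F: "\<And>p. p \<in> points \<sigma> \<Longrightarrow> p \<noteq> p0 \<Longrightarrow> F' p = F p"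
    and e: "\<And>y. y \<in> V \<Longrightarrow> e y = f (w y)" "\<And>y. y \<in> V \<Longrightarrow> e' y = f' (w' y)"
    and IH: "\<And>w w' e e'. game \<sigma> p0 F F' m (insert x V) w w' \<Longrightarrow>
      (\<And>y. y \<in> insert x V \<Longrightarrow> e y = f (w y)) \<Longrightarrow> (\<And>y. y \<in> insert x V \<Longrightarrow> e' y = f' (w' y)) \<Longrightarrow>
      P e \<Longrightarrow> P' e'"
    and ex: "\<exists>a\<in>points \<tau>. P (e(x := a))"
  shows "\<exists>a\<in>points \<tau>'. P' (e'(x := a))"
proof -
  obtain a where a: "a \<in> points \<tau>" "P (e(x := a))" using ex by blast
  then obtain p u where pu: "p \<in> points \<sigma>" "u \<in> points (F p)" "a = f (p, u)"
    using f(1) unfolding inflation_map_def bij_betw_def by blast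
  obtain v where v: "v \<in> points (F' p)"
      "game \<sigma> p0 F F' m (insert x V) (w(x := (p, u))) (w'(x := (p, v)))"
    using game_forth[OF g V F pu(1,2)] by blast
  have "P' (e'(x := f' (p, v)))"
    by (rule IH[OF v(2) _ _ a(2)]) (use e pu in auto)
  moreover have "f' (p, v) \<in> points \<tau>'"
    using f(2) pu(1) v(1) by (auto simp: inflation_map_def bij_betw_def)
  ultimately show ?thesis by blast
qed

text \<open>V collects the variables whose values are tracked. The assignments are unconstrained
  elsewhere, as fits \<open>models\<close>, whose assignment is meaningless outside the indices of
  the list.\<close>

lemma game_sat:
  assumes f: "inflation_map \<sigma> F \<tau> f" "inflation_map \<sigma> F' \<tau>' f'"
    and F: "\<And>p. p \<in> points \<sigma> \<Longrightarrow> p \<noteq> p0 \<Longrightarrow> F' p = F p" and mono: "comonotone (F p0) (F' p0)"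
  shows "game \<sigma> p0 F F' m V w w' \<Longrightarrow> finite V \<Longrightarrow> fv \<phi> \<subseteq> V \<Longrightarrow> qr \<phi> \<le> m \<Longrightarrow>
    (\<And>y. y \<in> V \<Longrightarrow> e y = f (w y)) \<Longrightarrow> (\<And>y. y \<in> V \<Longrightarrow> e' y = f' (w' y)) \<Longrightarrow>
    sat (points \<tau>) e \<phi> \<longleftrightarrow> sat (points \<tau>') e' \<phi>"
proof (induction \<phi> arbitrary: m V w w' e e')
  case (Eq x y)
  then show ?case using game_atoms(3)[OF Eq.prems(1) f mono, of x y] by simp
next
  case (LessP x y)
  then show ?case using game_atoms(1)[OF LessP.prems(1) f mono, of x y] by simp
next
  case (LessV x y)
  then show ?case using game_atoms(2)[OF LessV.prems(1) f mono, of x y] by simp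
next
  case (Neg \<phi>)
  then show ?case using Neg.IH[OF Neg.prems(1,2) _ _ Neg.prems(5,6)] by simp
next
  case (Conj \<phi> \<psi>)
  then show ?case
    using Conj.IH(1)[OF Conj.prems(1,2) _ _ Conj.prems(5,6)]
      Conj.IH(2)[OF Conj.prems(1,2) _ _ Conj.prems(5,6)] by simp
next
  case (Ex x \<phi>)
  then obtain m' where m: "m = Suc m'" "qr \<phi> \<le> m'" by (cases m) auto
  have V: "finite (insert x V)" "fv \<phi> \<subseteq> insert x V" using Ex.prems by auto
  have IH: "sat (points \<tau>) e \<phi> \<longleftrightarrow> sat (points \<tau>') e' \<phi>"
    if "game \<sigma> p0 F F' m' (insert x V) w w'" "\<And>y. y \<in> insert x V \<Longrightarrow> e y = f (w y)"
      "\<And>y. y \<in> insert x V \<Longrightarrow> e' y = f' (w' y)" for w w' e e'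
    using Ex.IH[OF that(1) V m(2) that(2,3)] by simp
  have g: "game \<sigma> p0 F F' (Suc m') V w w'" using Ex.prems(1) m by simp
  have "\<exists>a\<in>points \<tau>'. sat (points \<tau>') (e'(x := a)) \<phi>"
    if "\<exists>a\<in>points \<tau>. sat (points \<tau>) (e(x := a)) \<phi>"
  proof (rule game_sat_Ex[OF g Ex.prems(2) f F, of e e' x "\<lambda>e. sat (points \<tau>) e \<phi>"])
    fix w w' e e'
    assume "game \<sigma> p0 F F' m' (insert x V) w w'" "\<And>y. y \<in> insert x V \<Longrightarrow> e y = f (w y)"
      "\<And>y. y \<in> insert x V \<Longrightarrow> e' y = f' (w' y)" "sat (points \<tau>) e \<phi>"
    then show "sat (points \<tau>') e' \<phi>" using IH by blast
  qed (use that Ex.prems in simp_all)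
  \<comment> \<open>The converse is the same step in the game with its sides exchanged.\<close>
  moreover have "\<exists>a\<in>points \<tau>. sat (points \<tau>) (e(x := a)) \<phi>"
    if "\<exists>a\<in>points \<tau>'. sat (points \<tau>') (e'(x := a)) \<phi>"
  proof (rule game_sat_Ex[OF game_sym[OF g] Ex.prems(2) f(2,1) F[symmetric], of e' e x "\<lambda>e. sat (points \<tau>') e \<phi>"])
    fix w w' e e'
    assume *: "game \<sigma> p0 F' F m' (insert x V) w w'" "\<And>y. y \<in> insert x V \<Longrightarrow> e y = f' (w y)"
      "\<And>y. y \<in> insert x V \<Longrightarrow> e' y = f (w' y)" "sat (points \<tau>') e \<phi>"
    from IH[OF game_sym[OF *(1)] *(3,2)] *(4) show "sat (points \<tau>) e' \<phi>" by simp
  qed (use that Ex.prems in simp_all)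
  ultimately show ?case by auto
qed

section \<open>Boolean combinations and counting in the logic\<close>

text \<open>Built from a negated existential so that it is closed and also true in the empty
  structure, where every existential formula fails.\<close>

definition verum :: toto where
  "verum = Neg (Ex 0 (Neg (Eq 0 0)))"

lemma verum [simp]: "fv verum = {}" "sat A e verum"
  by (simp_all add: verum_def)

text \<open>Case distinction on one formula at a time, as for a truth table. The condition G on the
  set of true formulas is arbitrary; in the end it will refer to the class C.\<close>

lemma boolean_combination:
  assumes "finite \<Phi>"
  shows "\<exists>\<chi>. fv \<chi> \<subseteq> (\<Union>\<phi>\<in>\<Phi>. fv \<phi>) \<and> (\<forall>A e. sat A e \<chi> \<longleftrightarrow> G {\<phi> \<in> \<Phi>. sat A e \<phi>})"
  using assms
proof (induction \<Phi> arbitrary: G rule: finite_induct)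
  case empty
  show ?case by (rule exI[of _ "if G {} then verum else Neg verum"]) simp
next
  case (insert \<phi> \<Phi>)
  obtain \<chi>1 where 1: "fv \<chi>1 \<subseteq> (\<Union>\<phi>\<in>\<Phi>. fv \<phi>)"
      "\<And>A e. sat A e \<chi>1 \<longleftrightarrow> G (insert \<phi> {\<phi> \<in> \<Phi>. sat A e \<phi>})"
    using insert.IH[of "\<lambda>S. G (insert \<phi> S)"] by blast
  obtain \<chi>0 where 0: "fv \<chi>0 \<subseteq> (\<Union>\<phi>\<in>\<Phi>. fv \<phi>)"
      "\<And>A e. sat A e \<chi>0 \<longleftrightarrow> G {\<phi> \<in> \<Phi>. sat A e \<phi>}"
    using insert.IH[of G] by blast
  \<comment> \<open>By de Morgan this is the disjunction of \<phi> with \<open>\<chi>1\<close> and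
    of not \<phi> with \<open>\<chi>0\<close>.\<close>
  have "sat A e (Neg (Conj (Neg (Conj \<phi> \<chi>1)) (Neg (Conj (Neg \<phi>) \<chi>0)))) \<longleftrightarrow>
      G {\<psi> \<in> insert \<phi> \<Phi>. sat A e \<psi>}" for A e
  proof (cases "sat A e \<phi>")
    case True
    then have "{\<psi> \<in> insert \<phi> \<Phi>. sat A e \<psi>} = insert \<phi> {\<psi> \<in> \<Phi>. sat A e \<psi>}" by auto
    with True show ?thesis by (simp add: 1)
  next
    case False
    then have "{\<psi> \<in> insert \<phi> \<Phi>. sat A e \<psi>} = {\<psi> \<in> \<Phi>. sat A e \<psi>}" by auto
    with False show ?thesis by (simp add: 0)
  qed
  moreover have "fv (Neg (Conj (Neg (Conj \<phi> \<chi>1)) (Neg (Conj (Neg \<phi>) \<chi>0)))) \<subseteq> (\<Union>\<phi>\<in>insert \<phi> \<Phi>. fv \<phi>)"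
    using 1(1) 0(1) by auto
  ultimately show ?case by blast
qed

text \<open>A chain of m elements satisfying Q, each to the right of the previous one and the first
  to the right of the value of the variable k + m + 1. Going from left to right makes the elements
  distinct without pairwise inequations, and the numbering keeps all bound variables above the
  arguments 1, ..., k.\<close>

primrec count_above :: "(nat \<Rightarrow> toto) \<Rightarrow> nat \<Rightarrow> nat \<Rightarrow> toto" where
  "count_above Q k 0 = verum"
| "count_above Q k (Suc m) = Ex (k + Suc m)
     (Conj (Conj (LessP (k + Suc (Suc m)) (k + Suc m)) (Q (k + Suc m))) (count_above Q k m))"

text \<open>Reads the tuple back from the assignment used in \<open>models\<close>; binding
  variables above k does not disturb it.\<close>

definition arguments :: "nat \<Rightarrow> (nat \<Rightarrow> point) \<Rightarrow> point list" where
  "arguments k e = map e [1..<Suc k]"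

lemma arguments_upd [simp]: "k < z \<Longrightarrow> arguments k (e(z := a)) = arguments k e"
  by (auto simp: arguments_def)

text \<open>The leftmost element of X is the witness: all the others lie strictly to its
  right.\<close>

lemma Suc_le_card_iff:
  assumes "finite X" "inj_on fst X"
  shows "Suc m \<le> card X \<longleftrightarrow> (\<exists>a\<in>X. m \<le> card {p \<in> X. a \<prec>\<^sub>P p})"
proof
  assume m: "Suc m \<le> card X"
  then have "X \<noteq> {}" by auto
  then obtain a where a: "a \<in> X" "\<And>p. p \<in> X \<Longrightarrow> fst a \<le> fst p"
    using arg_min_if_finite[OF assms(1), of fst] by (metis not_less)
  have "{p \<in> X. a \<prec>\<^sub>P p} = X - {a}"
    using a assms(2) by (auto simp: less_P_def inj_on_def order_less_le)
  with a m assms(1) show "\<exists>a\<in>X. m \<le> card {p \<in> X. a \<prec>\<^sub>P p}" by (intro bexI[of _ a]) auto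
next
  assume "\<exists>a\<in>X. m \<le> card {p \<in> X. a \<prec>\<^sub>P p}"
  then obtain a where a: "a \<in> X" "m \<le> card {p \<in> X. a \<prec>\<^sub>P p}" by blast
  have "{p \<in> X. a \<prec>\<^sub>P p} \<subseteq> X - {a}" by (auto simp: less_P_def)
  then have "card {p \<in> X. a \<prec>\<^sub>P p} \<le> card (X - {a})" using assms(1) by (intro card_mono) simp_all
  with a(2) card_Suc_Diff1[OF assms(1) a(1)] show "Suc m \<le> card X" by linarith
qed

lemma count_formula:
  assumes fv: "\<And>z. k < z \<Longrightarrow> fv (Q z) \<subseteq> {1..k} \<union> {z}"
    and sat_Q: "\<And>A e z. k < z \<Longrightarrow> sat A e (Q z) \<longleftrightarrow> R (arguments k e) (e z)"
  shows "\<exists>\<chi>. fv \<chi> \<subseteq> {1..k} \<and> (\<forall>A e. finite A \<longrightarrow> inj_on fst A \<longrightarrow>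
    (sat A e \<chi> \<longleftrightarrow> m \<le> card {p \<in> A. R (arguments k e) p}))"
proof (cases m)
  case 0
  then show ?thesis by (intro exI[of _ verum]) simp
next
  \<comment> \<open>The outermost quantifier is written separately, since the leftmost element has
    no predecessor to compare with.\<close>
  case (Suc n)
  have fv_above: "fv (count_above Q k m) \<subseteq> {1..k} \<union> {k + Suc m}" for m
  proof (induction m)
    case (Suc m)
    then show ?case using fv[of "k + Suc m"] by fastforce
  qed simp
  have above: "sat A e (count_above Q k m) \<longleftrightarrow>
      m \<le> card {p \<in> A. R (arguments k e) p \<and> e (k + Suc m) \<prec>\<^sub>P p}"
    if A: "finite A" "inj_on fst A" for A e m
  proof (induction m arbitrary: e)
    case (Suc m)
    let ?X = "{p \<in> A. R (arguments k e) p \<and> e (k + Suc (Suc m)) \<prec>\<^sub>P p}"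
    have sub: "{p \<in> A. R (arguments k e) p \<and> a \<prec>\<^sub>P p} = {p \<in> ?X. a \<prec>\<^sub>P p}" if "a \<in> ?X" for a
      using that by (auto simp: less_P_def)
    have upd: "arguments k (e(k + Suc m := a)) = arguments k e"
      "(e(k + Suc m := a)) (k + Suc (Suc m)) = e (k + Suc (Suc m))"
      "(e(k + Suc m := a)) (k + Suc m) = a" for a
      by simp_all
    have "sat A e (count_above Q k (Suc m)) \<longleftrightarrow>
        (\<exists>a\<in>A. (e (k + Suc (Suc m)) \<prec>\<^sub>P a \<and> R (arguments k e) a) \<and>
          m \<le> card {p \<in> A. R (arguments k e) p \<and> a \<prec>\<^sub>P p})"
      unfolding count_above.simps sat.simps Suc.IH upd
      using sat_Q[of "k + Suc m" A] upd by simp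
    also have "\<dots> \<longleftrightarrow> (\<exists>a\<in>?X. m \<le> card {p \<in> A. R (arguments k e) p \<and> a \<prec>\<^sub>P p})"
      by blast
    also have "\<dots> \<longleftrightarrow> (\<exists>a\<in>?X. m \<le> card {p \<in> ?X. a \<prec>\<^sub>P p})"
      using sub by (intro bex_cong refl) simp
    also have "\<dots> \<longleftrightarrow> Suc m \<le> card ?X"
      by (rule Suc_le_card_iff[symmetric]) (auto simp: A(1) intro: inj_on_subset[OF A(2)])
    finally show ?case .
  qed simp
  show ?thesis
  proof (intro exI conjI allI impI)
    show "fv (Ex (k + Suc n) (Conj (Q (k + Suc n)) (count_above Q k n))) \<subseteq> {1..k}"
      using fv[of "k + Suc n"] fv_above[of n] by fastforce
    fix A :: "point set" and e assume A: "finite A" "inj_on fst A"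
    let ?X = "{p \<in> A. R (arguments k e) p}"
    have upd: "arguments k (e(k + Suc n := a)) = arguments k e" "(e(k + Suc n := a)) (k + Suc n) = a" for a
      by simp_all
    have "sat A e (Ex (k + Suc n) (Conj (Q (k + Suc n)) (count_above Q k n))) \<longleftrightarrow>
        (\<exists>a\<in>A. R (arguments k e) a \<and> n \<le> card {p \<in> A. R (arguments k e) p \<and> a \<prec>\<^sub>P p})"
      unfolding sat.simps above[OF A] upd using sat_Q[of "k + Suc n" A] upd by simp
    also have "\<dots> \<longleftrightarrow> (\<exists>a\<in>?X. n \<le> card {p \<in> ?X. a \<prec>\<^sub>P p})"
    proof -
      have "{p \<in> ?X. a \<prec>\<^sub>P p} = {p \<in> A. R (arguments k e) p \<and> a \<prec>\<^sub>P p}" for a by blast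
      then show ?thesis by (simp only: mem_Collect_eq Bex_def conj_assoc)
    qed
    also have "\<dots> \<longleftrightarrow> m \<le> card ?X"
      unfolding Suc by (rule Suc_le_card_iff[symmetric]) (auto simp: A(1) intro: inj_on_subset[OF A(2)])
    finally show "sat A e (Ex (k + Suc n) (Conj (Q (k + Suc n)) (count_above Q k n))) \<longleftrightarrow> m \<le> card ?X" .
  qed
qed

section \<open>Inflated expansions\<close>

text \<open>Comparison of two-digit numbers in base M is lexicographic.\<close>

lemma block_less:
  fixes a b u v M :: nat
  assumes "u < M" "v < M"
  shows "a * M + u < b * M + v \<longleftrightarrow> a < b \<or> a = b \<and> u < v"
proof -
  have "x * M + y < x' * M + y'" if "x < x'" "y < M" for x x' y y'
  proof -
    have "Suc x * M \<le> x' * M" using that by (intro mult_le_mono1) simp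
    then show ?thesis using that by simp
  qed
  from this[of a b u v] this[of b a v u] show ?thesis
    using assms by (cases a b rule: linorder_cases) auto
qed

text \<open>Each coordinate of a point is the two-digit number in base M formed from the block and
  the place in the block, with M above every coordinate occurring in a block; the resulting set is
  standardized.\<close>

lemma exists_inflation:
  assumes "\<sigma> \<in> perms" "\<And>p. p \<in> points \<sigma> \<Longrightarrow> F p \<in> perms"
  obtains \<tau> f where "\<tau> \<in> perms" "inflation_map \<sigma> F \<tau> f"
proof -
  define M where "M = Suc (\<Sum>p\<in>points \<sigma>. fst (F p))"
  define X where "X = (SIGMA p : points \<sigma>. points (F p))"
  define g where "g x = (fst (fst x) * M + fst (snd x), snd (fst x) * M + snd (snd x))"
    for x :: "point \<times> point"
  have bound: "fst u < M" "snd u < M" if "p \<in> points \<sigma>" "u \<in> points (F p)" for p u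
  proof -
    have "fst (F p) \<le> (\<Sum>p\<in>points \<sigma>. fst (F p))" using that(1) by (intro member_le_sum) auto
    moreover have "fst u \<in> {1..fst (F p)}" "snd u \<in> {1..fst (F p)}"
      using that(2) fst_image_points[of "F p"] snd_image_points[OF assms(2)[OF that(1)]] by blast+
    ultimately show "fst u < M" "snd u < M" by (auto simp: M_def)
  qed
  have less: "g (p, u) \<prec>\<^sub>P g (q, v) \<longleftrightarrow> p \<prec>\<^sub>P q \<or> p = q \<and> u \<prec>\<^sub>P v"
      "g (p, u) \<prec>\<^sub>V g (q, v) \<longleftrightarrow> p \<prec>\<^sub>V q \<or> p = q \<and> u \<prec>\<^sub>V v"
    if "p \<in> points \<sigma>" "q \<in> points \<sigma>" "u \<in> points (F p)" "v \<in> points (F q)" for p q u v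
  proof -
    have "fst p = fst q \<longleftrightarrow> p = q"
      using inj_on_eq_iff[OF inj_on_fst_points that(1,2)] .
    then show "g (p, u) \<prec>\<^sub>P g (q, v) \<longleftrightarrow> p \<prec>\<^sub>P q \<or> p = q \<and> u \<prec>\<^sub>P v"
      using block_less[OF bound(1)[OF that(1,3)] bound(1)[OF that(2,4)], of "fst p" "fst q"]
      by (simp add: g_def less_P_def)
    have "snd p = snd q \<longleftrightarrow> p = q"
      using inj_on_eq_iff[OF inj_on_snd_points[OF assms(1)] that(1,2)] .
    then show "g (p, u) \<prec>\<^sub>V g (q, v) \<longleftrightarrow> p \<prec>\<^sub>V q \<or> p = q \<and> u \<prec>\<^sub>V v"
      using block_less[OF bound(2)[OF that(1,3)] bound(2)[OF that(2,4)], of "snd p" "snd q"]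
      by (simp add: g_def less_V_def)
  qed
  \<comment> \<open>Standardization needs distinct positions and distinct values, so either
    coordinate alone must identify the point.\<close>
  have inj: "x = y" if xy: "x \<in> X" "y \<in> X" and eq: "fst (g x) = fst (g y) \<or> snd (g x) = snd (g y)" for x y
  proof -
    obtain p u q v where pq: "x = (p, u)" "y = (q, v)" "p \<in> points \<sigma>" "q \<in> points \<sigma>"
        "u \<in> points (F p)" "v \<in> points (F q)"
      using xy by (auto simp: X_def simp del: mem_points_iff)
    have F: "F p \<in> perms" using assms(2) pq(3) .
    from eq show ?thesis
    proof
      assume "fst (g x) = fst (g y)"
      then have n: "\<not> g (p, u) \<prec>\<^sub>P g (q, v)" "\<not> g (q, v) \<prec>\<^sub>P g (p, u)"
        using pq by (simp_all add: less_P_def)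
      have "p = q" using n less(1)[OF pq(3-6)] less(1)[OF pq(4,3,6,5)] not_less_P_iff[OF pq(3,4)] by blast
      then have "u = v"
        using n less(1)[OF pq(3-6)] less(1)[OF pq(4,3,6,5)] not_less_P_iff[of u "F p" v] pq(5,6) by blast
      with \<open>p = q\<close> show ?thesis using pq by simp
    next
      assume "snd (g x) = snd (g y)"
      then have n: "\<not> g (p, u) \<prec>\<^sub>V g (q, v)" "\<not> g (q, v) \<prec>\<^sub>V g (p, u)"
        using pq by (simp_all add: less_V_def)
      have "p = q"
        using n less(2)[OF pq(3-6)] less(2)[OF pq(4,3,6,5)] not_less_V_iff[OF assms(1) pq(3,4)] by blast
      then have "u = v"
        using n less(2)[OF pq(3-6)] less(2)[OF pq(4,3,6,5)] not_less_V_iff[OF F, of u v] pq(5,6) by blast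
      with \<open>p = q\<close> show ?thesis using pq by simp
    qed
  qed
  have "finite (g ` X)" by (simp add: X_def)
  moreover have "inj_on fst (g ` X)" "inj_on snd (g ` X)"
    using inj by (blast intro: inj_onI)+
  ultimately obtain \<tau> h where \<tau>: "\<tau> \<in> perms" "fst \<tau> = card (g ` X)"
      "bij_betw h (g ` X) (points \<tau>)" "embeds (g ` X) h"
    by (rule standardization)
  have "inj_on g X" using inj by (intro inj_onI) simp
  then have "bij_betw (h \<circ> g) X (points \<tau>)"
    using \<tau>(3) by (intro bij_betw_trans[of g X "g ` X"]) (simp_all add: bij_betw_def)
  moreover have "(h (g (p, u)) \<prec>\<^sub>P h (g (q, v)) \<longleftrightarrow> p \<prec>\<^sub>P q \<or> p = q \<and> u \<prec>\<^sub>P v) \<and>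
      (h (g (p, u)) \<prec>\<^sub>V h (g (q, v)) \<longleftrightarrow> p \<prec>\<^sub>V q \<or> p = q \<and> u \<prec>\<^sub>V v)"
    if "p \<in> points \<sigma>" "q \<in> points \<sigma>" "u \<in> points (F p)" "v \<in> points (F q)" for p q u v
  proof -
    have "g (p, u) \<in> g ` X" "g (q, v) \<in> g ` X" using that by (auto simp: X_def)
    then show ?thesis using \<tau>(4) less[OF that] unfolding embeds_def by blast
  qed
  ultimately have "inflation_map \<sigma> F \<tau> (h \<circ> g)" unfolding inflation_map_def X_def by simp
  with \<tau>(1) show ?thesis by (rule that)
qed

section \<open>Expansions and the cells of their new points\<close>

text \<open>The rows of the ones, in cyclic order, are listed by c and the columns by its rotation,
  which is again a distinct list with the same entries.\<close>

lemma cycle_matrix_eq: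
  "cycle_matrix c i j = (if \<exists>t<length c. i = c ! t \<and> j = rotate1 c ! t then 1 else 0)"
proof -
  have "i = c ! t \<and> j = c ! (Suc t mod length c) \<longleftrightarrow> i = c ! t \<and> j = rotate1 c ! t"
    if "t < length c" for t
    using nth_rotate1[OF that] by simp
  then have "(\<exists>t<length c. i = c ! t \<and> j = c ! (Suc t mod length c)) \<longleftrightarrow>
      (\<exists>t<length c. i = c ! t \<and> j = rotate1 c ! t)" by blast
  then show ?thesis by (simp only: cycle_matrix_def)
qed

lemma card_nth_eq: "distinct xs \<Longrightarrow> card {t. t < length xs \<and> xs ! t = x} = (if x \<in> set xs then 1 else 0)"
proof (cases "x \<in> set xs")
  case True
  assume "distinct xs"
  obtain t where t: "t < length xs" "xs ! t = x" using True by (auto simp: in_set_conv_nth)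
  then have "{t. t < length xs \<and> xs ! t = x} = {t}"
    using \<open>distinct xs\<close> by (auto simp: nth_eq_iff_index_eq)
  with True show ?thesis by simp
next
  case False
  then have "{t. t < length xs \<and> xs ! t = x} = {}" by auto
  with False show ?thesis by (simp only: card.empty if_False)
qed

lemma card_points_fst_less: "1 \<le> m \<Longrightarrow> m \<le> fst \<pi> + 1 \<Longrightarrow> card {x \<in> points \<pi>. fst x < m} = m - 1"
proof -
  assume m: "1 \<le> m" "m \<le> fst \<pi> + 1"
  have "card {x \<in> points \<pi>. fst x < m} = card (fst ` {x \<in> points \<pi>. fst x < m})"
    by (rule card_image[symmetric], rule inj_on_subset[OF inj_on_fst_points[of \<pi>]]) simp
  also have "fst ` {x \<in> points \<pi>. fst x < m} = {y \<in> fst ` points \<pi>. y < m}" by blast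
  also have "\<dots> = {1..<m}" using m unfolding fst_image_points by auto
  finally show ?thesis by simp
qed

lemma card_points_snd_less:
  "\<pi> \<in> perms \<Longrightarrow> 1 \<le> m \<Longrightarrow> m \<le> fst \<pi> + 1 \<Longrightarrow> card {x \<in> points \<pi>. snd x < m} = m - 1"
proof -
  assume m: "\<pi> \<in> perms" "1 \<le> m" "m \<le> fst \<pi> + 1"
  have "card {x \<in> points \<pi>. snd x < m} = card (snd ` {x \<in> points \<pi>. snd x < m})"
    by (rule card_image[symmetric], rule inj_on_subset[OF inj_on_snd_points[OF m(1)]]) simp
  also have "snd ` {x \<in> points \<pi>. snd x < m} = {y \<in> snd ` points \<pi>. y < m}" by blast
  also have "\<dots> = {1..<m}" using m unfolding snd_image_points[OF m(1)] by auto
  finally show ?thesis by simp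
qed

lemma double_minus_one:
  fixes m a :: nat
  assumes "1 \<le> m"
  shows "2 * m - 1 \<noteq> 2 * a" "2 * a < 2 * m - 1 \<longleftrightarrow> a < m"
  using assms by presburger+

text \<open>Doubling the coordinates of \<pi> frees the odd numbers, and the number 2m - 1 lies in
  the m-th gap. One new point is placed per step of the cycle; no coordinate repeats since c is
  distinct. Stability holds because each index of c is the row of exactly one new point and the
  column of exactly one.\<close>

lemma exists_expansion:
  assumes \<pi>: "\<pi> \<in> perms" and c: "distinct c" "set c \<subseteq> {1..fst \<pi> + 1}"
  obtains \<sigma> s where "is_expansion \<pi> c \<sigma> s"
proof -
  let ?k = "fst \<pi>" and ?r = "length c"
  define c' where "c' = rotate1 c"
  have c': "distinct c'" "length c' = ?r" "set c' = set c" using c(1) by (simp_all add: c'_def)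
  define b where "b x = (2 * fst x, 2 * snd x)" for x :: point
  \<comment> \<open>The position comes from the column index \<open>c' ! t\<close> and the value
    from the row index \<open>c ! t\<close>.\<close>
  define d where "d t = (2 * c' ! t - 1, 2 * c ! t - 1)" for t
  have range: "1 \<le> c ! t" "c ! t \<le> ?k + 1" "1 \<le> c' ! t" "c' ! t \<le> ?k + 1" if "t < ?r" for t
  proof -
    have "c ! t \<in> {1..?k + 1}" "c' ! t \<in> {1..?k + 1}"
      by (rule subsetD[OF c(2)], use that nth_mem[of t c'] c'(2,3) in simp)+
    then show "1 \<le> c ! t" "c ! t \<le> ?k + 1" "1 \<le> c' ! t" "c' ! t \<le> ?k + 1" by simp_all
  qed
  have odd: "fst (d t) \<noteq> 2 * a" "snd (d t) \<noteq> 2 * a" if "t < ?r" for t a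
    using double_minus_one(1)[OF range(1)[OF that]] double_minus_one(1)[OF range(3)[OF that]]
    by (simp_all add: d_def)
  have d_inj: "fst (d t) = fst (d u) \<longleftrightarrow> t = u" "snd (d t) = snd (d u) \<longleftrightarrow> t = u" if "t < ?r" "u < ?r" for t u
  proof -
    have "fst (d t) = fst (d u) \<longleftrightarrow> c' ! t = c' ! u" "snd (d t) = snd (d u) \<longleftrightarrow> c ! t = c ! u"
      using range[OF that(1)] range[OF that(2)] by (auto simp: d_def)
    then show "fst (d t) = fst (d u) \<longleftrightarrow> t = u" "snd (d t) = snd (d u) \<longleftrightarrow> t = u"
      using that c(1) c' by (simp_all add: nth_eq_iff_index_eq)
  qed
  define B where "B = b ` points \<pi>"
  define D where "D = d ` {..<?r}"
  have fst_inj: "inj_on fst (B \<union> D)"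
  proof (rule inj_onI)
    fix x y assume xy: "x \<in> B \<union> D" "y \<in> B \<union> D" "fst x = fst y"
    show "x = y"
    proof (cases "x \<in> B")
      case True
      then obtain p where p: "x = b p" "p \<in> points \<pi>" by (auto simp: B_def)
      then have "y \<notin> D" using odd(1)[of _ "fst p"] xy(3) by (auto simp: D_def b_def)
      then obtain q where q: "y = b q" "q \<in> points \<pi>" using xy(2) by (auto simp: B_def)
      then show ?thesis using p xy(3) inj_onD[OF inj_on_fst_points[of \<pi>], of p q] by (simp add: b_def)
    next
      case False
      then obtain t where t: "x = d t" "t < ?r" using xy(1) by (auto simp: D_def)
      then have "y \<notin> B" using odd(1)[OF t(2)] xy(3) by (auto simp: B_def b_def eq_commute)
      then obtain u where "y = d u" "u < ?r" using xy(2) by (auto simp: D_def)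
      then show ?thesis using t xy(3) d_inj by simp
    qed
  qed
  have snd_inj: "inj_on snd (B \<union> D)"
  proof (rule inj_onI)
    fix x y assume xy: "x \<in> B \<union> D" "y \<in> B \<union> D" "snd x = snd y"
    show "x = y"
    proof (cases "x \<in> B")
      case True
      then obtain p where p: "x = b p" "p \<in> points \<pi>" by (auto simp: B_def)
      then have "y \<notin> D" using odd(2)[of _ "snd p"] xy(3) by (auto simp: D_def b_def)
      then obtain q where q: "y = b q" "q \<in> points \<pi>" using xy(2) by (auto simp: B_def)
      then show ?thesis using p xy(3) inj_onD[OF inj_on_snd_points[OF \<pi>], of p q] by (simp add: b_def)
    next
      case False
      then obtain t where t: "x = d t" "t < ?r" using xy(1) by (auto simp: D_def)
      then have "y \<notin> B" using odd(2)[OF t(2)] xy(3) by (auto simp: B_def b_def eq_commute)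
      then obtain u where "y = d u" "u < ?r" using xy(2) by (auto simp: D_def)
      then show ?thesis using t xy(3) d_inj by simp
    qed
  qed
  have disj: "B \<inter> D = {}"
  proof (rule equals0I)
    fix x assume "x \<in> B \<inter> D"
    then obtain p t where "x = b p" "x = d t" "t < ?r" unfolding B_def D_def by blast
    then show False using odd(1)[of t "fst p"] by (metis b_def fst_conv)
  qed
  have fin: "finite B" "finite D" by (simp_all add: B_def D_def)
  have d_inj_on: "inj_on d {..<?r}"
  proof (rule inj_onI)
    fix t u assume *: "t \<in> {..<?r}" "u \<in> {..<?r}" "d t = d u"
    then have "fst (d t) = fst (d u)" by simp
    with *(1,2) d_inj(1)[of t u] show "t = u" by simp
  qed
  have "inj_on b (points \<pi>)" by (auto simp: b_def inj_on_def prod_eq_iff)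
  then have "card (B \<union> D) = ?k + ?r"
    using card_Un_disjoint[OF fin disj] d_inj_on by (simp add: B_def D_def card_image card_points)
  with standardization[OF finite_UnI[OF fin] fst_inj snd_inj] obtain \<sigma> f where \<sigma>: "\<sigma> \<in> perms" "fst \<sigma> = ?k + ?r"
      "bij_betw f (B \<union> D) (points \<sigma>)" "embeds (B \<union> D) f"
    by metis
  define s where "s = map (f \<circ> b) (point_list \<pi>)"
  have set_s: "set s = f ` B" by (simp add: s_def B_def image_comp)
  have f_inj: "inj_on f (B \<union> D)" and f_im: "f ` (B \<union> D) = points \<sigma>"
    using \<sigma>(3) by (auto simp: bij_betw_def)
  have occ: "occurrence \<pi> \<sigma> s" unfolding s_def
  proof (rule occurrence_map[OF occurrence_point_list])
    have "embeds (points \<pi>) b" by (simp add: embeds_def b_def less_P_def less_V_def)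
    moreover have "embeds B f" using \<sigma>(4) by (rule embeds_subset) simp
    ultimately show "embeds (points \<pi>) (f \<circ> b)" by (rule embeds_comp) (simp add: B_def)
    show "(f \<circ> b) ` points \<pi> \<subseteq> points \<sigma>" unfolding image_comp[symmetric] B_def[symmetric] f_im[symmetric] by blast
  qed
  have sub: "set s \<subseteq> points \<sigma>" using set_s f_im by blast
  have rest: "points \<sigma> - set s = f ` D"
  proof -
    have "f ` (B \<union> D) - f ` B = f ` ((B \<union> D) - B)"
      using inj_on_image_set_diff[OF f_inj, of "B \<union> D" B] by blast
    also have "(B \<union> D) - B = D" using disj by blast
    finally show ?thesis by (simp add: set_s f_im)
  qed
  have inj_b: "inj_on (f \<circ> b) (points \<pi>)"
  proof (rule comp_inj_on)
    show "inj_on f (b ` points \<pi>)" by (rule inj_on_subset[OF f_inj]) (simp add: B_def)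
  qed (rule \<open>inj_on b (points \<pi>)\<close>)
  have col: "cell_col s (f (d t)) = c' ! t" if t: "t < ?r" for t
  proof -
    have "d t \<in> B \<union> D" using t by (simp add: D_def)
    have less: "f (b x) \<prec>\<^sub>P f (d t) \<longleftrightarrow> fst x < c' ! t" if "x \<in> points \<pi>" for x
    proof -
      have "b x \<in> B \<union> D" using that by (simp add: B_def)
      then have "f (b x) \<prec>\<^sub>P f (d t) \<longleftrightarrow> b x \<prec>\<^sub>P d t"
        using \<sigma>(4) \<open>d t \<in> B \<union> D\<close> unfolding embeds_def by blast
      then show ?thesis
        using double_minus_one(2)[OF range(3)[OF t]] by (simp add: b_def d_def less_P_def)
    qed
    have "{q \<in> set s. q \<prec>\<^sub>P f (d t)} = (\<lambda>x. f (b x)) ` {x \<in> points \<pi>. f (b x) \<prec>\<^sub>P f (d t)}"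
      unfolding set_s B_def by blast
    also have "\<dots> = (f \<circ> b) ` {x \<in> points \<pi>. fst x < c' ! t}"
      by (intro image_cong) (auto simp: less)
    finally have "{q \<in> set s. q \<prec>\<^sub>P f (d t)} = (f \<circ> b) ` {x \<in> points \<pi>. fst x < c' ! t}" .
    moreover have "card ((f \<circ> b) ` {x \<in> points \<pi>. fst x < c' ! t}) = card {x \<in> points \<pi>. fst x < c' ! t}"
      by (rule card_image, rule inj_on_subset[OF inj_b]) simp
    ultimately show ?thesis using card_points_fst_less[of "c' ! t" \<pi>] range[OF t] by (simp add: cell_col_def)
  qed
  have row: "cell_row s (f (d t)) = c ! t" if t: "t < ?r" for t
  proof -
    have "d t \<in> B \<union> D" using t by (simp add: D_def)
    have less: "f (b x) \<prec>\<^sub>V f (d t) \<longleftrightarrow> snd x < c ! t" if "x \<in> points \<pi>" for x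
    proof -
      have "b x \<in> B \<union> D" using that by (simp add: B_def)
      then have "f (b x) \<prec>\<^sub>V f (d t) \<longleftrightarrow> b x \<prec>\<^sub>V d t"
        using \<sigma>(4) \<open>d t \<in> B \<union> D\<close> unfolding embeds_def by blast
      then show ?thesis
        using double_minus_one(2)[OF range(1)[OF t]] by (simp add: b_def d_def less_V_def)
    qed
    have "{q \<in> set s. q \<prec>\<^sub>V f (d t)} = (\<lambda>x. f (b x)) ` {x \<in> points \<pi>. f (b x) \<prec>\<^sub>V f (d t)}"
      unfolding set_s B_def by blast
    also have "\<dots> = (f \<circ> b) ` {x \<in> points \<pi>. snd x < c ! t}"
      by (intro image_cong) (auto simp: less)
    finally have "{q \<in> set s. q \<prec>\<^sub>V f (d t)} = (f \<circ> b) ` {x \<in> points \<pi>. snd x < c ! t}" .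
    moreover have "card ((f \<circ> b) ` {x \<in> points \<pi>. snd x < c ! t}) = card {x \<in> points \<pi>. snd x < c ! t}"
      by (rule card_image, rule inj_on_subset[OF inj_b]) simp
    ultimately show ?thesis using card_points_snd_less[OF \<pi>, of "c ! t"] range[OF t] by (simp add: cell_row_def)
  qed
  have fd_inj: "inj_on (\<lambda>t. f (d t)) {..<?r}"
  proof -
    have "inj_on f (d ` {..<?r})" by (rule inj_on_subset[OF f_inj]) (simp add: D_def)
    from comp_inj_on[OF d_inj_on this] show ?thesis by (simp add: comp_def)
  qed
  \<comment> \<open>A count for arbitrary conditions on row and column yields the matrix entries as
    well as the row and column sums.\<close>
  have count: "card {p \<in> points \<sigma> - set s. P (cell_row s p) (cell_col s p)} =
      card {t. t < ?r \<and> P (c ! t) (c' ! t)}" for P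
  proof -
    have "{p \<in> points \<sigma> - set s. P (cell_row s p) (cell_col s p)} =
        (\<lambda>t. f (d t)) ` {t. t < ?r \<and> P (c ! t) (c' ! t)}"
    proof -
      have "{p \<in> points \<sigma> - set s. P (cell_row s p) (cell_col s p)} =
          (\<lambda>t. f (d t)) ` {t \<in> {..<?r}. P (cell_row s (f (d t))) (cell_col s (f (d t)))}"
        unfolding rest D_def by blast
      also have "{t \<in> {..<?r}. P (cell_row s (f (d t))) (cell_col s (f (d t)))} = {t. t < ?r \<and> P (c ! t) (c' ! t)}"
        using row col by auto
      finally show ?thesis .
    qed
    moreover have "inj_on (\<lambda>t. f (d t)) {t. t < ?r \<and> P (c ! t) (c' ! t)}"
      by (rule inj_on_subset[OF fd_inj]) auto
    ultimately show ?thesis by (simp add: card_image)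
  qed
  have "cell_matrix \<sigma> s i j = cycle_matrix c i j" for i j
  proof -
    have "cell_matrix \<sigma> s i j = card {t. t < ?r \<and> c ! t = i \<and> c' ! t = j}"
      unfolding cell_matrix_def by (rule count)
    also have "\<dots> = cycle_matrix c i j"
    proof (cases "\<exists>t<?r. i = c ! t \<and> j = c' ! t")
      case True
      then obtain t where t: "t < ?r" "i = c ! t" "j = c' ! t" by blast
      then have "{t. t < ?r \<and> c ! t = i \<and> c' ! t = j} = {t}"
        using c(1) by (auto simp: nth_eq_iff_index_eq)
      with True show ?thesis by (simp add: cycle_matrix_eq c'_def)
    next
      case False
      then have "{t. t < ?r \<and> c ! t = i \<and> c' ! t = j} = {}" by blast
      with False show ?thesis by (simp add: cycle_matrix_eq c'_def del: Collect_empty_eq)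
    qed
    finally show ?thesis .
  qed
  moreover have "stable \<sigma> s"
  proof -
    have "row_count \<sigma> s i = col_count \<sigma> s i" for i
      using count[of "\<lambda>x y. x = i"] count[of "\<lambda>x y. y = i"] card_nth_eq[OF c(1), of i]
        card_nth_eq[OF c'(1), of i] c' by (simp add: row_count_def col_count_def)
    then show ?thesis using stable_iff_row_count_eq_col_count[OF \<sigma>(1) sub] by blast
  qed
  ultimately have "is_expansion \<pi> c \<sigma> s"
    using \<sigma> occ by (simp add: is_expansion_def)
  then show ?thesis by (rule that)
qed

text \<open>Every cell of the cycle contains a point, and the number of points outside s is the
  length of the cycle, so there is one in each. The enumeration follows the cycle and not the order
  from left to right.\<close>

lemma expansion_enum:
  assumes e: "is_expansion \<pi> c \<sigma> s" and c: "distinct c" "set c \<subseteq> {1..fst \<pi> + 1}"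
  obtains e where "bij_betw e {..<length c} (points \<sigma> - set s)"
    "\<And>t. t < length c \<Longrightarrow> cell_row s (e t) = c ! t"
    "\<And>t. t < length c \<Longrightarrow> cell_col s (e t) = rotate1 c ! t"
proof -
  have s: "occurrence \<pi> \<sigma> s" "fst \<sigma> = fst \<pi> + length c"
    and M: "\<And>i j. i \<in> {1..fst \<pi> + 1} \<Longrightarrow> j \<in> {1..fst \<pi> + 1} \<Longrightarrow> cell_matrix \<sigma> s i j = cycle_matrix c i j"
    using e by (auto simp: is_expansion_def)
  have "\<exists>p. p \<in> points \<sigma> - set s \<and> cell_row s p = c ! t \<and> cell_col s p = rotate1 c ! t" if "t < length c" for t
  proof -
    have "c ! t \<in> set c" "rotate1 c ! t \<in> set c"
      using that nth_mem[of t c] nth_mem[of t "rotate1 c"] by simp_all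
    then have "cell_matrix \<sigma> s (c ! t) (rotate1 c ! t) = cycle_matrix c (c ! t) (rotate1 c ! t)"
      using c(2) by (intro M) blast+
    moreover have "cycle_matrix c (c ! t) (rotate1 c ! t) = 1" using that by (auto simp: cycle_matrix_eq)
    ultimately have "{p \<in> points \<sigma> - set s. cell_row s p = c ! t \<and> cell_col s p = rotate1 c ! t} \<noteq> {}"
      unfolding cell_matrix_def by (intro notI) (simp only: card.empty)
    then show ?thesis by blast
  qed
  then obtain e where e: "\<And>t. t < length c \<Longrightarrow> e t \<in> points \<sigma> - set s"
      "\<And>t. t < length c \<Longrightarrow> cell_row s (e t) = c ! t"
      "\<And>t. t < length c \<Longrightarrow> cell_col s (e t) = rotate1 c ! t" by metis
  have "inj_on e {..<length c}"
  proof (rule inj_onI)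
    fix t u assume tu: "t \<in> {..<length c}" "u \<in> {..<length c}" "e t = e u"
    then have "c ! t = c ! u" using e(2)[of t] e(2)[of u] by simp
    then show "t = u" using tu c(1) by (simp add: nth_eq_iff_index_eq)
  qed
  moreover have "e ` {..<length c} = points \<sigma> - set s"
  proof (rule card_subset_eq)
    have "length s = fst \<pi>" "set s \<subseteq> points \<sigma>" using s(1) by (simp_all add: occurrence_def)
    then have "card (points \<sigma> - set s) = length c"
      using distinct_card[OF occurrence_distinct[OF s(1)]] s(2) by (simp add: card_Diff_subset card_points)
    then show "card (e ` {..<length c}) = card (points \<sigma> - set s)"
      using card_image[OF \<open>inj_on e {..<length c}\<close>] by simp
  qed (use e(1) in auto)
  ultimately show ?thesis using e(2,3) by (intro that[of e]) (simp_all add: bij_betw_def)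
qed

section \<open>Cell counts after inflation\<close>

lemma points_singleton [simp]: "points (Suc 0, id) = {(Suc 0, Suc 0)}"
  by (auto simp: points_def)

text \<open>The point (1, 1) is the only one of the one-point permutation by which the entries of s
  are inflated.\<close>

definition inflated_list :: "(point \<times> point \<Rightarrow> point) \<Rightarrow> point list \<Rightarrow> point list" where
  "inflated_list f s = map (\<lambda>p. f (p, (1, 1))) s"

text \<open>A block compares with the entries of s as the point it replaces, so all of it stays in
  the cell of that point.\<close>

lemma inflated_list:
  assumes f: "inflation_map \<sigma> F \<tau> f" and s: "set s \<subseteq> points \<sigma>" and F: "\<And>p. p \<in> set s \<Longrightarrow> F p = (1, id)"
  shows "set (inflated_list f s) \<subseteq> points \<tau>"
    "distinct s \<Longrightarrow> distinct (inflated_list f s)"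
    "points \<tau> - set (inflated_list f s) = f ` (SIGMA p : points \<sigma> - set s. points (F p))"
    "\<And>p u. p \<in> points \<sigma> - set s \<Longrightarrow> u \<in> points (F p) \<Longrightarrow> cell_row (inflated_list f s) (f (p, u)) = cell_row s p"
    "\<And>p u. p \<in> points \<sigma> - set s \<Longrightarrow> u \<in> points (F p) \<Longrightarrow> cell_col (inflated_list f s) (f (p, u)) = cell_col s p"
proof -
  let ?X = "SIGMA p : points \<sigma>. points (F p)"
  have inj: "inj_on f ?X" and im: "f ` ?X = points \<tau>"
    using f by (simp_all add: inflation_map_def bij_betw_def)
  have one: "(1, 1) \<in> points (F p)" if "p \<in> set s" for p using F[OF that] by simp
  have set_eq: "set (inflated_list f s) = f ` (SIGMA p : set s. points (F p))"
    using F by (auto simp: inflated_list_def image_iff)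
  have sub: "(SIGMA p : set s. points (F p)) \<subseteq> ?X" using s by auto
  show "set (inflated_list f s) \<subseteq> points \<tau>" using sub set_eq im by blast
  have f_inj: "inj_on (\<lambda>p. f (p, (1, 1))) (set s)"
  proof (rule inj_onI)
    fix p q assume pq: "p \<in> set s" "q \<in> set s" "f (p, (1, 1)) = f (q, (1, 1))"
    have "p \<in> points \<sigma>" "q \<in> points \<sigma>" using s pq(1,2) by blast+
    from inflation_map_eq[OF f this one[OF pq(1)] one[OF pq(2)]] pq(3) show "p = q" by simp
  qed
  then show "distinct s \<Longrightarrow> distinct (inflated_list f s)" by (simp add: inflated_list_def distinct_map)
  show "points \<tau> - set (inflated_list f s) = f ` (SIGMA p : points \<sigma> - set s. points (F p))"
  proof -
    have "points \<tau> - set (inflated_list f s) = f ` (?X - (SIGMA p : set s. points (F p)))"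
      unfolding set_eq im[symmetric] using inj_on_image_set_diff[OF inj _ sub, of ?X] by simp
    also have "?X - (SIGMA p : set s. points (F p)) = (SIGMA p : points \<sigma> - set s. points (F p))" by blast
    finally show ?thesis .
  qed
  fix p u assume p: "p \<in> points \<sigma> - set s" and u: "u \<in> points (F p)"
  have less: "f (q, (1, 1)) \<prec>\<^sub>P f (p, u) \<longleftrightarrow> q \<prec>\<^sub>P p" "f (q, (1, 1)) \<prec>\<^sub>V f (p, u) \<longleftrightarrow> q \<prec>\<^sub>V p" if "q \<in> set s" for q
  proof -
    have q: "q \<in> points \<sigma>" "q \<noteq> p" "p \<in> points \<sigma>" using that s p by blast+
    show "f (q, (1, 1)) \<prec>\<^sub>P f (p, u) \<longleftrightarrow> q \<prec>\<^sub>P p" "f (q, (1, 1)) \<prec>\<^sub>V f (p, u) \<longleftrightarrow> q \<prec>\<^sub>V p"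
      using inflation_map_less[OF f q(1,3) one[OF that] u] q(2) by simp_all
  qed
  have "{q \<in> set (inflated_list f s). q \<prec>\<^sub>V f (p, u)} = (\<lambda>p. f (p, (1, 1))) ` {q \<in> set s. q \<prec>\<^sub>V p}"
    unfolding inflated_list_def set_map using less(2) by blast
  moreover have "card ((\<lambda>p. f (p, (1, 1))) ` {q \<in> set s. q \<prec>\<^sub>V p}) = card {q \<in> set s. q \<prec>\<^sub>V p}"
    by (rule card_image, rule inj_on_subset[OF f_inj]) simp
  ultimately show "cell_row (inflated_list f s) (f (p, u)) = cell_row s p"
    by (simp add: cell_row_def)
  have "{q \<in> set (inflated_list f s). q \<prec>\<^sub>P f (p, u)} = (\<lambda>p. f (p, (1, 1))) ` {q \<in> set s. q \<prec>\<^sub>P p}"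
    unfolding inflated_list_def set_map using less(1) by blast
  moreover have "card ((\<lambda>p. f (p, (1, 1))) ` {q \<in> set s. q \<prec>\<^sub>P p}) = card {q \<in> set s. q \<prec>\<^sub>P p}"
    by (rule card_image, rule inj_on_subset[OF f_inj]) simp
  ultimately show "cell_col (inflated_list f s) (f (p, u)) = cell_col s p"
    by (simp add: cell_col_def)
qed

text \<open>With P a condition on the row or on the column, this computes row and column sums: a
  block contributes its full size if the point it replaces satisfies the condition.\<close>

lemma card_inflated:
  assumes f: "inflation_map \<sigma> F \<tau> f" and s: "set s \<subseteq> points \<sigma>" and F: "\<And>p. p \<in> set s \<Longrightarrow> F p = (1, id)"
    and e: "bij_betw e {..<r} (points \<sigma> - set s)"
    and P: "\<And>p u. p \<in> points \<sigma> - set s \<Longrightarrow> u \<in> points (F p) \<Longrightarrow> P (f (p, u)) \<longleftrightarrow> Q p"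
  shows "card {x \<in> points \<tau> - set (inflated_list f s). P x} = (\<Sum>t | t < r \<and> Q (e t). fst (F (e t)))"
proof -
  have inj: "inj_on f (SIGMA p : points \<sigma>. points (F p))"
    using f by (simp add: inflation_map_def bij_betw_def)
  have "{x \<in> points \<tau> - set (inflated_list f s). P x} = f ` (SIGMA p : {p \<in> points \<sigma> - set s. Q p}. points (F p))"
  proof -
    have "points \<tau> - set (inflated_list f s) = f ` (SIGMA p : points \<sigma> - set s. points (F p))"
      by (rule inflated_list(3)[OF f s F])
    moreover have "{x \<in> f ` S. P x} = f ` {z \<in> S. P (f z)}" for S by blast
    ultimately have "{x \<in> points \<tau> - set (inflated_list f s). P x} =
        f ` {z \<in> (SIGMA p : points \<sigma> - set s. points (F p)). P (f z)}" by simp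
    also have "{z \<in> (SIGMA p : points \<sigma> - set s. points (F p)). P (f z)} =
        (SIGMA p : {p \<in> points \<sigma> - set s. Q p}. points (F p))" using P by auto
    finally show ?thesis .
  qed
  moreover have "card (f ` (SIGMA p : {p \<in> points \<sigma> - set s. Q p}. points (F p))) =
      card (SIGMA p : {p \<in> points \<sigma> - set s. Q p}. points (F p))"
    by (rule card_image, rule inj_on_subset[OF inj]) auto
  moreover have "\<dots> = (\<Sum>p | p \<in> points \<sigma> - set s \<and> Q p. fst (F p))"
    by (subst card_SigmaI) (auto simp: card_points)
  moreover have "\<dots> = (\<Sum>t | t < r \<and> Q (e t). fst (F (e t)))"
  proof (rule sum.reindex_cong)
    show "inj_on e {t. t < r \<and> Q (e t)}"
      using e by (auto simp: bij_betw_def intro: inj_on_subset)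
    show "{p. p \<in> points \<sigma> - set s \<and> Q p} = e ` {t. t < r \<and> Q (e t)}"
    proof -
      have "{p \<in> e ` S. Q p} = e ` {t \<in> S. Q (e t)}" for S by blast
      from this[of "{..<r}"] show ?thesis using e by (simp add: bij_betw_def)
    qed
  qed simp
  ultimately show ?thesis by simp
qed

section \<open>Two inflations that a formula cannot separate\<close>

definition mono_perm :: "bool \<Rightarrow> nat \<Rightarrow> perm" where
  "mono_perm b n = (n, \<lambda>i. if i \<in> {1..n} then (if b then i else n + 1 - i) else i)"

lemma fst_mono_perm [simp]: "fst (mono_perm b n) = n"
  by (simp add: mono_perm_def)

lemma mono_perm_perms: "mono_perm b n \<in> perms"
proof -
  let ?f = "\<lambda>i. if i \<in> {1..n} then (if b then i else n + 1 - i) else i"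
  have "bij_betw ?f {1..n} {1..n}"
    by (rule bij_betw_byWitness[of _ ?f]) auto
  then have "?f permutes {1..n}" by (rule bij_imp_permutes) (simp only: if_False)
  then show ?thesis by (simp add: mono_perm_def perms_def)
qed

lemma mono_perm_mono:
  "mono_perm True n \<in> increasing_perms" "mono_perm False n \<in> decreasing_perms"
  using mono_perm_perms[of True n] mono_perm_perms[of False n]
  by (auto simp: increasing_perms_def decreasing_perms_def mono_perm_def)

lemma comonotone_mono_perm: "comonotone (mono_perm b m) (mono_perm b n)"
  by (cases b) (simp_all add: comonotone_def mono_perm_mono)

lemma rank_P_less_card:
  assumes "finite A" "p \<in> A"
  shows "card {q \<in> A. q \<prec>\<^sub>P p} < card A"
  using assms by (intro psubset_card_mono) (auto simp: less_P_def)

text \<open>Consequently distinct points outside s are inflated by different entries of the list in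
  \<open>inflation_family\<close>, and one block can be enlarged alone.\<close>

lemma rank_P_inj:
  assumes "finite A" "inj_on fst A" "p \<in> A" "p' \<in> A" "card {q \<in> A. q \<prec>\<^sub>P p} = card {q \<in> A. q \<prec>\<^sub>P p'}"
  shows "p = p'"
proof -
  have *: "card {q \<in> A. q \<prec>\<^sub>P x} < card {q \<in> A. q \<prec>\<^sub>P y}" if "x \<in> A" "x \<prec>\<^sub>P y" for x y
    using assms(1) that by (intro psubset_card_mono) (auto simp: less_P_def)
  have "\<not> p \<prec>\<^sub>P p'" "\<not> p' \<prec>\<^sub>P p" using *[of p p'] *[of p' p] assms(3-5) by auto
  then have "fst p = fst p'" by (simp add: less_P_def)
  with assms show ?thesis by (simp add: inj_onD)
qed

lemma not_definable:
  assumes \<pi>: "\<pi> \<in> perms" "fst \<pi> = k" and c: "distinct c" "set c \<subseteq> {1..k + 1}" "length c \<ge> 2"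
    and Xs: "length Xs = length c" "set Xs \<subseteq> {increasing_perms, decreasing_perms}"
    and C: "expansion_class \<pi> c Xs \<subseteq> C"
    and \<phi>: "fv \<phi> \<subseteq> {1..k}" "\<And>\<sigma> as. \<sigma> \<in> C \<Longrightarrow> length as = k \<Longrightarrow> set as \<subseteq> points \<sigma> \<Longrightarrow>
      models \<sigma> as \<phi> \<longleftrightarrow> union_of_cycles \<sigma> as"
  shows False
proof -
  obtain \<sigma> s where ex: "is_expansion \<pi> c \<sigma> s"
    using exists_expansion[OF \<pi>(1) c(1)] c(2) \<pi>(2) by auto
  have \<sigma>: "\<sigma> \<in> perms" and occ: "occurrence \<pi> \<sigma> s" using ex by (simp_all add: is_expansion_def)
  have s: "set s \<subseteq> points \<sigma>" "distinct s" "length s = k"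
    using occ occurrence_distinct[OF occ] \<pi>(2) by (auto simp: occurrence_def)
  obtain e where e: "bij_betw e {..<length c} (points \<sigma> - set s)"
      "\<And>t. t < length c \<Longrightarrow> cell_row s (e t) = c ! t"
      "\<And>t. t < length c \<Longrightarrow> cell_col s (e t) = rotate1 c ! t"
    using expansion_enum[OF ex c(1)] c(2) \<pi>(2) by auto
  \<comment> \<open>With only the sentinels in play, blocks of lengths N and N + 1 give the
    distances N + 1 and N + 2, which are indistinguishable once both are at least 2^rank.\<close>
  let ?A = "points \<sigma> - set s" and ?N = "2 ^ qr \<phi> :: nat"
  have c0: "0 < length c" "1 < length c" using c(3) by linarith+
  have e_mem: "e t \<in> ?A" if "t < length c" for t using e(1) that by (auto simp: bij_betw_def)
  have e_inj: "e t = e 0 \<longleftrightarrow> t = 0" if "t < length c" for t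
    using inj_on_eq_iff[OF bij_betw_imp_inj_on[OF e(1)], of t 0] that c(3) by (cases c) auto
  define rank where "rank p = card {q \<in> ?A. q \<prec>\<^sub>P p}" for p
  have cardA: "card ?A = length c" using bij_betw_same_card[OF e(1)] by simp
  have rank: "rank p < length c" "rank p = rank (e 0) \<longleftrightarrow> p = e 0" if "p \<in> ?A" for p
  proof -
    show "rank p < length c"
      using rank_P_less_card[OF _ that] cardA by (simp add: rank_def)
    have "e 0 \<in> ?A" using e_mem[OF c0(1)] .
    then show "rank p = rank (e 0) \<longleftrightarrow> p = e 0"
      using rank_P_inj[of ?A p "e 0"] that inj_on_subset[OF inj_on_fst_points, of ?A \<sigma>] by (auto simp: rank_def)
  qed
  \<comment> \<open>The list is indexed from left to right and the cycle by t, so the long block for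
    \<open>e 0\<close> is entry \<open>rank (e 0)\<close>.\<close>
  define \<Theta> where "\<Theta> d = map (\<lambda>i. mono_perm (Xs ! i = increasing_perms)
      (?N + (if i = rank (e 0) then d else 0))) [0..<length c]" for d :: nat
  define F where "F d = inflation_family \<sigma> s (\<Theta> d)" for d
  have F_s: "F d p = (1, id)" if "p \<in> set s" for d p using that by (simp add: F_def inflation_family_def)
  have F_A: "F d p = mono_perm (Xs ! rank p = increasing_perms) (?N + (if p = e 0 then d else 0))"
    if "p \<in> ?A" for d p
  proof -
    have "F d p = \<Theta> d ! rank p" using that by (simp add: F_def inflation_family_def rank_def)
    then show ?thesis using rank[OF that] by (simp add: \<Theta>_def)
  qed
  have F_perms: "F d p \<in> perms" if "p \<in> points \<sigma>" for d p
  proof (cases "p \<in> set s")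
    case True
    then show ?thesis by (simp add: F_s perms_def)
  next
    case False
    then show ?thesis using that by (simp add: F_A mono_perm_perms)
  qed
  have "\<exists>\<tau> f. \<tau> \<in> perms \<and> inflation_map \<sigma> (F d) \<tau> f" for d
  proof -
    obtain \<tau> f where "\<tau> \<in> perms" "inflation_map \<sigma> (F d) \<tau> f"
      using exists_inflation[OF \<sigma> F_perms] .
    then show ?thesis by blast
  qed
  then obtain \<tau> f where \<tau>: "\<And>d. \<tau> d \<in> perms" "\<And>d. inflation_map \<sigma> (F d) (\<tau> d) (f d)" by metis
  define a where "a d = inflated_list (f d) s" for d
  have a: "set (a d) \<subseteq> points (\<tau> d)" "distinct (a d)" "length (a d) = k" for d
    using inflated_list(1,2)[OF \<tau>(2) s(1) F_s] s(2,3) by (simp_all add: a_def inflated_list_def)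
  have "\<tau> d \<in> C" for d
  proof -
    have "\<Theta> d ! t \<in> Xs ! t" if "t < length Xs" for t
    proof -
      have "Xs ! t = increasing_perms \<or> Xs ! t = decreasing_perms"
        using Xs(2) nth_mem[OF that] by blast
      then have "mono_perm (Xs ! t = increasing_perms) n \<in> Xs ! t" for n
        using mono_perm_mono by (cases "Xs ! t = increasing_perms") simp_all
      then show ?thesis using that Xs(1) by (simp add: \<Theta>_def)
    qed
    moreover have "is_inflated_expansion \<pi> c (\<Theta> d) (\<tau> d)"
    proof -
      have "is_inflation \<sigma> (inflation_family \<sigma> s (\<Theta> d)) (\<tau> d)"
        unfolding is_inflation_iff using \<tau>(1) \<tau>(2)[of d, unfolded F_def] by blast
      then show ?thesis unfolding is_inflated_expansion_def using ex by blast
    qed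
    ultimately have "\<tau> d \<in> expansion_class \<pi> c Xs"
      unfolding expansion_class_def using \<tau>(1) contains_refl[of "\<tau> d"] Xs(1)
      by (intro CollectI conjI exI[of _ "\<Theta> d"] exI[of _ "\<tau> d"]) (simp_all add: \<Theta>_def)
    then show ?thesis using C by blast
  qed
  then have mod: "models (\<tau> d) (a d) \<phi> \<longleftrightarrow> stable (\<tau> d) (a d)" for d
    using \<phi>(2)[OF _ a(3) a(1)] a(2) by (simp add: union_of_cycles_def)
  have size: "fst (F d (e t)) = ?N + (if t = 0 then d else 0)" if "t < length c" for d t
    using e_mem[OF that] e_inj[OF that] by (simp add: F_A)
  have row: "row_count (\<tau> d) (a d) i = (\<Sum>t | t < length c \<and> c ! t = i. ?N + (if t = 0 then d else 0))" for d i
  proof -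
    have "row_count (\<tau> d) (a d) i = (\<Sum>t | t < length c \<and> cell_row s (e t) = i. fst (F d (e t)))"
      unfolding row_count_def a_def
      by (rule card_inflated[OF \<tau>(2) s(1) F_s e(1)]) (use inflated_list(4)[OF \<tau>(2) s(1) F_s] in simp_all)
    also have "\<dots> = (\<Sum>t | t < length c \<and> c ! t = i. ?N + (if t = 0 then d else 0))"
      by (intro sum.cong) (auto simp: e(2) size)
    finally show ?thesis .
  qed
  have col: "col_count (\<tau> d) (a d) i = (\<Sum>t | t < length c \<and> rotate1 c ! t = i. ?N + (if t = 0 then d else 0))" for d i
  proof -
    have "col_count (\<tau> d) (a d) i = (\<Sum>t | t < length c \<and> cell_col s (e t) = i. fst (F d (e t)))"
      unfolding col_count_def a_def
      by (rule card_inflated[OF \<tau>(2) s(1) F_s e(1)]) (use inflated_list(5)[OF \<tau>(2) s(1) F_s] in simp_all)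
    also have "\<dots> = (\<Sum>t | t < length c \<and> rotate1 c ! t = i. ?N + (if t = 0 then d else 0))"
      by (intro sum.cong) (auto simp: e(3) size)
    finally show ?thesis .
  qed
  have c': "distinct (rotate1 c)" using c(1) by simp
  have "stable (\<tau> 0) (a 0)"
    unfolding stable_iff_row_count_eq_col_count[OF \<tau>(1) a(1)] row col
    using card_nth_eq[OF c(1)] card_nth_eq[OF c'] by simp
  moreover have "\<not> stable (\<tau> 1) (a 1)"
  proof -
    \<comment> \<open>The enlarged block lies in row \<open>c ! 0\<close> and column
      \<open>c ! 1\<close>. These indices differ, so row sum \<open>c ! 0\<close> grows while column
      sum \<open>c ! 0\<close> does not.\<close>
    have "{t. t < length c \<and> c ! t = c ! 0} = {0}"
      using nth_eq_iff_index_eq[OF c(1) _ c0(1)] c0(1) by auto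
    then have "row_count (\<tau> 1) (a 1) (c ! 0) = ?N + 1" by (simp add: row)
    moreover have "rotate1 c ! 0 \<noteq> c ! 0"
      using nth_eq_iff_index_eq[OF c(1) c0(2,1)] nth_rotate1[OF c0(1)] c0(2) by simp
    then have "t \<noteq> 0" if "rotate1 c ! t = c ! 0" for t using that by (cases t) simp_all
    then have "col_count (\<tau> 1) (a 1) (c ! 0) = (\<Sum>t | t < length c \<and> rotate1 c ! t = c ! 0. ?N)"
      unfolding col by (intro sum.cong) auto
    then have "col_count (\<tau> 1) (a 1) (c ! 0) \<le> ?N"
      using card_nth_eq[OF c', of "c ! 0"] by (simp split: if_splits)
    ultimately show ?thesis
      unfolding stable_iff_row_count_eq_col_count[OF \<tau>(1) a(1)] by (metis Suc_eq_plus1 not_less_eq_eq order_refl)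
  qed
  moreover have a_nth: "a d ! (x - 1) = f d (s ! (x - 1), (1, 1))" if "x \<in> {1..k}" for x d
  proof -
    have "x - 1 < length s" using that s(3) by auto
    then show ?thesis by (simp add: a_def inflated_list_def)
  qed
  moreover have "models (\<tau> 0) (a 0) \<phi> \<longleftrightarrow> models (\<tau> 1) (a 1) \<phi>"
    unfolding models_def
  proof (rule game_sat[OF \<tau>(2) \<tau>(2), of "e 0"])
    let ?w = "\<lambda>x. (s ! (x - 1), (1, 1))"
    have s_mem: "s ! (x - 1) \<in> set s" if "x \<in> {1..k}" for x using that s(3) by (intro nth_mem) auto
    have e0: "e 0 \<in> ?A" using e_mem[OF c0(1)] .
    show "F 1 p = F 0 p" if "p \<in> points \<sigma>" "p \<noteq> e 0" for p
      using that by (cases "p \<in> set s") (simp_all add: F_s F_A)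
    show "comonotone (F 0 (e 0)) (F 1 (e 0))" using e0 by (simp add: F_A comonotone_mono_perm)
    \<comment> \<open>The arguments are entries of s, so none lies in the block that differs and the
      game starts with the sentinels alone.\<close>
    have none: "{x \<in> {1..k}. fst (?w x) = e 0} = {}"
    proof (rule equals0I)
      fix x assume "x \<in> {x \<in> {1..k}. fst (?w x) = e 0}"
      then have "s ! (x - 1) = e 0" "x \<in> {1..k}" by simp_all
      with s_mem[of x] e0 show False by simp
    qed
    have "game_pairs (e 0) (F 0 (e 0)) (F 1 (e 0)) {1..k} ?w ?w = {(0, 0), (int ?N + 1, int ?N + 2)}"
      using e0 by (simp only: game_pairs_def none image_empty Un_empty_right) (simp add: F_A add.commute)
    moreover have "good (qr \<phi>) {(0, 0), (int ?N + 1, int ?N + 2)}"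
      by (simp add: good_def near_def)
    ultimately show "game \<sigma> (e 0) (F 0) (F 1) (qr \<phi>) {1..k} ?w ?w"
      using s_mem s(1) by (auto simp: game_def F_s)
    show "a 0 ! (y - 1) = f 0 (?w y)" "a 1 ! (y - 1) = f 1 (?w y)" if "y \<in> {1..k}" for y
      using a_nth[OF that] by simp_all
  qed (use \<phi>(1) in auto)
  ultimately show False using mod[of 0] mod[of 1] by blast
qed

section \<open>Large cycles of cells\<close>

text \<open>The path is extended edge by edge; when the new vertex already occurs, the path is cut
  off at that occurrence.\<close>

lemma rtrancl_simple_path:
  assumes "(a, b) \<in> E\<^sup>*" "E \<subseteq> I \<times> I" "a \<in> I"
  obtains xs where "xs \<noteq> []" "distinct xs" "set xs \<subseteq> I" "hd xs = a" "last xs = b"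
    "\<And>t. Suc t < length xs \<Longrightarrow> (xs ! t, xs ! Suc t) \<in> E"
proof -
  from assms(1) have "\<exists>xs. xs \<noteq> [] \<and> distinct xs \<and> set xs \<subseteq> I \<and> hd xs = a \<and> last xs = b \<and>
      (\<forall>t. Suc t < length xs \<longrightarrow> (xs ! t, xs ! Suc t) \<in> E)"
  proof (induction rule: rtrancl_induct)
    case base
    show ?case by (rule exI[of _ "[a]"]) (simp add: assms(3))
  next
    case (step y z)
    then obtain xs where xs: "xs \<noteq> []" "distinct xs" "set xs \<subseteq> I" "hd xs = a" "last xs = y"
        "\<And>t. Suc t < length xs \<Longrightarrow> (xs ! t, xs ! Suc t) \<in> E" by blast
    show ?case
    proof (cases "z \<in> set xs")
      case True
      then obtain ys zs where split: "xs = ys @ z # zs" by (meson split_list)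
      have edges: "((ys @ [z]) ! t, (ys @ [z]) ! Suc t) \<in> E" if "Suc t < length (ys @ [z])" for t
      proof -
        have "xs ! t = (ys @ [z]) ! t" "xs ! Suc t = (ys @ [z]) ! Suc t"
          using that by (auto simp: split nth_append less_Suc_eq)
        with xs(6)[of t] that split show ?thesis by simp
      qed
      have "hd (ys @ [z]) = a" using xs(4) split by (cases ys) simp_all
      then show ?thesis using xs(2,3) split edges by (intro exI[of _ "ys @ [z]"]) simp
    next
      case False
      have "((xs @ [z]) ! t, (xs @ [z]) ! Suc t) \<in> E" if "Suc t < length (xs @ [z])" for t
      proof (cases "Suc t < length xs")
        case True
        with xs(6)[OF True] show ?thesis by (simp add: nth_append)
      next
        case False
        with that have t: "Suc t = length xs" by simp
        then have "xs ! t = y" using xs(1,5) by (simp add: last_conv_nth flip: t)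
        with t step(2) show ?thesis by (simp add: nth_append)
      qed
      moreover have "z \<in> I" using step(2) assms(2) by blast
      ultimately show ?thesis using xs False by (intro exI[of _ "xs @ [z]"]) simp
    qed
  qed
  then obtain xs where "xs \<noteq> []" "distinct xs" "set xs \<subseteq> I" "hd xs = a" "last xs = b"
    "\<forall>t. Suc t < length xs \<longrightarrow> (xs ! t, xs ! Suc t) \<in> E" by blast
  then show ?thesis by (intro that[of xs]) simp_all
qed

text \<open>
  A large entry from i to j would leave the set of vertices reachable from j by large entries
  with more inflow than outflow.
\<close>

lemma balanced_entry_bound:
  fixes M :: "nat \<Rightarrow> nat \<Rightarrow> nat"
  assumes I: "finite I" and bal: "\<And>v. v \<in> I \<Longrightarrow> (\<Sum>u\<in>I. M v u) = (\<Sum>u\<in>I. M u v)"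
    and no_cycle: "\<And>c. distinct c \<Longrightarrow> set c \<subseteq> I \<Longrightarrow> 2 \<le> length c \<Longrightarrow>
      \<exists>t<length c. M (c ! t) (rotate1 c ! t) < n"
    and ij: "i \<in> I" "j \<in> I" "i \<noteq> j"
  shows "M i j \<le> card I * card I * n"
proof (cases "M i j < n")
  case True
  have "card I \<noteq> 0" using I ij(1) by auto
  then have one: "1 \<le> card I" by linarith
  have "M i j \<le> 1 * 1 * n" using True by simp
  also have "\<dots> \<le> card I * card I * n"
    by (rule mult_le_mono1[OF mult_le_mono[OF one one]])
  finally show ?thesis .
next
  case False
  define E where "E = {(a, b). a \<in> I \<and> b \<in> I \<and> n \<le> M a b}"
  define U where "U = {v \<in> I. (j, v) \<in> E\<^sup>*}"
  \<comment> \<open>Otherwise a simple path from j to i through large entries, closed by the large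
    entry from i to j, would be a cycle excluded by \<open>no_cycle\<close>.\<close>
  have i: "i \<notin> U"
  proof
    assume "i \<in> U"
    then have path: "(j, i) \<in> E\<^sup>*" by (simp add: U_def)
    have sub: "E \<subseteq> I \<times> I" by (auto simp: E_def)
    obtain xs where xs: "xs \<noteq> []" "distinct xs" "set xs \<subseteq> I" "hd xs = j" "last xs = i"
        "\<And>t. Suc t < length xs \<Longrightarrow> (xs ! t, xs ! Suc t) \<in> E"
      using rtrancl_simple_path[OF path sub ij(2)] by blast
    have "length xs \<noteq> 1" using xs(4,5) ij(3) by (cases xs) auto
    moreover have "length xs \<noteq> 0" using xs(1) by simp
    ultimately have "2 \<le> length xs" by linarith
    from no_cycle[OF xs(2,3) this] obtain t where t: "t < length xs" "M (xs ! t) (rotate1 xs ! t) < n"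
      by blast
    show False
    proof (cases "Suc t < length xs")
      case True
      then have "rotate1 xs ! t = xs ! Suc t" unfolding nth_rotate1[OF t(1)] by simp
      then show False using xs(6)[OF True] t(2) by (simp add: E_def)
    next
      case False
      with t(1) have len: "length xs = Suc t" by simp
      have "rotate1 xs ! t = xs ! 0" unfolding nth_rotate1[OF t(1)] len by simp
      moreover have "xs ! 0 = j" using hd_conv_nth[OF xs(1)] xs(4) by simp
      moreover have "xs ! t = i" using last_conv_nth[OF xs(1)] xs(5) len by simp
      ultimately have "rotate1 xs ! t = j" "xs ! t = i" by simp_all
      with t(2) \<open>\<not> M i j < n\<close> show False by simp
    qed
  qed
  have fin: "finite U" "U \<subseteq> I" "finite (I - U)" using I by (simp_all add: U_def)
  have split: "sum g I = sum g (I - U) + sum g U" for g :: "nat \<Rightarrow> nat"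
    by (rule sum.subset_diff[OF fin(2) I])
  \<comment> \<open>The balance is summed over U. Entries with both ends in U cancel, so what leaves
    U equals what enters it.\<close>
  have "(\<Sum>v\<in>U. \<Sum>u\<in>I. M v u) = (\<Sum>v\<in>U. \<Sum>u\<in>I. M u v)"
    by (rule sum.cong[OF refl]) (rule bal[OF subsetD[OF fin(2)]])
  moreover have "(\<Sum>v\<in>U. \<Sum>u\<in>I. M v u) = (\<Sum>v\<in>U. \<Sum>u\<in>I - U. M v u) + (\<Sum>v\<in>U. \<Sum>u\<in>U. M v u)"
    unfolding split sum.distrib ..
  moreover have "(\<Sum>v\<in>U. \<Sum>u\<in>I. M u v) = (\<Sum>v\<in>U. \<Sum>u\<in>I - U. M u v) + (\<Sum>v\<in>U. \<Sum>u\<in>U. M u v)"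
    unfolding split sum.distrib ..
  moreover have "(\<Sum>v\<in>U. \<Sum>u\<in>U. M v u) = (\<Sum>v\<in>U. \<Sum>u\<in>U. M u v)" by (rule sum.swap)
  ultimately have eq: "(\<Sum>v\<in>U. \<Sum>u\<in>I - U. M v u) = (\<Sum>v\<in>U. \<Sum>u\<in>I - U. M u v)" by simp
  have j: "j \<in> U" using ij(2) by (simp add: U_def)
  \<comment> \<open>The entry from i to j is part of the inflow of U. The outflow has at most card I
    times card I entries, and none exceeds n, as U is closed under large entries.\<close>
  have "M i j \<le> (\<Sum>u\<in>I - U. M u j)"
    using i ij(1) fin by (intro member_le_sum[of i "I - U" "\<lambda>u. M u j"]) simp_all
  also have "\<dots> \<le> (\<Sum>v\<in>U. \<Sum>u\<in>I - U. M u v)"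
    using j fin by (intro member_le_sum[of j U "\<lambda>v. \<Sum>u\<in>I - U. M u v"]) simp_all
  also have "\<dots> \<le> (\<Sum>v\<in>U. card I * n)"
    unfolding eq[symmetric]
  proof (rule sum_mono)
    fix v assume v: "v \<in> U"
    have "M v u \<le> n" if "u \<in> I - U" for u
    proof (rule ccontr)
      assume "\<not> M v u \<le> n"
      then have step: "(v, u) \<in> E" using v that by (simp add: E_def U_def)
      have "(j, v) \<in> E\<^sup>*" using v by (simp add: U_def)
      from rtrancl_into_rtrancl[OF this step] have "(j, u) \<in> E\<^sup>*" .
      then show False using that by (simp add: U_def)
    qed
    then have "(\<Sum>u\<in>I - U. M v u) \<le> card (I - U) * n"
      using sum_bounded_above[of "I - U" "M v" n] by simp
    also have "\<dots> \<le> card I * n" using I by (intro mult_le_mono1 card_mono) auto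
    finally show "(\<Sum>u\<in>I - U. M v u) \<le> card I * n" .
  qed
  also have "\<dots> \<le> card I * card I * n"
    using card_mono[OF I fin(2)] by simp
  finally show ?thesis .
qed

section \<open>Monotone sequences in cells and embedded expansions\<close>

text \<open>Ramsey's theorem for the graph of pairs on which the two orders agree: a clique is
  increasing and an independent set decreasing. The map h lists the set from left to right, and b
  records the direction.\<close>

lemma exists_monotone_subset:
  fixes N :: nat
  shows "\<exists>R. \<forall>\<sigma>\<in>perms. \<forall>V\<subseteq>points \<sigma>. R \<le> card V \<longrightarrow>
    (\<exists>h b. \<forall>a\<in>{1..N}. h a \<in> V \<and> (\<forall>a'\<in>{1..N}. (h a \<prec>\<^sub>P h a' \<longleftrightarrow> a < a') \<and>
      (h a \<prec>\<^sub>V h a' \<longleftrightarrow> (if b then a < a' else a' < a))))"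
proof -
  obtain R where R: "\<forall>(V :: point set) E. finite V \<and> R \<le> card V \<longrightarrow>
      (\<exists>W\<subseteq>V. card W = N \<and> clique W E \<or> card W = N \<and> indep W E)"
    using ramsey2[of N N, where 'a = point] by (elim exE conjE)
  show ?thesis
  proof (intro exI[of _ R] ballI allI impI)
    fix \<sigma> V assume \<sigma>: "\<sigma> \<in> perms" and V: "V \<subseteq> points \<sigma>" "R \<le> card V"
    define E where "E = {{p, q} | p q. p \<prec>\<^sub>P q \<and> p \<prec>\<^sub>V q}"
    have E_iff: "{p, q} \<in> E \<longleftrightarrow> p \<prec>\<^sub>V q" if "p \<prec>\<^sub>P q" for p q
    proof
      assume "{p, q} \<in> E"
      then obtain a b where "{p, q} = {a, b}" "a \<prec>\<^sub>P b" "a \<prec>\<^sub>V b"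
        unfolding E_def mem_Collect_eq by (elim exE conjE)
      then show "p \<prec>\<^sub>V q" using that by (auto simp: doubleton_eq_iff less_P_def)
    next
      assume "p \<prec>\<^sub>V q"
      with that show "{p, q} \<in> E"
        unfolding E_def by (intro CollectI exI[of _ p] exI[of _ q] conjI refl)
    qed
    have "finite V" using V(1) by (rule finite_subset) simp
    then obtain W where W: "W \<subseteq> V" "card W = N" "clique W E \<or> indep W E"
      using R[rule_format, of V E] V(2) by blast
    have W\<sigma>: "W \<subseteq> points \<sigma>" using W(1) V(1) by blast
    obtain \<theta> f where \<theta>: "\<theta> \<in> perms" "fst \<theta> = card W" "bij_betw f W (points \<theta>)" "embeds W f"
      using standardization[OF finite_subset[OF W\<sigma> finite_points]
          inj_on_subset[OF inj_on_fst_points W\<sigma>] inj_on_subset[OF inj_on_snd_points[OF \<sigma>] W\<sigma>]] .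
    \<comment> \<open>The standardization numbers W by position, so \<open>h a\<close> is the a-th
      point of W from the left.\<close>
    define h where "h a = inv_into W f (a, snd \<theta> a)" for a
    have pt: "(a, snd \<theta> a) \<in> points \<theta>" if "a \<in> {1..N}" for a
      using that \<theta>(2) W(2) by (simp add: mem_points_iff)
    have hW: "h a \<in> W" if "a \<in> {1..N}" for a
      using bij_betwE[OF bij_betw_inv_into[OF \<theta>(3)]] pt[OF that] by (simp add: h_def)
    have hP: "h a \<prec>\<^sub>P h a' \<longleftrightarrow> a < a'" if "a \<in> {1..N}" "a' \<in> {1..N}" for a a'
      using embeds_inv[OF \<theta>(4,3), unfolded embeds_def, rule_format, OF pt[OF that(1)] pt[OF that(2)]]
      by (simp add: h_def less_P_def)
    have lt: "h a \<prec>\<^sub>V h a' \<longleftrightarrow> clique W E" "h a' \<prec>\<^sub>V h a \<longleftrightarrow> \<not> clique W E"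
      if "a \<in> {1..N}" "a' \<in> {1..N}" "a < a'" for a a'
    proof -
      have P: "h a \<prec>\<^sub>P h a'" using hP that by simp
      then have ne: "h a \<noteq> h a'" by (auto simp: less_P_def)
      then have "{h a, h a'} \<in> E \<longleftrightarrow> clique W E"
      proof -
        have "clique W E \<Longrightarrow> {h a, h a'} \<in> E" "indep W E \<Longrightarrow> {h a, h a'} \<notin> E"
          using hW[OF that(1)] hW[OF that(2)] ne by (simp_all add: clique_def indep_def)
        with W(3) show ?thesis by blast
      qed
      then show *: "h a \<prec>\<^sub>V h a' \<longleftrightarrow> clique W E" using E_iff[OF P] by simp
      have "\<not> h a \<prec>\<^sub>V h a' \<longleftrightarrow> h a' \<prec>\<^sub>V h a"
        using hW that W\<sigma> ne by (intro not_less_V_iff[OF \<sigma>]) blast+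
      with * show "h a' \<prec>\<^sub>V h a \<longleftrightarrow> \<not> clique W E" by simp
    qed
    have hV: "h a \<prec>\<^sub>V h a' \<longleftrightarrow> (if clique W E then a < a' else a' < a)"
      if "a \<in> {1..N}" "a' \<in> {1..N}" for a a'
    proof (cases a a' rule: linorder_cases)
      case less
      then show ?thesis using lt(1)[OF that less] by simp
    next
      case greater
      then show ?thesis using lt(2)[OF that(2,1) greater] by simp
    qed (simp add: less_V_def)
    show "\<exists>h b. \<forall>a\<in>{1..N}. h a \<in> V \<and> (\<forall>a'\<in>{1..N}. (h a \<prec>\<^sub>P h a' \<longleftrightarrow> a < a') \<and>
      (h a \<prec>\<^sub>V h a' \<longleftrightarrow> (if b then a < a' else a' < a)))"
      using subsetD[OF W(1) hW] hP hV by (intro exI[of _ h] exI[of _ "clique W E"] ballI conjI) simp_all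
  qed
qed

lemma cell_col_neq:
  assumes "cell_col s p \<noteq> cell_col s q"
  shows "p \<prec>\<^sub>P q \<longleftrightarrow> cell_col s p < cell_col s q"
proof (cases "cell_col s p < cell_col s q")
  case True
  then show ?thesis using cell_col_less[of s p q] by simp
next
  case False
  then have "q \<prec>\<^sub>P p" using assms by (intro cell_col_less[of s q p]) simp_all
  then have "\<not> p \<prec>\<^sub>P q" by (simp add: less_P_def)
  with False show ?thesis by simp
qed

lemma cell_row_neq:
  assumes "cell_row s p \<noteq> cell_row s q"
  shows "p \<prec>\<^sub>V q \<longleftrightarrow> cell_row s p < cell_row s q"
proof (cases "cell_row s p < cell_row s q")
  case True
  then show ?thesis using cell_row_less[of s p q] by simp
next
  case False
  then have "q \<prec>\<^sub>V p" using assms by (intro cell_row_less[of s q p]) simp_all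
  then have "\<not> p \<prec>\<^sub>V q" by (simp add: less_V_def)
  with False show ?thesis by simp
qed

text \<open>Converts a place on the cycle into an index of the list of blocks, which is ordered from
  left to right. In an expansion every column of c holds one new point, so the rank of that point is
  the number of smaller columns in c.\<close>

definition col_rank :: "nat list \<Rightarrow> nat \<Rightarrow> nat" where
  "col_rank c j = card {j' \<in> set c. j' < j}"

text \<open>The distinguished occurrence is mapped to s, and place a of the t-th block to
  \<open>h t a\<close>; blocks of length at most N fit into sequences of length N. All comparisons
  survive because the cells of the cycle lie in pairwise different rows and columns and the
  directions within them match.\<close>

lemma inflated_expansion_contains:
  assumes infl: "is_inflated_expansion \<pi> c \<Theta> \<tau>" and \<pi>: "\<pi> \<in> perms"
    and c: "distinct c" "set c \<subseteq> {1..fst \<pi> + 1}"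
    and \<sigma>: "\<sigma> \<in> perms" and s: "occurrence \<pi> \<sigma> s"
    and h: "\<And>t a. t < length c \<Longrightarrow> a \<in> {1..N} \<Longrightarrow>
      h t a \<in> points \<sigma> - set s \<and> cell_row s (h t a) = c ! t \<and> cell_col s (h t a) = rotate1 c ! t"
    and hP: "\<And>t a a'. t < length c \<Longrightarrow> a \<in> {1..N} \<Longrightarrow> a' \<in> {1..N} \<Longrightarrow> h t a \<prec>\<^sub>P h t a' \<longleftrightarrow> a < a'"
    and hV: "\<And>t a a'. t < length c \<Longrightarrow> a \<in> {1..N} \<Longrightarrow> a' \<in> {1..N} \<Longrightarrow>
      h t a \<prec>\<^sub>V h t a' \<longleftrightarrow> (if b t then a < a' else a' < a)"
    and \<Theta>: "\<And>t. t < length c \<Longrightarrow> fst (\<Theta> ! col_rank c (rotate1 c ! t)) \<le> N"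
      "\<And>t. t < length c \<Longrightarrow> \<Theta> ! col_rank c (rotate1 c ! t) \<in> (if b t then increasing_perms else decreasing_perms)"
    and \<rho>: "contains \<tau> \<rho>"
  shows "contains \<sigma> \<rho>"
proof -
  let ?k = "fst \<pi>" and ?r = "length c"
  define c' where "c' = rotate1 c"
  have c': "distinct c'" "length c' = ?r" "set c' = set c" using c(1) by (simp_all add: c'_def)
  obtain \<sigma>0 s0 where ex: "is_expansion \<pi> c \<sigma>0 s0" and inf: "is_inflation \<sigma>0 (inflation_family \<sigma>0 s0 \<Theta>) \<tau>"
    using infl by (auto simp: is_inflated_expansion_def)
  define F where "F = inflation_family \<sigma>0 s0 \<Theta>"
  obtain f where f: "inflation_map \<sigma>0 F \<tau> f" and \<tau>: "\<tau> \<in> perms"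
    using inf by (auto simp: is_inflation_iff F_def)
  have \<sigma>0: "\<sigma>0 \<in> perms" and s0: "occurrence \<pi> \<sigma>0 s0" using ex by (simp_all add: is_expansion_def)
  have len: "length s0 = ?k" "length s = ?k" and sub: "set s0 \<subseteq> points \<sigma>0" "set s \<subseteq> points \<sigma>"
    using s0 s by (simp_all add: occurrence_def)
  let ?A = "points \<sigma>0 - set s0"
  obtain e where "bij_betw e {..<?r} ?A" "\<And>t. t < ?r \<Longrightarrow> cell_row s0 (e t) = c ! t"
      "\<And>t. t < ?r \<Longrightarrow> cell_col s0 (e t) = rotate1 c ! t"
    using expansion_enum[OF ex c] by blast
  note e = this[folded c'_def]
  have eA: "e t \<in> ?A" if "t < ?r" for t using bij_betwE[OF e(1)] that by simp
  have e_P: "e t \<prec>\<^sub>P e u \<longleftrightarrow> c' ! t < c' ! u" if "t < ?r" "u < ?r" for t u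
  proof (cases "t = u")
    case False
    then have "c' ! t \<noteq> c' ! u" using that c' by (simp add: nth_eq_iff_index_eq)
    then show ?thesis using cell_col_neq[of s0 "e t" "e u"] e(3) that by simp
  qed (simp add: less_P_def)
  have rank: "card {q \<in> ?A. q \<prec>\<^sub>P e t} = col_rank c (c' ! t)" if t: "t < ?r" for t
  proof -
    let ?T = "{u \<in> {..<?r}. e u \<prec>\<^sub>P e t}"
    have "{q \<in> e ` S. q \<prec>\<^sub>P e t} = e ` {u \<in> S. e u \<prec>\<^sub>P e t}" for S by blast
    from this[of "{..<?r}"] have "{q \<in> ?A. q \<prec>\<^sub>P e t} = e ` ?T"
      unfolding bij_betw_imp_surj_on[OF e(1)] .
    moreover have "card (e ` ?T) = card ?T"
      by (rule card_image, rule inj_on_subset[OF bij_betw_imp_inj_on[OF e(1)]]) blast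
    moreover have "{j \<in> set c. j < c' ! t} = (\<lambda>u. c' ! u) ` ?T"
    proof -
      have "set c = (\<lambda>u. c' ! u) ` {..<?r}" using c'(2,3) by (metis lessThan_atLeast0 list.set_map map_nth set_upt)
      moreover have "{j \<in> (\<lambda>u. c' ! u) ` S. j < c' ! t} = (\<lambda>u. c' ! u) ` {u \<in> S. c' ! u < c' ! t}" for S by blast
      moreover have "{u \<in> {..<?r}. c' ! u < c' ! t} = ?T" using e_P[OF _ t] by auto
      ultimately show ?thesis by simp
    qed
    moreover have "inj_on (\<lambda>u. c' ! u) ?T" using c' by (auto simp: inj_on_def nth_eq_iff_index_eq)
    ultimately show ?thesis by (simp add: col_rank_def card_image)
  qed
  have F_e: "F (e t) = \<Theta> ! col_rank c (c' ! t)" if "t < ?r" for t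
    using eA[OF that] rank[OF that] by (simp add: F_def inflation_family_def)
  have F_s: "F p = (1, id)" if "p \<in> set s0" for p using that by (simp add: F_def inflation_family_def)
  have N: "fst u \<in> {1..N}" if "t < ?r" "u \<in> points (F (e t))" for t u
    using that \<Theta>(1)[OF that(1)] F_e[OF that(1)] by (auto simp: mem_points_iff c'_def)
  define idx where "idx = inv_into {..<?k} (\<lambda>j. s0 ! j)"
  have idx: "idx (s0 ! j) = j" if "j < ?k" for j
    unfolding idx_def using that occurrence_distinct[OF s0] len
    by (intro inv_into_f_f) (auto simp: inj_on_def nth_eq_iff_index_eq)
  define ti where "ti = inv_into {..<?r} e"
  have ti: "ti (e t) = t" if "t < ?r" for t
    unfolding ti_def using that bij_betw_imp_inj_on[OF e(1)] by (intro inv_into_f_f) simp_all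
  let ?X = "SIGMA p : points \<sigma>0. points (F p)"
  define g0 where "g0 x = (if fst x \<in> set s0 then s ! idx (fst x) else h (ti (fst x)) (fst (snd x)))"
    for x :: "point \<times> point"
  define g where "g = g0 \<circ> inv_into ?X f"
  have f_bij: "bij_betw f ?X (points \<tau>)" using f by (simp add: inflation_map_def)
  have gf: "g (f (p, u)) = g0 (p, u)" if "p \<in> points \<sigma>0" "u \<in> points (F p)" for p u
    unfolding g_def comp_def using that bij_betw_imp_inj_on[OF f_bij] by (subst inv_into_f_f) auto
  have g_s: "g (f (s0 ! j, (1, 1))) = s ! j" if "j < ?k" for j
  proof -
    have "s0 ! j \<in> set s0" using that len by simp
    then have "s0 ! j \<in> points \<sigma>0" "(1, 1) \<in> points (F (s0 ! j))" using sub F_s by auto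
    from gf[OF this] \<open>s0 ! j \<in> set s0\<close> show ?thesis by (simp add: g0_def idx that)
  qed
  have g_e: "g (f (e t, u)) = h t (fst u)" if "t < ?r" "u \<in> points (F (e t))" for t u
    using gf[of "e t" u] eA[OF that(1)] that by (simp add: g0_def ti)
  have pt: "(\<exists>j<?k. x = f (s0 ! j, (1, 1))) \<or> (\<exists>t<?r. \<exists>u\<in>points (F (e t)). x = f (e t, u))"
    if "x \<in> points \<tau>" for x
  proof -
    have "x \<in> f ` ?X" using that bij_betw_imp_surj_on[OF f_bij] by simp
    then obtain z where z: "x = f z" "z \<in> ?X" by blast
    obtain p u where "z = (p, u)" by (cases z)
    with z have pu: "x = f (p, u)" "p \<in> points \<sigma>0" "u \<in> points (F p)" by simp_all
    show ?thesis
    proof (cases "p \<in> set s0")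
      case True
      then obtain j where "j < ?k" "p = s0 ! j" using len by (auto simp: in_set_conv_nth)
      moreover have "u = (1, 1)" using pu(3) F_s[OF True] by simp
      ultimately show ?thesis using pu(1) by blast
    next
      case False
      then have "p \<in> e ` {..<?r}" using pu(2) bij_betw_imp_surj_on[OF e(1)] by blast
      then show ?thesis using pu by blast
    qed
  qed
  have s0j: "s0 ! j \<in> points \<sigma>0" "(1, 1) \<in> points (F (s0 ! j))" "s0 ! j \<in> set s0"
      "s ! j \<in> points \<sigma>" "s ! j \<in> set s" if "j < ?k" for j
  proof -
    show *: "s0 ! j \<in> set s0" "s ! j \<in> set s" using that len by simp_all
    then show "s0 ! j \<in> points \<sigma>0" "s ! j \<in> points \<sigma>" using sub by blast+
    show "(1, 1) \<in> points (F (s0 ! j))" using F_s[OF *(1)] by simp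
  qed
  \<comment> \<open>Both lists are occurrences of the same \<pi>.\<close>
  have ss: "(g x \<prec>\<^sub>P g y \<longleftrightarrow> x \<prec>\<^sub>P y) \<and> (g x \<prec>\<^sub>V g y \<longleftrightarrow> x \<prec>\<^sub>V y)"
    if "i < ?k" "x = f (s0 ! i, (1, 1))" "j < ?k" "y = f (s0 ! j, (1, 1))" for x y i j
  proof -
    have irr: "\<not> (1, 1) \<prec>\<^sub>P (1, 1)" "\<not> (1, 1) \<prec>\<^sub>V (1, 1)" by (simp_all add: less_P_def less_V_def)
    note fl = inflation_map_less[OF f s0j(1)[OF that(1)] s0j(1)[OF that(3)] s0j(2)[OF that(1)] s0j(2)[OF that(3)]]
    show ?thesis unfolding that(2,4) g_s[OF that(1)] g_s[OF that(3)] fl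
      using irr occurrence_nth_less_P[OF s that(1,3)] occurrence_nth_less_P[OF s0 that(1,3)]
        occurrence_nth_less_V[OF s that(1,3)] occurrence_nth_less_V[OF s0 that(1,3)] by simp
  qed
  \<comment> \<open>The row and column of a point determine its comparisons with the occurrence, and
    they agree on both sides. Both orders of the arguments are included, so the two mixed cases
    follow at once.\<close>
  have se: "(g x \<prec>\<^sub>P g y \<longleftrightarrow> x \<prec>\<^sub>P y) \<and> (g x \<prec>\<^sub>V g y \<longleftrightarrow> x \<prec>\<^sub>V y) \<and>
      (g y \<prec>\<^sub>P g x \<longleftrightarrow> y \<prec>\<^sub>P x) \<and> (g y \<prec>\<^sub>V g x \<longleftrightarrow> y \<prec>\<^sub>V x)"
    if j: "j < ?k" "x = f (s0 ! j, (1, 1))" and t: "t < ?r" "u \<in> points (F (e t))" "y = f (e t, u)" for x y j t u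
  proof -
    have et: "e t \<in> points \<sigma>0" "s0 ! j \<noteq> e t" using eA[OF t(1)] s0j(3)[OF j(1)] by auto
    note ht = h[OF t(1) N[OF t(1,2)]]
    have h': "h t (fst u) \<in> points \<sigma>" "s ! j \<noteq> h t (fst u)" using ht s0j(5)[OF j(1)] by auto
    note fl = inflation_map_less[OF f s0j(1)[OF j(1)] et(1) s0j(2)[OF j(1)] t(2)]
      inflation_map_less[OF f et(1) s0j(1)[OF j(1)] t(2) s0j(2)[OF j(1)]]
    have P: "s ! j \<prec>\<^sub>P h t (fst u) \<longleftrightarrow> s0 ! j \<prec>\<^sub>P e t"
      using occurrence_nth_less_P_cell[OF s j(1), of "h t (fst u)"]
        occurrence_nth_less_P_cell[OF s0 j(1), of "e t"] ht e(3)[OF t(1)] by (simp add: c'_def)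
    have V: "s ! j \<prec>\<^sub>V h t (fst u) \<longleftrightarrow> s0 ! j \<prec>\<^sub>V e t"
      using occurrence_nth_less_V_cell[OF s \<pi> j(1), of "h t (fst u)"]
        occurrence_nth_less_V_cell[OF s0 \<pi> j(1), of "e t"] ht e(2)[OF t(1)] by simp
    have P': "h t (fst u) \<prec>\<^sub>P s ! j \<longleftrightarrow> e t \<prec>\<^sub>P s0 ! j"
      using P not_less_P_iff[OF s0j(4)[OF j(1)] h'] not_less_P_iff[OF s0j(1)[OF j(1)] et] by simp
    have V': "h t (fst u) \<prec>\<^sub>V s ! j \<longleftrightarrow> e t \<prec>\<^sub>V s0 ! j"
      using V not_less_V_iff[OF \<sigma> s0j(4)[OF j(1)] h'] not_less_V_iff[OF \<sigma>0 s0j(1)[OF j(1)] et] by simp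
    show ?thesis unfolding j(2) t(3) g_s[OF j(1)] g_e[OF t(1,2)] fl P V P' V'
      using et(2) et(2)[symmetric] by simp
  qed
  \<comment> \<open>Within one block the direction decides; between different blocks the distinct
    rows and columns do.\<close>
  have ee: "(g x \<prec>\<^sub>P g y \<longleftrightarrow> x \<prec>\<^sub>P y) \<and> (g x \<prec>\<^sub>V g y \<longleftrightarrow> x \<prec>\<^sub>V y)"
    if x: "t < ?r" "u \<in> points (F (e t))" "x = f (e t, u)" and y: "t' < ?r" "v \<in> points (F (e t'))" "y = f (e t', v)"
    for x y t t' u v
  proof -
    have et: "e t \<in> points \<sigma>0" "e t' \<in> points \<sigma>0" using eA x(1) y(1) by blast+
    note fl = inflation_map_less[OF f et x(2) y(2)]
    note hx = h[OF x(1) N[OF x(1,2)]] and hy = h[OF y(1) N[OF y(1,2)]]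
    show ?thesis
    proof (cases "t = t'")
      case True
      have irr: "\<not> e t \<prec>\<^sub>P e t" "\<not> e t \<prec>\<^sub>V e t" by (simp_all add: less_P_def less_V_def)
      have v: "v \<in> points (F (e t))" using y(2) True by simp
      have "u \<prec>\<^sub>V v \<longleftrightarrow> (if b t then fst u < fst v else fst v < fst u)"
        using increasing_perms_less[OF _ x(2) v] decreasing_perms_less[OF _ x(2) v] \<Theta>(2)[OF x(1)] F_e[OF x(1)]
        by (simp add: c'_def split: if_splits)
      moreover have "g y = h t (fst v)" unfolding y(3) using g_e[OF x(1) v] True by simp
      ultimately show ?thesis
        using hP[OF x(1) N[OF x(1,2)] N[OF x(1) v]] hV[OF x(1) N[OF x(1,2)] N[OF x(1) v]]
          irr True fl g_e[OF x(1,2)] x(3) y(3) by (simp add: less_P_def)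
    next
      case False
      then have ne: "c ! t \<noteq> c ! t'" "c' ! t \<noteq> c' ! t'" "e t \<noteq> e t'"
        using x(1) y(1) c(1) c' inj_on_eq_iff[OF bij_betw_imp_inj_on[OF e(1)], of t t']
        by (simp_all add: nth_eq_iff_index_eq)
      have "h t (fst u) \<prec>\<^sub>P h t' (fst v) \<longleftrightarrow> e t \<prec>\<^sub>P e t'"
        using cell_col_neq[of s "h t (fst u)" "h t' (fst v)"] cell_col_neq[of s0 "e t" "e t'"]
          hx hy e(3) x(1) y(1) ne by (simp add: c'_def)
      moreover have "h t (fst u) \<prec>\<^sub>V h t' (fst v) \<longleftrightarrow> e t \<prec>\<^sub>V e t'"
        using cell_row_neq[of s "h t (fst u)" "h t' (fst v)"] cell_row_neq[of s0 "e t" "e t'"]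
          hx hy e(2) x(1) y(1) ne by simp
      ultimately show ?thesis unfolding x(3) y(3) g_e[OF x(1,2)] g_e[OF y(1,2)] fl using ne(3) by simp
    qed
  qed
  have "embeds (points \<tau>) g"
    unfolding embeds_def
  proof (intro ballI)
    fix x y assume xy: "x \<in> points \<tau>" "y \<in> points \<tau>"
    from pt[OF xy(1)] pt[OF xy(2)] show "(g x \<prec>\<^sub>P g y \<longleftrightarrow> x \<prec>\<^sub>P y) \<and> (g x \<prec>\<^sub>V g y \<longleftrightarrow> x \<prec>\<^sub>V y)"
    proof (elim disjE exE conjE bexE)
      fix i j assume "i < ?k" "x = f (s0 ! i, (1, 1))" "j < ?k" "y = f (s0 ! j, (1, 1))"
      then show ?thesis by (rule ss)
    next
      fix j t u assume "j < ?k" "x = f (s0 ! j, (1, 1))" "t < ?r" "u \<in> points (F (e t))" "y = f (e t, u)"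
      from se[OF this] show ?thesis by simp
    next
      fix j t u assume "t < ?r" "u \<in> points (F (e t))" "x = f (e t, u)" "j < ?k" "y = f (s0 ! j, (1, 1))"
      from se[OF this(4,5,1,2,3)] show ?thesis by simp
    next
      fix t u t' v assume "t < ?r" "u \<in> points (F (e t))" "x = f (e t, u)" "t' < ?r" "v \<in> points (F (e t'))" "y = f (e t', v)"
      then show ?thesis by (rule ee)
    qed
  qed
  moreover have "g ` points \<tau> \<subseteq> points \<sigma>"
  proof
    fix z assume "z \<in> g ` points \<tau>"
    then obtain x where x: "x \<in> points \<tau>" "z = g x" by blast
    from pt[OF x(1)] show "z \<in> points \<sigma>"
    proof (elim disjE exE conjE bexE)
      fix j assume "j < ?k" "x = f (s0 ! j, (1, 1))"
      then show ?thesis using x(2) g_s s0j(4) by simp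
    next
      fix t u assume *: "t < ?r" "u \<in> points (F (e t))" "x = f (e t, u)"
      then show ?thesis using x(2) g_e h[OF *(1) N[OF *(1,2)]] by simp
    qed
  qed
  ultimately show ?thesis using contains_of_embedding[OF \<rho>] by blast
qed

section \<open>Defining stability by bounded counts\<close>

lemma finite_uniform_bound:
  fixes P :: "'a \<Rightarrow> nat \<Rightarrow> bool"
  assumes "finite T" "\<And>x. x \<in> T \<Longrightarrow> \<exists>n. P x n" "\<And>x m n. P x m \<Longrightarrow> m \<le> n \<Longrightarrow> P x n"
  shows "\<exists>N. \<forall>x\<in>T. P x N"
  using assms(1,2)
proof (induction T rule: finite_induct)
  case (insert x T)
  obtain N where N: "\<forall>y\<in>T. P y N" using insert.IH insert.prems by blast
  obtain n where n: "P x n" using insert.prems by blast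
  have "P y (max N n)" if "y \<in> insert x T" for y
  proof (cases "y = x")
    case True
    show ?thesis unfolding True by (rule assms(3)[OF n]) simp
  next
    case False
    with that N have "P y N" by blast
    then show ?thesis by (rule assms(3)) simp
  qed
  then show ?case by blast
qed simp

text \<open>The parameters over which the avoidance condition ranges. Their number is finite, which
  makes the bound in \<open>no_large_cycle\<close> uniform.\<close>

definition expansion_data :: "nat \<Rightarrow> (perm \<times> nat list \<times> perm set list) set" where
  "expansion_data k = {(\<pi>, c, Xs). \<pi> \<in> perms \<and> fst \<pi> = k \<and> distinct c \<and> set c \<subseteq> {1..k + 1} \<and>
     length c \<ge> 2 \<and> length Xs = length c \<and> set Xs \<subseteq> {increasing_perms, decreasing_perms}}"

lemma finite_expansion_data: "finite (expansion_data k)"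
proof -
  let ?\<Pi> = "Pair k ` {f. f permutes {1..k}}"
  let ?L = "{c. set c \<subseteq> {1..k + 1} \<and> length c \<le> k + 1}"
  let ?M = "{Xs. set Xs \<subseteq> {increasing_perms, decreasing_perms} \<and> length Xs \<le> k + 1}"
  have "expansion_data k \<subseteq> ?\<Pi> \<times> ?L \<times> ?M"
  proof
    fix x assume x: "x \<in> expansion_data k"
    obtain \<pi> c Xs where x_eq: "x = (\<pi>, c, Xs)" by (cases x)
    then have *: "\<pi> \<in> perms" "fst \<pi> = k" "distinct c" "set c \<subseteq> {1..k + 1}" "length Xs = length c"
        "set Xs \<subseteq> {increasing_perms, decreasing_perms}"
      using x unfolding expansion_data_def by simp_all
    have "length c \<le> k + 1" using card_mono[OF _ *(4)] distinct_card[OF *(3)] by simp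
    moreover have "\<pi> \<in> ?\<Pi>" using permutes_of_perms[OF *(1)] *(2) by (intro image_eqI[of _ _ "snd \<pi>"]) auto
    ultimately show "x \<in> ?\<Pi> \<times> ?L \<times> ?M" using * by (simp add: x_eq)
  qed
  moreover have "finite (?\<Pi> \<times> ?L \<times> ?M)"
    by (intro finite_cartesian_product finite_imageI finite_permutations finite_lists_length_le) simp_all
  ultimately show ?thesis by (rule finite_subset)
qed

lemma cell_row_set: "set s = set s' \<Longrightarrow> cell_row s = cell_row s'"
  by (simp add: cell_row_def fun_eq_iff)

lemma cell_col_set: "set s = set s' \<Longrightarrow> cell_col s = cell_col s'"
  by (simp add: cell_col_def fun_eq_iff)

text \<open>If every cell of a cycle had R points, each would contain a monotone sequence of length
  N. The directions found there select Xs, and the avoided permutation belonging to this Xs would be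
  contained in \<sigma>, since the expansion around it has blocks of length at most N.\<close>

lemma no_large_cycle:
  assumes C: "C \<subseteq> perms"
    and av: "\<And>\<pi> c Xs. (\<pi>, c, Xs) \<in> expansion_data k \<Longrightarrow> \<exists>\<rho>\<in>expansion_class \<pi> c Xs. avoids C \<rho>"
  obtains n where "\<And>\<sigma> s c. \<sigma> \<in> C \<Longrightarrow> set s \<subseteq> points \<sigma> \<Longrightarrow> distinct s \<Longrightarrow> length s = k \<Longrightarrow>
    distinct c \<Longrightarrow> set c \<subseteq> {1..k + 1} \<Longrightarrow> 2 \<le> length c \<Longrightarrow>
    \<exists>t<length c. cell_matrix \<sigma> s (c ! t) (rotate1 c ! t) < n"
proof -
  define P where "P x N \<longleftrightarrow> (case x of (\<pi>, c, Xs) \<Rightarrow> \<exists>\<Theta> \<tau> \<rho>. avoids C \<rho> \<and>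
      (\<forall>t<length Xs. \<Theta> ! t \<in> Xs ! t \<and> fst (\<Theta> ! t) \<le> N) \<and>
      is_inflated_expansion \<pi> c \<Theta> \<tau> \<and> contains \<tau> \<rho>)" for x :: "perm \<times> nat list \<times> perm set list" and N
  have "\<exists>N. \<forall>x\<in>expansion_data k. P x N"
  proof (rule finite_uniform_bound[OF finite_expansion_data])
    fix x assume x: "x \<in> expansion_data k"
    obtain \<pi> c Xs where x_eq: "x = (\<pi>, c, Xs)" by (cases x)
    obtain \<rho> where "\<rho> \<in> expansion_class \<pi> c Xs" and \<rho>: "avoids C \<rho>"
      using av x unfolding x_eq by blast
    then obtain \<Theta> \<tau> where \<Theta>: "length \<Theta> = length Xs" "\<forall>t<length Xs. \<Theta> ! t \<in> Xs ! t"
        "is_inflated_expansion \<pi> c \<Theta> \<tau>" "contains \<tau> \<rho>"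
      unfolding expansion_class_def mem_Collect_eq by (elim conjE exE)
    have "fst (\<Theta> ! t) \<le> sum_list (map fst \<Theta>)" if "t < length Xs" for t
      using that \<Theta>(1) by (intro member_le_sum_list) auto
    then have "P x (sum_list (map fst \<Theta>))"
      unfolding P_def x_eq prod.case using \<rho> \<Theta>(2-4)
      by (intro exI[of _ \<Theta>] exI[of _ \<tau>] exI[of _ \<rho>] conjI) simp_all
    then show "\<exists>N. P x N" ..
  next
    fix x m n assume "P x m" "m \<le> (n :: nat)"
    then show "P x n"
      unfolding P_def by (cases x) (simp, meson le_trans)
  qed
  then obtain N where N: "\<And>x. x \<in> expansion_data k \<Longrightarrow> P x N" by blast
  obtain R where R: "\<forall>\<sigma>\<in>perms. \<forall>V\<subseteq>points \<sigma>. R \<le> card V \<longrightarrow>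
      (\<exists>h b. \<forall>a\<in>{1..N}. h a \<in> V \<and> (\<forall>a'\<in>{1..N}. (h a \<prec>\<^sub>P h a' \<longleftrightarrow> a < a') \<and>
        (h a \<prec>\<^sub>V h a' \<longleftrightarrow> (if b then a < a' else a' < a))))"
    using exists_monotone_subset[of N] by (elim exE)
  show ?thesis
  proof (rule that[of R], rule ccontr)
    fix \<sigma> s0 c
    assume \<sigma>C: "\<sigma> \<in> C" and s0: "set s0 \<subseteq> points \<sigma>" "distinct s0" "length s0 = k"
      and c: "distinct c" "set c \<subseteq> {1..k + 1}" "2 \<le> length c"
      and no: "\<not> (\<exists>t<length c. cell_matrix \<sigma> s0 (c ! t) (rotate1 c ! t) < R)"
    have \<sigma>: "\<sigma> \<in> perms" using C \<sigma>C by blast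
    \<comment> \<open>The list s rearranges \<open>s0\<close> from left to right. Cells depend only
      on the set of entries.\<close>
    obtain \<pi> s where \<pi>: "\<pi> \<in> perms" "fst \<pi> = card (set s0)" "occurrence \<pi> \<sigma> s" "set s = set s0"
      using exists_pattern[OF \<sigma> s0(1)] .
    have k: "fst \<pi> = k" using \<pi>(2) distinct_card[OF s0(2)] s0(3) by simp
    let ?r = "length c" and ?c' = "rotate1 c"
    define V where "V t = {p \<in> points \<sigma> - set s. cell_row s p = c ! t \<and> cell_col s p = ?c' ! t}" for t
    have "\<exists>h b. \<forall>a\<in>{1..N}. h a \<in> V t \<and> (\<forall>a'\<in>{1..N}. (h a \<prec>\<^sub>P h a' \<longleftrightarrow> a < a') \<and>
        (h a \<prec>\<^sub>V h a' \<longleftrightarrow> (if b then a < a' else a' < a)))" if "t < ?r" for t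
    proof (rule R[rule_format, OF \<sigma>])
      show "V t \<subseteq> points \<sigma>" by (auto simp: V_def)
      have "R \<le> cell_matrix \<sigma> s0 (c ! t) (?c' ! t)" using no that by (meson not_le_imp_less)
      then show "R \<le> card (V t)"
        unfolding cell_matrix_def V_def \<pi>(4) cell_row_set[OF \<pi>(4)] cell_col_set[OF \<pi>(4)] .
    qed
    then have "\<forall>t. \<exists>h b. t < ?r \<longrightarrow> (\<forall>a\<in>{1..N}. h a \<in> V t \<and> (\<forall>a'\<in>{1..N}. (h a \<prec>\<^sub>P h a' \<longleftrightarrow> a < a') \<and>
        (h a \<prec>\<^sub>V h a' \<longleftrightarrow> (if b then a < a' else a' < a))))" by blast
    then obtain h b where hb: "\<forall>t. t < ?r \<longrightarrow> (\<forall>a\<in>{1..N}. h t a \<in> V t \<and> (\<forall>a'\<in>{1..N}. (h t a \<prec>\<^sub>P h t a' \<longleftrightarrow> a < a') \<and>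
        (h t a \<prec>\<^sub>V h t a' \<longleftrightarrow> (if b t then a < a' else a' < a))))"
      unfolding choice_iff by (elim exE)
    define rk where "rk t = col_rank c (?c' ! t)" for t
    have c': "distinct ?c'" "length ?c' = ?r" "set ?c' = set c" using c(1) by simp_all
    have c'_mem: "?c' ! t \<in> set c" if "t < ?r" for t using nth_mem[of t ?c'] that c'(2,3) by simp
    have rk_mono: "col_rank c i < col_rank c j" if "i \<in> set c" "i < j" for i j
      unfolding col_rank_def using that by (intro psubset_card_mono) auto
    have rk_inj: "inj_on rk {..<?r}"
    proof (rule inj_onI)
      fix t u assume tu: "t \<in> {..<?r}" "u \<in> {..<?r}" "rk t = rk u"
      have "?c' ! t = ?c' ! u"
        using rk_mono[OF c'_mem[of t], of "?c' ! u"] rk_mono[OF c'_mem[of u], of "?c' ! t"] tu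
        by (cases "?c' ! t" "?c' ! u" rule: linorder_cases) (simp_all add: rk_def)
      then show "t = u" using tu(1,2) c' by (simp add: nth_eq_iff_index_eq)
    qed
    have rk_less: "rk t < ?r" if "t < ?r" for t
    proof -
      have "col_rank c (?c' ! t) < card (set c)"
        unfolding col_rank_def using c'_mem[OF that] by (intro psubset_card_mono) auto
      then show ?thesis using distinct_card[OF c(1)] by (simp add: rk_def)
    qed
    \<comment> \<open>The directions are known along the cycle, whereas Xs is ordered from left to
      right; the inverse of \<open>rk\<close> translates.\<close>
    define Xs where "Xs = map (\<lambda>i. if b (inv_into {..<?r} rk i) then increasing_perms else decreasing_perms) [0..<?r]"
    have Xs: "Xs ! rk t = (if b t then increasing_perms else decreasing_perms)" if "t < ?r" for t
      using rk_less[OF that] inv_into_f_f[OF rk_inj, of t] that by (simp add: Xs_def)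
    have len: "length Xs = ?r" by (simp add: Xs_def)
    have "(\<pi>, c, Xs) \<in> expansion_data k"
      unfolding expansion_data_def using \<pi>(1) k c by (auto simp: Xs_def)
    then have "P (\<pi>, c, Xs) N" by (rule N)
    then obtain \<Theta> \<tau> \<rho> where \<rho>: "avoids C \<rho>" and \<Theta>: "\<forall>t<length Xs. \<Theta> ! t \<in> Xs ! t \<and> fst (\<Theta> ! t) \<le> N"
        and \<tau>: "is_inflated_expansion \<pi> c \<Theta> \<tau>" "contains \<tau> \<rho>"
      unfolding P_def prod.case by (elim exE conjE)
    have "contains \<sigma> \<rho>"
    proof (rule inflated_expansion_contains[OF \<tau>(1) \<pi>(1) c(1) _ \<sigma> \<pi>(3), of N h b])
      show "set c \<subseteq> {1..fst \<pi> + 1}" using c(2) k by simp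
      fix t assume t: "t < ?r"
      note hb' = hb[rule_format, OF t]
      show "h t a \<in> points \<sigma> - set s \<and> cell_row s (h t a) = c ! t \<and> cell_col s (h t a) = ?c' ! t"
        if "a \<in> {1..N}" for a
        using hb'[OF that] by (simp add: V_def)
      show "h t a \<prec>\<^sub>P h t a' \<longleftrightarrow> a < a'" "h t a \<prec>\<^sub>V h t a' \<longleftrightarrow> (if b t then a < a' else a' < a)"
        if "a \<in> {1..N}" "a' \<in> {1..N}" for a a'
        using conjunct2[OF hb'[OF that(1)], rule_format, OF that(2)] by blast+
      show "fst (\<Theta> ! col_rank c (?c' ! t)) \<le> N"
        "\<Theta> ! col_rank c (?c' ! t) \<in> (if b t then increasing_perms else decreasing_perms)"
        using \<Theta>[rule_format, of "rk t"] rk_less[OF t] len Xs[OF t] by (simp_all add: rk_def)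
    qed (rule \<tau>(2))
    with \<rho> \<sigma>C show False by (simp add: avoids_def)
  qed
qed

section \<open>Defining cell counts by formulas\<close>

lemma sum_cell_matrix:
  assumes "length s = k"
  shows "(\<Sum>j\<in>{1..k + 1}. cell_matrix \<sigma> s i j) = row_count \<sigma> s i"
    "(\<Sum>i\<in>{1..k + 1}. cell_matrix \<sigma> s i j) = col_count \<sigma> s j"
proof -
  let ?S = "{p \<in> points \<sigma> - set s. cell_row s p = i}" and ?T = "{p \<in> points \<sigma> - set s. cell_col s p = j}"
  have "(\<Sum>y\<in>{1..k + 1}. \<Sum>p\<in>{p \<in> ?S. cell_col s p = y}. 1) = (\<Sum>p\<in>?S. 1 :: nat)"
    using cell_col_bounds[OF assms] by (intro sum.group) auto
  moreover have "{p \<in> ?S. cell_col s p = y} = {p \<in> points \<sigma> - set s. cell_row s p = i \<and> cell_col s p = y}" for y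
    by blast
  ultimately show "(\<Sum>j\<in>{1..k + 1}. cell_matrix \<sigma> s i j) = row_count \<sigma> s i"
    by (simp only: row_count_def cell_matrix_def card_eq_sum)
  have "(\<Sum>y\<in>{1..k + 1}. \<Sum>p\<in>{p \<in> ?T. cell_row s p = y}. 1) = (\<Sum>p\<in>?T. 1 :: nat)"
    using cell_row_bounds[OF assms] by (intro sum.group) auto
  moreover have "{p \<in> ?T. cell_row s p = y} = {p \<in> points \<sigma> - set s. cell_row s p = y \<and> cell_col s p = j}" for y
    by blast
  ultimately show "(\<Sum>i\<in>{1..k + 1}. cell_matrix \<sigma> s i j) = col_count \<sigma> s j"
    by (simp only: col_count_def cell_matrix_def card_eq_sum)
qed

lemma stable_iff_cell_matrix:
  assumes "\<sigma> \<in> perms" "set s \<subseteq> points \<sigma>" "length s = k"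
  shows "stable \<sigma> s \<longleftrightarrow> (\<forall>i\<in>{1..k + 1}.
    (\<Sum>j\<in>{1..k + 1}. cell_matrix \<sigma> s i j) = (\<Sum>j\<in>{1..k + 1}. cell_matrix \<sigma> s j i))"
proof -
  have "row_count \<sigma> s i = 0 \<and> col_count \<sigma> s i = 0" if "i \<notin> {1..k + 1}" for i
  proof -
    have "{p \<in> points \<sigma> - set s. cell_row s p = i} = {}" "{p \<in> points \<sigma> - set s. cell_col s p = i} = {}"
      using that cell_row_bounds[OF assms(3)] cell_col_bounds[OF assms(3)] by blast+
    then show ?thesis unfolding row_count_def col_count_def by (simp only: card.empty)
  qed
  then show ?thesis
    unfolding stable_iff_row_count_eq_col_count[OF assms(1,2)] sum_cell_matrix[OF assms(3)]
    by metis
qed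

text \<open>Counts indices instead of points, so that for every tuple, even with repetitions,
  membership is a condition on finitely many atomic formulas. For distinct tuples it is membership
  in the cell.\<close>

definition in_cell :: "nat \<Rightarrow> nat \<Rightarrow> nat \<Rightarrow> point list \<Rightarrow> point \<Rightarrow> bool" where
  "in_cell k i j as p \<longleftrightarrow> (\<forall>l\<in>{1..k}. as ! (l - 1) \<noteq> p) \<and>
     Suc (card {l \<in> {1..k}. as ! (l - 1) \<prec>\<^sub>V p}) = i \<and> Suc (card {l \<in> {1..k}. as ! (l - 1) \<prec>\<^sub>P p}) = j"

lemma card_nth_filter:
  assumes "distinct as" "length as = k"
  shows "card {l \<in> {1..k}. P (as ! (l - 1))} = card {q \<in> set as. P q}"
proof -
  have set_as: "set as = (\<lambda>l. as ! (l - 1)) ` {1..k}"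
  proof -
    have "set as = (\<lambda>l. as ! l) ` {0..<k}" using assms(2) by (auto simp: set_conv_nth)
    also have "\<dots> = (\<lambda>l. as ! (l - 1)) ` Suc ` {0..<k}" unfolding image_image diff_Suc_1 ..
    finally show ?thesis by (simp only: image_Suc_atLeastLessThan atLeastLessThanSuc_atLeastAtMost One_nat_def)
  qed
  have "{q \<in> f ` S. P q} = f ` {l \<in> S. P (f l)}" for f :: "nat \<Rightarrow> 'a" and S by blast
  then have "{q \<in> set as. P q} = (\<lambda>l. as ! (l - 1)) ` {l \<in> {1..k}. P (as ! (l - 1))}"
    unfolding set_as .
  moreover have "inj_on (\<lambda>l. as ! (l - 1)) {l \<in> {1..k}. P (as ! (l - 1))}"
    using assms by (auto simp: inj_on_def nth_eq_iff_index_eq)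
  ultimately show ?thesis by (simp add: card_image)
qed

lemma card_in_cell:
  assumes "distinct as" "length as = k"
  shows "card {p \<in> points \<sigma>. in_cell k i j as p} = cell_matrix \<sigma> as i j"
proof -
  have "(\<forall>l\<in>{1..k}. as ! (l - 1) \<noteq> p) \<longleftrightarrow> p \<notin> set as" for p
  proof -
    have "{l \<in> {1..k}. as ! (l - 1) = p} = {} \<longleftrightarrow> {q \<in> set as. q = p} = {}"
      using card_nth_filter[OF assms, of "\<lambda>q. q = p"] card_0_eq[of "{l \<in> {1..k}. as ! (l - 1) = p}"]
        card_0_eq[of "{q \<in> set as. q = p}"] by simp
    then show ?thesis by blast
  qed
  moreover have "card {l \<in> {1..k}. as ! (l - 1) \<prec>\<^sub>V p} = card {q \<in> set as. q \<prec>\<^sub>V p}"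
      "card {l \<in> {1..k}. as ! (l - 1) \<prec>\<^sub>P p} = card {q \<in> set as. q \<prec>\<^sub>P p}" for p
    by (rule card_nth_filter[OF assms])+
  ultimately have "in_cell k i j as p \<longleftrightarrow> p \<notin> set as \<and> cell_row as p = i \<and> cell_col as p = j" for p
    unfolding in_cell_def cell_row_def cell_col_def by simp
  then have "{p \<in> points \<sigma>. in_cell k i j as p} = {p \<in> points \<sigma> - set as. cell_row as p = i \<and> cell_col as p = j}"
    by auto
  then show ?thesis by (simp add: cell_matrix_def)
qed

text \<open>Membership depends only on which of the 3k atomic formulas comparing z with an argument
  hold.\<close>

lemma cell_formula:
  obtains Q where "\<And>z. fv (Q z) \<subseteq> {1..k} \<union> {z}" "\<And>A e z. sat A e (Q z) \<longleftrightarrow> in_cell k i j (arguments k e) (e z)"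
proof -
  have "\<exists>\<chi>. fv \<chi> \<subseteq> {1..k} \<union> {z} \<and> (\<forall>A e. sat A e \<chi> \<longleftrightarrow> in_cell k i j (arguments k e) (e z))" for z
  proof -
    let ?\<Phi> = "(\<lambda>l. Eq l z) ` {1..k} \<union> (\<lambda>l. LessV l z) ` {1..k} \<union> (\<lambda>l. LessP l z) ` {1..k}"
    define G where "G S \<longleftrightarrow> (\<forall>l\<in>{1..k}. Eq l z \<notin> S) \<and> Suc (card {l \<in> {1..k}. LessV l z \<in> S}) = i \<and>
      Suc (card {l \<in> {1..k}. LessP l z \<in> S}) = j" for S
    have "finite ?\<Phi>" by simp
    then obtain \<chi> where \<chi>: "fv \<chi> \<subseteq> (\<Union>\<phi>\<in>?\<Phi>. fv \<phi>)" "\<And>A e. sat A e \<chi> \<longleftrightarrow> G {\<phi> \<in> ?\<Phi>. sat A e \<phi>}"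
      using boolean_combination[of ?\<Phi> G] by blast
    have "fv \<chi> \<subseteq> {1..k} \<union> {z}" by (rule order_trans[OF \<chi>(1)]) auto
    moreover have "sat A e \<chi> \<longleftrightarrow> in_cell k i j (arguments k e) (e z)" for A e
    proof -
      let ?S = "{\<phi> \<in> ?\<Phi>. sat A e \<phi>}"
      have arg: "arguments k e ! (l - 1) = e l" if "l \<in> {1..k}" for l
        using that by (cases l) (simp_all add: arguments_def nth_upt del: upt_Suc)
      have "(\<forall>l\<in>{1..k}. Eq l z \<notin> ?S) \<longleftrightarrow> (\<forall>l\<in>{1..k}. arguments k e ! (l - 1) \<noteq> e z)"
        using arg by auto
      moreover have "{l \<in> {1..k}. LessV l z \<in> ?S} = {l \<in> {1..k}. arguments k e ! (l - 1) \<prec>\<^sub>V e z}"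
        using arg by auto
      moreover have "{l \<in> {1..k}. LessP l z \<in> ?S} = {l \<in> {1..k}. arguments k e ! (l - 1) \<prec>\<^sub>P e z}"
        using arg by auto
      ultimately show ?thesis unfolding \<chi>(2) G_def in_cell_def by simp
    qed
    ultimately show ?thesis by blast
  qed
  then have "\<forall>z. \<exists>\<chi>. fv \<chi> \<subseteq> {1..k} \<union> {z} \<and> (\<forall>A e. sat A e \<chi> \<longleftrightarrow> in_cell k i j (arguments k e) (e z))" by blast
  then obtain Q where "\<forall>z. fv (Q z) \<subseteq> {1..k} \<union> {z} \<and> (\<forall>A e. sat A e (Q z) \<longleftrightarrow> in_cell k i j (arguments k e) (e z))"
    unfolding choice_iff by (elim exE)
  then show ?thesis by (intro that[of Q]) simp_all
qed

lemma cell_count_formula: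
  obtains \<chi> where "fv \<chi> \<subseteq> {1..k}"
    "\<And>\<sigma> e. sat (points \<sigma>) e \<chi> \<longleftrightarrow> m \<le> card {p \<in> points \<sigma>. in_cell k i j (arguments k e) p}"
proof -
  obtain Q where Q: "\<And>z. fv (Q z) \<subseteq> {1..k} \<union> {z}"
      "\<And>A e z. sat A e (Q z) \<longleftrightarrow> in_cell k i j (arguments k e) (e z)"
    by (rule cell_formula[of k i j]) blast
  obtain \<chi> where "fv \<chi> \<subseteq> {1..k}" "\<forall>A e. finite A \<longrightarrow> inj_on fst A \<longrightarrow>
      (sat A e \<chi> \<longleftrightarrow> m \<le> card {p \<in> A. in_cell k i j (arguments k e) p})"
    using count_formula[of k Q "in_cell k i j" m, OF Q] by (elim exE conjE)
  then show ?thesis using that[of \<chi>] inj_on_fst_points by simp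
qed

text \<open>The formula accepts exactly the truth patterns, over a finite set of test formulas, that
  are realized by some union of cycles in a member of C. It has to be shown that a tuple sharing its
  pattern with a union of cycles is one itself.\<close>

lemma definable:
  assumes C: "C \<subseteq> perms"
    and n: "\<And>\<sigma> s c. \<sigma> \<in> C \<Longrightarrow> set s \<subseteq> points \<sigma> \<Longrightarrow> distinct s \<Longrightarrow> length s = k \<Longrightarrow>
      distinct c \<Longrightarrow> set c \<subseteq> {1..k + 1} \<Longrightarrow> 2 \<le> length c \<Longrightarrow>
      \<exists>t<length c. cell_matrix \<sigma> s (c ! t) (rotate1 c ! t) < n"
  shows "\<exists>\<phi>. fv \<phi> \<subseteq> {1..k} \<and> (\<forall>\<sigma>\<in>C. \<forall>as. length as = k \<and> set as \<subseteq> points \<sigma> \<longrightarrow>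
    (models \<sigma> as \<phi> \<longleftrightarrow> union_of_cycles \<sigma> as))"
proof -
  let ?I = "{1..k + 1}"
  \<comment> \<open>The bound of \<open>balanced_entry_bound\<close> for off-diagonal entries of a
    balanced matrix.\<close>
  define T where "T = card ?I * card ?I * n"
  have "\<forall>x. \<exists>\<chi>. fv \<chi> \<subseteq> {1..k} \<and> (\<forall>\<sigma> e. sat (points \<sigma>) e \<chi> \<longleftrightarrow>
      snd x \<le> card {p \<in> points \<sigma>. in_cell k (fst (fst x)) (snd (fst x)) (arguments k e) p})"
  proof
    fix x :: "(nat \<times> nat) \<times> nat"
    show "\<exists>\<chi>. fv \<chi> \<subseteq> {1..k} \<and> (\<forall>\<sigma> e. sat (points \<sigma>) e \<chi> \<longleftrightarrow>
      snd x \<le> card {p \<in> points \<sigma>. in_cell k (fst (fst x)) (snd (fst x)) (arguments k e) p})"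
      by (rule cell_count_formula[of k "snd x" "fst (fst x)" "snd (fst x)"]) blast
  qed
  then obtain \<chi> where \<chi>: "\<forall>x. fv (\<chi> x) \<subseteq> {1..k} \<and> (\<forall>\<sigma> e. sat (points \<sigma>) e (\<chi> x) \<longleftrightarrow>
      snd x \<le> card {p \<in> points \<sigma>. in_cell k (fst (fst x)) (snd (fst x)) (arguments k e) p})"
    unfolding choice_iff by (elim exE)
  \<comment> \<open>Thresholds up to T + 1 determine an entry that is at most T exactly, because
    they also test for one point more. The equalities transfer distinctness of the tuple.\<close>
  define \<Phi> where "\<Phi> = \<chi> ` ((?I \<times> ?I) \<times> {..T + 1}) \<union> (\<lambda>(l, l'). Eq l l') ` ({1..k} \<times> {1..k})"
  define holds where "holds \<sigma> as = {\<phi> \<in> \<Phi>. sat (points \<sigma>) (\<lambda>i. as ! (i - 1)) \<phi>}" for \<sigma> :: perm and as :: "point list"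
  define G where "G S \<longleftrightarrow> (\<exists>\<sigma>\<in>C. \<exists>as. length as = k \<and> set as \<subseteq> points \<sigma> \<and>
      union_of_cycles \<sigma> as \<and> S = holds \<sigma> as)" for S
  have "finite \<Phi>" by (simp add: \<Phi>_def)
  then obtain \<phi> where \<phi>: "fv \<phi> \<subseteq> (\<Union>\<psi>\<in>\<Phi>. fv \<psi>)" "\<And>A e. sat A e \<phi> \<longleftrightarrow> G {\<psi> \<in> \<Phi>. sat A e \<psi>}"
    using boolean_combination[of \<Phi> G] by blast
  have "fv \<psi> \<subseteq> {1..k}" if "\<psi> \<in> \<Phi>" for \<psi>
    using that \<chi> unfolding \<Phi>_def by auto
  then have "fv \<phi> \<subseteq> {1..k}" using \<phi>(1) by blast
  moreover have "models \<sigma> as \<phi> \<longleftrightarrow> union_of_cycles \<sigma> as"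
    if \<sigma>: "\<sigma> \<in> C" and as: "length as = k" "set as \<subseteq> points \<sigma>" for \<sigma> as
  proof -
    have "models \<sigma> as \<phi> \<longleftrightarrow> G (holds \<sigma> as)" unfolding models_def \<phi>(2) holds_def ..
    moreover have "G (holds \<sigma> as)" if "union_of_cycles \<sigma> as"
      unfolding G_def using \<sigma> as that by blast
    moreover have "union_of_cycles \<sigma> as" if "G (holds \<sigma> as)"
    proof -
      obtain \<sigma>' as' where \<sigma>': "\<sigma>' \<in> C" and as': "length as' = k" "set as' \<subseteq> points \<sigma>'"
          and cyc: "union_of_cycles \<sigma>' as'" and eq: "holds \<sigma> as = holds \<sigma>' as'"
        using \<open>G (holds \<sigma> as)\<close> unfolding G_def by (elim bexE exE conjE)
      have sat_iff: "sat (points \<sigma>) (\<lambda>i. as ! (i - 1)) \<psi> \<longleftrightarrow> sat (points \<sigma>') (\<lambda>i. as' ! (i - 1)) \<psi>"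
        if "\<psi> \<in> \<Phi>" for \<psi>
      proof -
        have "\<psi> \<in> holds \<sigma> as \<longleftrightarrow> \<psi> \<in> holds \<sigma>' as'" using eq by simp
        with that show ?thesis by (simp add: holds_def)
      qed
      have dist': "distinct as'" and st': "stable \<sigma>' as'" using cyc by (simp_all add: union_of_cycles_def)
      have dist: "distinct as"
        unfolding distinct_conv_nth
      proof (intro allI impI)
        fix a b assume ab: "a < length as" "b < length as" "a \<noteq> b"
        have "Eq (Suc a) (Suc b) \<in> \<Phi>" unfolding \<Phi>_def using ab as(1) by (intro UnI2 image_eqI[of _ _ "(Suc a, Suc b)"]) auto
        from sat_iff[OF this] have "as ! a = as ! b \<longleftrightarrow> as' ! a = as' ! b" by simp
        then show "as ! a \<noteq> as ! b" using dist' ab as(1) as'(1) by (simp add: nth_eq_iff_index_eq)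
      qed
      have args: "arguments k (\<lambda>i. as ! (i - 1)) = as" if "length as = k" for as :: "point list"
        using that by (intro nth_equalityI) (auto simp: arguments_def nth_append simp del: upt_Suc)
      have counts: "m \<le> cell_matrix \<sigma> as i j \<longleftrightarrow> m \<le> cell_matrix \<sigma>' as' i j"
        if "i \<in> ?I" "j \<in> ?I" "m \<le> T + 1" for i j m
      proof -
        have "\<chi> ((i, j), m) \<in> \<Phi>" unfolding \<Phi>_def using that by (intro UnI1 imageI) simp
        from sat_iff[OF this] show ?thesis
          using \<chi> by (simp add: args[OF as(1), simplified] args[OF as'(1), simplified] card_in_cell[OF dist as(1)] card_in_cell[OF dist' as'(1)])
      qed
      have \<sigma>'p: "\<sigma>' \<in> perms" and \<sigma>p: "\<sigma> \<in> perms" using C \<sigma> \<sigma>' by blast+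
      have bal': "(\<Sum>j\<in>?I. cell_matrix \<sigma>' as' i j) = (\<Sum>j\<in>?I. cell_matrix \<sigma>' as' j i)" if "i \<in> ?I" for i
        using st' that unfolding stable_iff_cell_matrix[OF \<sigma>'p as'(2,1)] by blast
      \<comment> \<open>Only the matrix of \<open>\<sigma>'\<close> is known to be balanced, and so
        bounded by T; the thresholds carry its entries over to \<sigma>.\<close>
      have off: "cell_matrix \<sigma> as i j = cell_matrix \<sigma>' as' i j" if ij: "i \<in> ?I" "j \<in> ?I" "i \<noteq> j" for i j
      proof -
        have "cell_matrix \<sigma>' as' i j \<le> T"
          unfolding T_def
        proof (rule balanced_entry_bound[OF _ bal' _ ij])
          show "\<exists>t<length c. cell_matrix \<sigma>' as' (c ! t) (rotate1 c ! t) < n"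
            if "distinct c" "set c \<subseteq> ?I" "2 \<le> length c" for c
            by (rule n[OF \<sigma>' as'(2) dist' as'(1) that])
        qed simp_all
        then show ?thesis
          using counts[OF ij(1,2), of "cell_matrix \<sigma>' as' i j"] counts[OF ij(1,2), of "Suc (cell_matrix \<sigma>' as' i j)"]
          by simp
      qed
      \<comment> \<open>The diagonal entry may differ between the two matrices, but it occurs in
        both the row and the column sum and cancels.\<close>
      have "(\<Sum>j\<in>?I. cell_matrix \<sigma> as i j) = (\<Sum>j\<in>?I. cell_matrix \<sigma> as j i)" if i: "i \<in> ?I" for i
      proof -
        have fin: "finite ?I" by simp
        have "(\<Sum>j\<in>?I - {i}. cell_matrix \<sigma> as i j) = (\<Sum>j\<in>?I - {i}. cell_matrix \<sigma>' as' i j)"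
          using off[OF i] by (intro sum.cong refl) blast
        moreover have "(\<Sum>j\<in>?I - {i}. cell_matrix \<sigma> as j i) = (\<Sum>j\<in>?I - {i}. cell_matrix \<sigma>' as' j i)"
          using off[OF _ i] by (intro sum.cong refl) blast
        ultimately show ?thesis
          using bal'[OF i] sum.remove[OF fin i, of "\<lambda>j. cell_matrix \<sigma> as i j"] sum.remove[OF fin i, of "\<lambda>j. cell_matrix \<sigma> as j i"]
            sum.remove[OF fin i, of "\<lambda>j. cell_matrix \<sigma>' as' i j"] sum.remove[OF fin i, of "\<lambda>j. cell_matrix \<sigma>' as' j i"]
          by linarith
      qed
      then have "stable \<sigma> as" unfolding stable_iff_cell_matrix[OF \<sigma>p as(2,1)] by blast
      with dist show ?thesis by (simp add: union_of_cycles_def)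
    qed
    ultimately show ?thesis by blast
  qed
  ultimately show ?thesis by blast
qed

section \<open>Equivalence of definability and avoidance\<close>

theorem theorem5p11:
  fixes C :: "perm set" and k :: nat
  assumes "perm_class C" and "k \<ge> 1"
  shows "(\<exists>\<phi>. fv \<phi> \<subseteq> {1..k} \<and>
            (\<forall>\<sigma>\<in>C. \<forall>as. length as = k \<and> set as \<subseteq> points \<sigma> \<longrightarrow>
               (models \<sigma> as \<phi> \<longleftrightarrow> union_of_cycles \<sigma> as)))
     \<longleftrightarrow>
         (\<forall>\<pi> c Xs. \<pi> \<in> perms \<and> fst \<pi> = k \<and>
            distinct c \<and> set c \<subseteq> {1..k + 1} \<and> length c \<ge> 2 \<and>
            length Xs = length c \<and> set Xs \<subseteq> {increasing_perms, decreasing_perms} \<longrightarrow>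
            (\<exists>\<rho>\<in>expansion_class \<pi> c Xs. avoids C \<rho>))"
(is "?definable \<longleftrightarrow> ?avoids")
proof
  assume ?definable
  then obtain \<phi> where \<phi>: "fv \<phi> \<subseteq> {1..k}"
      "\<And>\<sigma> as. \<sigma> \<in> C \<Longrightarrow> length as = k \<Longrightarrow> set as \<subseteq> points \<sigma> \<Longrightarrow>
        models \<sigma> as \<phi> \<longleftrightarrow> union_of_cycles \<sigma> as"
    by blast
  show ?avoids
  proof (intro allI impI, elim conjE, rule ccontr)
    fix \<pi> c Xs
    assume *: "\<pi> \<in> perms" "fst \<pi> = k" "distinct c" "set c \<subseteq> {1..k + 1}" "2 \<le> length c"
      "length Xs = length c" "set Xs \<subseteq> {increasing_perms, decreasing_perms}"
      and no: "\<not> (\<exists>\<rho>\<in>expansion_class \<pi> c Xs. avoids C \<rho>)"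
    \<comment> \<open>Each member of the expansion class is contained in some permutation of C, and
      C is closed under patterns.\<close>
    have "expansion_class \<pi> c Xs \<subseteq> C"
    proof
      fix \<rho> assume \<rho>: "\<rho> \<in> expansion_class \<pi> c Xs"
      then obtain \<sigma> where \<sigma>: "\<sigma> \<in> C" "contains \<sigma> \<rho>" using no unfolding avoids_def by blast
      have "\<rho> \<in> perms" using \<rho> by (simp add: expansion_class_def)
      with assms(1) \<sigma> show "\<rho> \<in> C" by (simp add: perm_class_def)
    qed
    from not_definable[OF * this \<phi>] show False .
  qed
next
  assume avoids: ?avoids
  have av: "\<exists>\<rho>\<in>expansion_class \<pi> c Xs. avoids C \<rho>" if "(\<pi>, c, Xs) \<in> expansion_data k" for \<pi> c Xs
    by (rule avoids[rule_format]) (use that in \<open>simp add: expansion_data_def\<close>)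
  have C: "C \<subseteq> perms" using assms(1) by (simp add: perm_class_def)
  show ?definable
    by (rule no_large_cycle[OF C av], assumption) (rule definable[OF C])
qed

end
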